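(* Let $\{(\tilde{\mathbf p}^{(n)},\lambda^{(n)})\}$ be the sequence generated by the primal-dual domain decomposition method (Algorithm A, defined in the context). Then $(\tilde{\mathbf p}^{(n)},\lambda^{(n)})$ converges to a saddle point $(\tilde{\mathbf p}^*,\lambda^* )$ of $$\min_{\tilde{\mathbf p}\in\tilde Y}\ \max_{\lambda\in\mathbb R^{|\mathcal I_\Gamma|}}\ \mathcal L(\tilde{\mathbf p},\lambda),\qquad \mathcal L(\tilde{\mathbf p},\lambda)=\sum_{s=1}^{\mathcal N}\left\{\frac1\alpha F_s^*(\operatorname{div}\tilde{\mathbf p}_s)+\chi_{\tilde C_s}(\tilde{\mathbf p}_s)\right\}+\langle B\tilde{\mathbf p},\lambda\rangle_{\mathbb R^{|\mathcal I_\Gamma|}},$$ and it satisfies $$\mathcal L(\tilde{\mathbf p}_n,\lambda)-\mathcal L(\tilde{\mathbf p},\lambda_n)\le\frac1n\left(\frac1\tau\|\tilde{\mathbf p}-\tilde{\mathbf p}^{(0)}\|_{2,\tilde Y}^2+\frac1\sigma\|\lambda-\lambda^{(0)}\|_{2,\mathbb R^{|\mathcal I_\Gamma|}}^2\right)$$ for any $\tilde{\mathbf p}\in\tilde Y$ and $\lambda\in\mathbb R^{|\mathcal I_\Gamma|}$, where $\tilde{\mathbf p}_n=\frac1n\sum_{i=1}^n\tilde{\mathbf p}^{(i)}$ and $\lambda_n=\frac1n\sum_{i=1}^n\lambda^{(i)}$ are averages of the iterates (so $\tilde{\mathbf p}_n\in\tilde Y$ with index $n$ is not to be confused with the restriction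 $\tilde{\mathbf p}_s=\tilde{\mathbf p}|_{\Omega_s}$).
   Context: Spaces. $\Omega\subset\mathbb R^2$ is a rectangle divided into finitely many unit-square pixels; $\mathcal T$ is the set of pixels. $X$ is the space of functions on $\Omega$ that are constant on each pixel, identified with $\mathbb R^{\mathcal T}$ with the Euclidean inner product $\langle\cdot,\cdot\rangle_X$ and norm $\|\cdot\|_{2,X}$. $\Omega$ is decomposed into $\mathcal N=N\times N$ disjoint rectangular subdomains $\Omega_1,\dots,\Omega_{\mathcal N}$ whose interfaces do not cut through pixels. For $s<t$ with $\Omega_s,\Omega_t$ sharing a subdomain edge, $\Gamma_{st}=\partial\Omega_s\cap\partial\Omega_t$ and $\mathbf n_{st}$ is a fixed unit normal to $\Gamma_{st}$; $\Gamma=\bigcup_{s<t}\Gamma_{st}$. $\mathcal T_s$ is the set of pixels in $\Omega_s$, and $X_s$ is the space of functions on $\Omega_s$ constant on each $T\in\mathcal T_s$ (Euclidean inner product), so $X=\bigoplus_s X_s$; $R_s:X\to X_s$ is the restriction $R_su=u|_{\Omega_s}$. $\mathcal{RT}_0(T)$ is the set of fields $(x_1,x_2)\mapsto(a_1+b_1x_1,\,a_2+b_2x_2)$ on $T$. $Y=\{\mathbf q\in H_0(\operatorname{div};\Omega):\mathbf q|_T\in\mathcal{RT}_0(T)\ \forall T\in\mathcal T\}$, where $H_0(\operatorname{div};\Omega)$ consists of vector fields with divergence in $L^2(\Omega)$ and zero normal component on $\partial\Omega$. $\tilde Y_s=\{\tilde{\mathbf q}_s\in H(\operatorname{div};\Omega_s):\tilde{\mathbf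 q}_s\cdot\mathbf n_s=0\text{ on }\partial\Omega_s\setminus\Gamma,\ \tilde{\mathbf q}_s|_T\in\mathcal{RT}_0(T)\ \forall T\in\mathcal T_s\}$, with $\mathbf n_s$ the outer unit normal to $\partial\Omega_s$. Degrees of freedom (dofs) of $Y$ and $\tilde Y_s$ are the values of the normal component (for a fixed orientation of each edge) on pixel edges where it is not prescribed to vanish; thus $\tilde Y_s$ has dofs on the pixel edges in $\partial\Omega_s\cap\Gamma$. Inner products and norms on $Y,\tilde Y_s$ are the Euclidean ones of the dof vectors. $C\subset Y$ and $\tilde C_s\subset\tilde Y_s$ are the sets of fields all of whose dofs have absolute value at most $1$. $\tilde Y=\bigoplus_s\tilde Y_s$; $\tilde{\mathbf p}_s=\tilde{\mathbf p}|_{\Omega_s}$ for $\tilde{\mathbf p}\in\tilde Y$. $\mathcal I_\Gamma$ is the set of dofs of $Y$ on $\Gamma$. The jump operator $B:\tilde Y\to\mathbb R^{|\mathcal I_\Gamma|}$ is $B\tilde{\mathbf p}|_{\Gamma_{st}}=\tilde{\mathbf p}_s\cdot\mathbf n_{st}-\tilde{\mathbf p}_t\cdot\mathbf n_{st}$ ($s<t$), one value per pixel edge in $\Gamma$; $B^*$ is its adjoint. Conventions. $\chi_S$ is $0$ on $S$ and $+\infty$ off $S$. $F_s^*(v^* )=\sup_{v\in X_s}\{\langle v,v^*\rangle_{X_s}-F_s(v)\}$ denotes the Legendre–Fenchel conjugate. Model problem. $\alpha>0$, and $F:X\to\overline{\mathbb R}$ is proper, convex, lower semicontinuous with: (i)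 $F(u)=\sum_{s=1}^{\mathcal N}F_s(R_su)$ for proper, convex, lower semicontinuous $F_s:X_s\to\overline{\mathbb R}$; (ii) for any $u\in X$ and $\sigma>0$ the proximity operator $\operatorname{prox}_{\sigma F}(u)=\arg\min_{v\in X}\{F(v)+\frac1{2\sigma}\|v-u\|_{2,X}^2\}$ has a closed-form formula; (iii) $\operatorname{ri}(\operatorname{dom}F)\ne\emptyset$, where $\operatorname{dom}F=\{u:F(u)<\infty\}$ and $\operatorname{ri}$ is the relative interior. The model problem is $\min_{u\in X}\{\alpha F(u)+TV(u)\}$ with $TV(u)=\max_{\mathbf p\in C}\langle u,\operatorname{div}\mathbf p\rangle_X$. Algorithm A. Choose $L>2$ and $\tau,\sigma>0$ with $\tau\sigma=1/L$. Set $\tilde{\mathbf p}^{(0)}=\tilde{\mathbf p}^{(-1)}=\mathbf 0$, $\lambda^{(0)}=0$. For $n=0,1,2,\dots$: $\lambda^{(n+1)}=\lambda^{(n)}+\sigma B(2\tilde{\mathbf p}^{(n)}-\tilde{\mathbf p}^{(n-1)})$; $\hat{\mathbf p}^{(n+1)}=\tilde{\mathbf p}^{(n)}-\tau B^*\lambda^{(n+1)}$; for each $s=1,\dots,\mathcal N$ (in parallel), $(u_s^{(n+1)},\tilde{\mathbf p}_s^{(n+1)})$ is a solution of the saddle point problem $$\min_{u_s\in X_s}\max_{\tilde{\mathbf p}_s\in\tilde Y_s}\left\{-\langle u_s,\operatorname{div}\tilde{\mathbf p}_s\rangle_{X_s}+\alpha F_s(u_s)-\chi_{\tilde C_s}(\tilde{\mathbf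 p}_s)-\tfrac1{2\tau}\|\tilde{\mathbf p}_s-\hat{\mathbf p}^{(n+1)}|_{\Omega_s}\|_{2,\tilde Y_s}^2\right\};$$ $u^{(n+1)}=\bigoplus_{s}u_s^{(n+1)}$, $\tilde{\mathbf p}^{(n+1)}=\bigoplus_{s}\tilde{\mathbf p}_s^{(n+1)}$.
   Formalization: In L the term (1/α)F_s*(div p_s) is replaced by αF_s*(div p_s/α), the conjugate of αF_s, as the printed claim fails for α≠1; convergence to a saddle point is claimed only if the model problem attains its minimum (else L may have no saddle point). The estimate needs no such premise. *)

theory Defs
  imports "HOL-Analysis.Analysis"
begin

section \<open>Convex analysis with extended real values\<close>

text \<open>The spaces occurring below are linear subspaces of a Euclidean space, so functions live on the
  whole type and are only inspected on a set \<open>S\<close>.\<close>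

definition proper_on :: "'a set \<Rightarrow> ('a \<Rightarrow> ereal) \<Rightarrow> bool" where
  "proper_on S f \<longleftrightarrow> (\<forall>x\<in>S. f x \<noteq> -\<infinity>) \<and> (\<exists>x\<in>S. f x \<noteq> \<infinity>)"

definition ereal_convex_on :: "'a::real_vector set \<Rightarrow> ('a \<Rightarrow> ereal) \<Rightarrow> bool" where
  "ereal_convex_on S f \<longleftrightarrow>
     (\<forall>x\<in>S. \<forall>y\<in>S. \<forall>t\<in>{0<..<1::real}.
        f ((1 - t) *\<^sub>R x + t *\<^sub>R y) \<le> ereal (1 - t) * f x + ereal t * f y)"

definition lsc_on :: "'a::topological_space set \<Rightarrow> ('a \<Rightarrow> ereal) \<Rightarrow> bool" where
  "lsc_on S f \<longleftrightarrow> (\<forall>x\<in>S. f x \<le> Liminf (at x within S) f)"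

definition proper_convex_lsc_on :: "'a::real_normed_vector set \<Rightarrow> ('a \<Rightarrow> ereal) \<Rightarrow> bool" where
  "proper_convex_lsc_on S f \<longleftrightarrow> proper_on S f \<and> ereal_convex_on S f \<and> lsc_on S f"

definition fconj :: "'a::real_inner set \<Rightarrow> ('a \<Rightarrow> ereal) \<Rightarrow> 'a \<Rightarrow> ereal" where
  "fconj S f v = (SUP x\<in>S. ereal (x \<bullet> v) - f x)"

definition chi :: "'a set \<Rightarrow> 'a \<Rightarrow> ereal" where
  "chi S x = (if x \<in> S then 0 else \<infinity>)"

text \<open>\<open>(x, y)\<close> solves the problem: minimise over \<open>x \<in> A\<close>, maximise over \<open>y \<in> B\<close> the function \<open>K x y\<close>.\<close>

definition saddle_point :: "'a set \<Rightarrow> 'b set \<Rightarrow> ('a \<Rightarrow> 'b \<Rightarrow> ereal) \<Rightarrow> 'a \<Rightarrow> 'b \<Rightarrow> bool" where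
  "saddle_point A B K x y \<longleftrightarrow>
     x \<in> A \<and> y \<in> B \<and> (\<forall>y'\<in>B. K x y' \<le> K x y) \<and> (\<forall>x'\<in>A. K x y \<le> K x' y)"


section \<open>The space H(div)\<close>

definition L2_on :: "'a::euclidean_space set \<Rightarrow> ('a \<Rightarrow> 'b::{second_countable_topology,banach}) set" where
  "L2_on U = {f. set_borel_measurable lborel U f \<and> set_integrable lborel U (\<lambda>x. (norm (f x))\<^sup>2)}"

text \<open>\<open>G\<close> is the gradient of \<open>\<phi>\<close>.  Testing with compactly supported functions of class \<open>C\<^sup>1\<close> gives the
  same weak divergence as testing with smooth ones, by density.\<close>

definition test_function :: "'a::euclidean_space set \<Rightarrow> ('a \<Rightarrow> real) \<Rightarrow> ('a \<Rightarrow> 'a) \<Rightarrow> bool" where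
  "test_function U \<phi> G \<longleftrightarrow>
     (\<forall>x. GDERIV \<phi> x :> G x) \<and> continuous_on UNIV G \<and>
     (\<exists>K. compact K \<and> K \<subseteq> U \<and> (\<forall>x. x \<notin> K \<longrightarrow> \<phi> x = 0))"

definition Hdiv :: "'a::euclidean_space set \<Rightarrow> ('a \<Rightarrow> 'a) set" where
  "Hdiv U = {q \<in> L2_on U. \<exists>g \<in> L2_on U. \<forall>\<phi> G. test_function U \<phi> G \<longrightarrow>
     (LINT x:U|lborel. q x \<bullet> G x) = - (LINT x:U|lborel. g x * \<phi> x)}"


section \<open>Pixels, pixel edges and subdomains\<close>

text \<open>Pixels are the elements of a finite type \<open>'p\<close>, so that \<open>X\<close> is \<open>real ^ 'p\<close>.  The pixel with lower
  left corner \<open>(i, j)\<close> is the square \<open>[i, i+1] \<times> [j, j+1]\<close>, and the domain is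
  \<open>(0, width) \<times> (0, height)\<close>.  The subdomains have indices in \<open>{1..N * N}\<close>; subdomain \<open>s\<close> is
  the open rectangle with lower left corner \<open>sub_lo s\<close> and upper right corner \<open>sub_hi s\<close>; \<open>nrm s t\<close> is
  the unit normal to the interface of \<open>s\<close> and \<open>t\<close>.\<close>

record 'p decomp =
  width :: nat
  height :: nat
  corner :: "'p \<Rightarrow> nat \<times> nat"
  N :: nat
  sub_lo :: "nat \<Rightarrow> nat \<times> nat"
  sub_hi :: "nat \<Rightarrow> nat \<times> nat"
  nrm :: "nat \<Rightarrow> nat \<Rightarrow> real \<times> real"

definition open_rect :: "nat \<times> nat \<Rightarrow> nat \<times> nat \<Rightarrow> (real \<times> real) set" where
  "open_rect a b = {real (fst a)<..<real (fst b)} \<times> {real (snd a)<..<real (snd b)}"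

definition Omega :: "'p decomp \<Rightarrow> (real \<times> real) set" where
  "Omega D = open_rect (0, 0) (width D, height D)"

definition Omega_sub :: "'p decomp \<Rightarrow> nat \<Rightarrow> (real \<times> real) set" where
  "Omega_sub D s = open_rect (sub_lo D s) (sub_hi D s)"

definition subs :: "'p decomp \<Rightarrow> nat set" where
  "subs D = {1..N D * N D}"

definition pixels :: "'p decomp \<Rightarrow> nat \<Rightarrow> 'p set" where
  "pixels D s = {T. fst (sub_lo D s) \<le> fst (corner D T) \<and> fst (corner D T) < fst (sub_hi D s) \<and>
                    snd (sub_lo D s) \<le> snd (corner D T) \<and> snd (corner D T) < snd (sub_hi D s)}"

text \<open>\<open>VEdge i j\<close> is the segment \<open>{i} \<times> [j, j+1]\<close> and \<open>HEdge i j\<close> is the segment \<open>[i, i+1] \<times> {j}\<close>.\<close>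

datatype edge = VEdge nat nat | HEdge nat nat

fun edge_mid :: "edge \<Rightarrow> real \<times> real" where
  "edge_mid (VEdge i j) = (real i, real j + 1/2)"
| "edge_mid (HEdge i j) = (real i + 1/2, real j)"

fun edge_normal :: "edge \<Rightarrow> real \<times> real" where
  "edge_normal (VEdge i j) = (1, 0)"
| "edge_normal (HEdge i j) = (0, 1)"

fun edge_of_square :: "edge \<Rightarrow> nat \<times> nat \<Rightarrow> bool" where
  "edge_of_square (VEdge i j) (k, l) \<longleftrightarrow> l = j \<and> (k = i \<or> Suc k = i)"
| "edge_of_square (HEdge i j) (k, l) \<longleftrightarrow> k = i \<and> (l = j \<or> Suc l = j)"

definition pixel_edge :: "'p decomp \<Rightarrow> edge \<Rightarrow> 'p \<Rightarrow> bool" where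
  "pixel_edge D e T \<longleftrightarrow> edge_of_square e (corner D T)"

definition edges :: "'p decomp \<Rightarrow> 'p set \<Rightarrow> edge set" where
  "edges D S = {e. \<exists>T\<in>S. pixel_edge D e T}"

definition boundary_edges :: "'p decomp \<Rightarrow> 'p set \<Rightarrow> edge set" where
  "boundary_edges D S = {e. \<exists>!T. T \<in> S \<and> pixel_edge D e T}"

definition Gamma_st :: "'p decomp \<Rightarrow> nat \<Rightarrow> nat \<Rightarrow> edge set" where
  "Gamma_st D s t = boundary_edges D (pixels D s) \<inter> boundary_edges D (pixels D t)"

text \<open>The pixel edges in \<open>\<Gamma>\<close>.  There is one degree of freedom of \<open>Y\<close> on each of them, so this is also the
  index set \<open>\<I>\<^sub>\<Gamma>\<close>.\<close>

definition Gamma :: "'p decomp \<Rightarrow> edge set" where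
  "Gamma D = (\<Union>s\<in>subs D. \<Union>t\<in>{t \<in> subs D. s < t}. Gamma_st D s t)"

definition decomposition :: "'p decomp \<Rightarrow> bool" where
  "decomposition D \<longleftrightarrow>
     bij_betw (corner D) UNIV ({..<width D} \<times> {..<height D}) \<and>
     0 < N D \<and>
     (\<forall>s\<in>subs D. fst (sub_lo D s) < fst (sub_hi D s) \<and> fst (sub_hi D s) \<le> width D \<and>
                  snd (sub_lo D s) < snd (sub_hi D s) \<and> snd (sub_hi D s) \<le> height D) \<and>
     (\<forall>T. \<exists>!s. s \<in> subs D \<and> T \<in> pixels D s) \<and>
     (\<forall>s\<in>subs D. \<forall>t\<in>subs D. s < t \<longrightarrow>
        (\<forall>e\<in>Gamma_st D s t. nrm D s t = edge_normal e \<or> nrm D s t = - edge_normal e))"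


section \<open>Discrete function spaces\<close>

text \<open>Functions on a subdomain are identified with their extensions by zero to all pixels.  Hence \<open>X\<^sub>s\<close> is
  a subspace of \<open>real ^ 'p\<close>, restriction is \<open>restr\<close>, and \<open>X = \<Oplus>\<^sub>s X\<^sub>s\<close> is an internal direct sum.\<close>

definition restr :: "'p::finite set \<Rightarrow> 'a::zero ^ 'p \<Rightarrow> 'a ^ 'p" where
  "restr S q = (\<chi> T. if T \<in> S then q $ T else 0)"

definition X_sub :: "'p::finite decomp \<Rightarrow> nat \<Rightarrow> (real ^ 'p) set" where
  "X_sub D s = {u. \<forall>T. T \<notin> pixels D s \<longrightarrow> u $ T = 0}"

text \<open>\<open>((a\<^sub>1, b\<^sub>1), (a\<^sub>2, b\<^sub>2))\<close> stands for the field \<open>(x\<^sub>1, x\<^sub>2) \<mapsto> (a\<^sub>1 + b\<^sub>1 x\<^sub>1, a\<^sub>2 + b\<^sub>2 x\<^sub>2)\<close>.  An element of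
  \<open>rt0 ^ 'p\<close> is a field that is piecewise of this form.\<close>

type_synonym rt0 = "(real \<times> real) \<times> (real \<times> real)"

fun rt0_eval :: "rt0 \<Rightarrow> real \<times> real \<Rightarrow> real \<times> real" where
  "rt0_eval ((a1, b1), (a2, b2)) (x1, x2) = (a1 + b1 * x1, a2 + b2 * x2)"

fun rt0_div :: "rt0 \<Rightarrow> real" where
  "rt0_div ((a1, b1), (a2, b2)) = b1 + b2"

definition divp :: "rt0 ^ 'p \<Rightarrow> real ^ 'p::finite" where
  "divp q = (\<chi> T. rt0_div (q $ T))"

text \<open>Half-open cells only fix the values on the pixel edges, a null set.\<close>

definition cell :: "nat \<times> nat \<Rightarrow> (real \<times> real) set" where
  "cell c = {real (fst c)..<real (fst c) + 1} \<times> {real (snd c)..<real (snd c) + 1}"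

definition field :: "'p::finite decomp \<Rightarrow> rt0 ^ 'p \<Rightarrow> real \<times> real \<Rightarrow> real \<times> real" where
  "field D q x = (\<Sum>T\<in>UNIV. indicator (cell (corner D T)) x *\<^sub>R rt0_eval (q $ T) x)"

text \<open>The normal component of a field of lowest order is constant on each pixel edge, so it is read off at
  the midpoint.  \<open>edge_trace D S q e v\<close> is the component along \<open>v\<close> on the edge \<open>e\<close>, seen from a pixel in \<open>S\<close>; if
  both neighbours of \<open>e\<close> lie in \<open>S\<close> and \<open>q\<close> is in \<open>H(div)\<close>, the two one-sided normal components agree.\<close>

definition edge_trace :: "'p::finite decomp \<Rightarrow> 'p set \<Rightarrow> rt0 ^ 'p \<Rightarrow> edge \<Rightarrow> real \<times> real \<Rightarrow> real" where
  "edge_trace D S q e v = rt0_eval (q $ (SOME T. T \<in> S \<and> pixel_edge D e T)) (edge_mid e) \<bullet> v"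

text \<open>The space on the union of the pixels in \<open>S\<close>, whose interior is \<open>U\<close>, with zero normal component on
  the boundary edges in \<open>Z\<close>.\<close>

definition RT_space ::
    "'p::finite decomp \<Rightarrow> 'p set \<Rightarrow> (real \<times> real) set \<Rightarrow> edge set \<Rightarrow> (rt0 ^ 'p) set" where
  "RT_space D S U Z = {q. (\<forall>T. T \<notin> S \<longrightarrow> q $ T = 0) \<and> field D q \<in> Hdiv U \<and>
                          (\<forall>e\<in>Z. edge_trace D S q e (edge_normal e) = 0)}"

definition Y_space :: "'p::finite decomp \<Rightarrow> (rt0 ^ 'p) set" where
  "Y_space D = RT_space D UNIV (Omega D) (boundary_edges D UNIV)"

definition Yt_sub :: "'p::finite decomp \<Rightarrow> nat \<Rightarrow> (rt0 ^ 'p) set" where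
  "Yt_sub D s =
     RT_space D (pixels D s) (Omega_sub D s) (boundary_edges D (pixels D s) - Gamma D)"

definition Yt :: "'p::finite decomp \<Rightarrow> (rt0 ^ 'p) set" where
  "Yt D = {q. \<forall>s\<in>subs D. restr (pixels D s) q \<in> Yt_sub D s}"

definition dof :: "'p::finite decomp \<Rightarrow> 'p set \<Rightarrow> rt0 ^ 'p \<Rightarrow> edge \<Rightarrow> real" where
  "dof D S q e = edge_trace D S q e (edge_normal e)"

definition dofs_Y :: "'p::finite decomp \<Rightarrow> edge set" where
  "dofs_Y D = edges D UNIV - boundary_edges D UNIV"

definition dofs_Yt_sub :: "'p::finite decomp \<Rightarrow> nat \<Rightarrow> edge set" where
  "dofs_Yt_sub D s = edges D (pixels D s) - (boundary_edges D (pixels D s) - Gamma D)"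

definition C_set :: "'p::finite decomp \<Rightarrow> (rt0 ^ 'p) set" where
  "C_set D = {q \<in> Y_space D. \<forall>e\<in>dofs_Y D. \<bar>dof D UNIV q e\<bar> \<le> 1}"

definition Ct_sub :: "'p::finite decomp \<Rightarrow> nat \<Rightarrow> (rt0 ^ 'p) set" where
  "Ct_sub D s = {q \<in> Yt_sub D s. \<forall>e\<in>dofs_Yt_sub D s. \<bar>dof D (pixels D s) q e\<bar> \<le> 1}"

definition inner_Yt_sub :: "'p::finite decomp \<Rightarrow> nat \<Rightarrow> rt0 ^ 'p \<Rightarrow> rt0 ^ 'p \<Rightarrow> real" where
  "inner_Yt_sub D s p q = (\<Sum>e\<in>dofs_Yt_sub D s. dof D (pixels D s) p e * dof D (pixels D s) q e)"

definition norm_Yt_sub :: "'p::finite decomp \<Rightarrow> nat \<Rightarrow> rt0 ^ 'p \<Rightarrow> real" where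
  "norm_Yt_sub D s p = sqrt (inner_Yt_sub D s p p)"

definition inner_Yt :: "'p::finite decomp \<Rightarrow> rt0 ^ 'p \<Rightarrow> rt0 ^ 'p \<Rightarrow> real" where
  "inner_Yt D p q = (\<Sum>s\<in>subs D. inner_Yt_sub D s (restr (pixels D s) p) (restr (pixels D s) q))"

definition norm_Yt :: "'p::finite decomp \<Rightarrow> rt0 ^ 'p \<Rightarrow> real" where
  "norm_Yt D p = sqrt (inner_Yt D p p)"

text \<open>Multipliers are functions on edges of which only the values on \<open>Gamma D\<close> are ever relevant.\<close>

definition inner_Gamma :: "'p decomp \<Rightarrow> (edge \<Rightarrow> real) \<Rightarrow> (edge \<Rightarrow> real) \<Rightarrow> real" where
  "inner_Gamma D l m = (\<Sum>e\<in>Gamma D. l e * m e)"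

definition norm_Gamma :: "'p decomp \<Rightarrow> (edge \<Rightarrow> real) \<Rightarrow> real" where
  "norm_Gamma D l = sqrt (inner_Gamma D l l)"

text \<open>For \<open>e\<close> in \<open>Gamma D\<close> the sum has exactly one term.\<close>

definition jump :: "'p::finite decomp \<Rightarrow> rt0 ^ 'p \<Rightarrow> edge \<Rightarrow> real" where
  "jump D p e =
     (\<Sum>(s, t) \<in> {(s, t). s \<in> subs D \<and> t \<in> subs D \<and> s < t \<and> e \<in> Gamma_st D s t}.
        edge_trace D (pixels D s) (restr (pixels D s) p) e (nrm D s t)
        - edge_trace D (pixels D t) (restr (pixels D t) p) e (nrm D s t))"

definition jump_adj :: "'p::finite decomp \<Rightarrow> (edge \<Rightarrow> real) \<Rightarrow> rt0 ^ 'p" where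
  "jump_adj D l = (THE w. w \<in> Yt D \<and> (\<forall>p\<in>Yt D. inner_Gamma D (jump D p) l = inner_Yt D p w))"


section \<open>Model problem, algorithm and Lagrangian\<close>

definition TV :: "'p::finite decomp \<Rightarrow> real ^ 'p \<Rightarrow> real" where
  "TV D u = (SUP p\<in>C_set D. u \<bullet> divp p)"

definition model_minimizer ::
    "'p::finite decomp \<Rightarrow> real \<Rightarrow> (real ^ 'p \<Rightarrow> ereal) \<Rightarrow> real ^ 'p \<Rightarrow> bool" where
  "model_minimizer D \<alpha> F u \<longleftrightarrow>
     (\<forall>v. ereal \<alpha> * F u + ereal (TV D u) \<le> ereal \<alpha> * F v + ereal (TV D v))"

definition local_functional ::
    "'p::finite decomp \<Rightarrow> real \<Rightarrow> real \<Rightarrow> (nat \<Rightarrow> real ^ 'p \<Rightarrow> ereal) \<Rightarrow> nat \<Rightarrow> rt0 ^ 'p \<Rightarrow>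
      real ^ 'p \<Rightarrow> rt0 ^ 'p \<Rightarrow> ereal" where
  "local_functional D \<alpha> \<tau> Fs s phat u p =
     ereal (- (u \<bullet> divp p)) + ereal \<alpha> * Fs s u - chi (Ct_sub D s) p
     - ereal (1 / (2 * \<tau>) * (norm_Yt_sub D s (p - restr (pixels D s) phat))\<^sup>2)"

definition generated_by_algorithm ::
    "'p::finite decomp \<Rightarrow> real \<Rightarrow> real \<Rightarrow> real \<Rightarrow> (nat \<Rightarrow> real ^ 'p \<Rightarrow> ereal) \<Rightarrow>
      (nat \<Rightarrow> real ^ 'p) \<Rightarrow> (nat \<Rightarrow> rt0 ^ 'p) \<Rightarrow> (nat \<Rightarrow> edge \<Rightarrow> real) \<Rightarrow> bool" where
  "generated_by_algorithm D \<alpha> \<tau> \<sigma> Fs u p lam \<longleftrightarrow>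
     p 0 = 0 \<and> lam 0 = (\<lambda>e. 0) \<and>
     (\<forall>n. let p_prev = (if n = 0 then 0 else p (n - 1));
              phat = p n - \<tau> *\<^sub>R jump_adj D (lam (Suc n))
          in lam (Suc n) = (\<lambda>e. lam n e + \<sigma> * jump D (2 *\<^sub>R p n - p_prev) e) \<and>
             (\<forall>s\<in>subs D. saddle_point (X_sub D s) (Yt_sub D s)
                (local_functional D \<alpha> \<tau> Fs s phat)
                (restr (pixels D s) (u (Suc n))) (restr (pixels D s) (p (Suc n)))))"

text \<open>The first term is the conjugate \<open>(\<alpha> F\<^sub>s)\<^sup>*(v) = \<alpha> F\<^sub>s\<^sup>*(v / \<alpha>)\<close> at \<open>v = div p\<^sub>s\<close>, which is what
  minimising \<open>\<alpha> F\<^sub>s(u) - \<langle>u, v\<rangle>\<close> over \<open>u\<close> in the local problems produces, up to sign.  The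
  expression \<open>(1/\<alpha>) F\<^sub>s\<^sup>*(v)\<close> agrees with it if \<open>\<alpha> = 1\<close> or \<open>F\<^sub>s\<^sup>*\<close> is homogeneous of degree 2, but not
  in general.\<close>

definition Lagrangian ::
    "'p::finite decomp \<Rightarrow> real \<Rightarrow> (nat \<Rightarrow> real ^ 'p \<Rightarrow> ereal) \<Rightarrow> rt0 ^ 'p \<Rightarrow> (edge \<Rightarrow> real) \<Rightarrow> ereal" where
  "Lagrangian D \<alpha> Fs p l =
     (\<Sum>s\<in>subs D. ereal \<alpha> * fconj (X_sub D s) (Fs s) ((1 / \<alpha>) *\<^sub>R divp (restr (pixels D s) p))
                  + chi (Ct_sub D s) (restr (pixels D s) p))
     + ereal (inner_Gamma D (jump D p) l)"

end

theory Submission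
  imports Defs
begin

text \<open>The method is a primal-dual iteration of Chambolle-Pock type for the Lagrangian.  Minimising the
local objective over \<open>u\<^sub>s\<close> turns its first two terms into \<open>- (\<alpha> F\<^sub>s)\<^sup>*(div p\<^sub>s)\<close>, so all local problems
together perform one proximal step for the dual energy \<open>g p = \<Sum>\<^sub>s (\<alpha> F\<^sub>s)\<^sup>*(div p\<^sub>s)\<close> on the box of
fields with degrees of freedom in \<open>[-1, 1]\<close>, tilted by the coupling \<open>\<langle>B p, \<lambda>\<rangle>\<close> with the new multiplier
(\<open>algorithm_step\<close>).  The update of \<open>\<lambda>\<close> is a gradient step for the coupling at the extrapolated field.

Rate and convergence both come from an energy of the \<open>n\<close>-th iterate relative to a reference pair
\<open>(q, l)\<close>: its decrease in one step dominates the duality gap of the new iterate plus a fixed multiple of the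
squared lengths of the last steps (\<open>energy_descent\<close>).  Summation and convexity give the ergodic bound.  Relative to a
saddle point the gap is nonnegative, so the steps are square summable and the iterates bounded; a
cluster point turns out to be a saddle point, the energy relative to it decreases and has a
subsequence tending to 0, hence tends to 0 (\<open>convergence\<close>).  What makes the energy control the distance is
\<open>\<tau> \<sigma> \<parallel>B\<parallel>\<^sup>2 < 1\<close>, which holds since every jump is a difference of two degrees of freedom, so that
\<open>\<parallel>B\<parallel>\<^sup>2 \<le> 2 < L\<close> (\<open>jump_bound\<close>).

A saddle point is obtained from a minimiser \<open>u\<close> of the model problem.  A separation argument gives a
field \<open>p\<^sup>*\<close> in \<open>C\<close> such that \<open>u\<close> minimises \<open>\<alpha> F - \<langle>\<cdot>, div p\<^sup>*\<rangle>\<close> and \<open>p\<^sup>*\<close> minimises \<open>\<langle>u, div \<cdot>\<rangle>\<close> on \<open>C\<close>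
(\<open>support_point_of_minimizer\<close>).  The multiplier that lets \<open>p\<^sup>*\<close> compete with fields that jump across the
interfaces is explicit: averaging the two normal components of such a field at every interface edge
produces an element of \<open>C\<close> and changes \<open>\<langle>u, div p\<rangle>\<close> by exactly \<open>\<langle>B p, \<lambda>\<^sup>*\<rangle>\<close>, where \<open>\<lambda>\<^sup>*\<close> is, up to sign,
the mean of the two values of \<open>u\<close> next to the edge (\<open>multiplier_for_averaging\<close>).

All of this needs the spaces in terms of degrees of freedom, that is, that a field which is of lowest
order on every pixel lies in \<open>H(div)\<close> of a rectangle if and only if its normal components agree across
all interior edges (\<open>Hdiv_iff\<close>).  One direction is Green's formula on every pixel; for the other, the weak
divergence is tested with functions that concentrate at a single edge.\<close>

section \<open>An abstract primal-dual iteration\<close>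

text \<open>The primal variable lives in a Euclidean space that carries a second, possibly degenerate, inner
product \<open>ip\<close>; the dual variable is a function of which only the values on the finite set \<open>A\<close> matter.
\<open>K\<close> is a bound for \<open>\<parallel>B\<parallel>\<^sup>2\<close>, and \<open>c < 1\<close> quantifies the slack in \<open>\<tau> \<sigma> K < 1\<close>.  The primal step is given
by the variational inequality of the proximal point, so that neither the adjoint of \<open>B\<close> nor the
proximal map occurs.  At \<open>n = 0\<close> the truncated index \<open>n - 1 = 0\<close> makes the extrapolated point \<open>p 0 = 0\<close>.\<close>

locale primal_dual_iteration =
  fixes Dom :: "'a::euclidean_space set" and g :: "'a \<Rightarrow> real"
    and ip :: "'a \<Rightarrow> 'a \<Rightarrow> real" and A :: "'e set" and B :: "'a \<Rightarrow> 'e \<Rightarrow> real"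
    and \<tau> \<sigma> K c :: real and p :: "nat \<Rightarrow> 'a" and lam :: "nat \<Rightarrow> 'e \<Rightarrow> real"
  assumes finite_A: "finite A"
    and ip_bilinear: "bilinear ip" and ip_sym: "\<And>x y. ip x y = ip y x"
    and ip_nonneg: "\<And>x. 0 \<le> ip x x"
    and B_linear: "\<And>e. linear (\<lambda>x. B x e)"
    and B_bound: "\<And>x. (\<Sum>e\<in>A. (B x e)\<^sup>2) \<le> K * ip x x"
    and \<tau>_pos: "0 < \<tau>" and \<sigma>_pos: "0 < \<sigma>"
    and c_pos: "0 < c" and c_less_1: "c < 1" and step_sizes: "\<tau> * \<sigma> * K \<le> c\<^sup>2"
    and p_0: "p 0 = 0"
    and p_Dom: "\<And>n. p (Suc n) \<in> Dom"
    and dual_step: "\<And>n e. e \<in> A \<Longrightarrow>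
      lam (Suc n) e = lam n e + \<sigma> * B (2 *\<^sub>R p n - p (n - 1)) e"
    and primal_step: "\<And>n q. q \<in> Dom \<Longrightarrow>
      g (p (Suc n)) + (1 / \<tau>) * ip (p n - p (Suc n)) (q - p (Suc n))
        \<le> g q + (\<Sum>e\<in>A. B (q - p (Suc n)) e * lam (Suc n) e)"
begin

definition sqnorm :: "'a \<Rightarrow> real" where "sqnorm x = ip x x"
definition dual_sqnorm :: "('e \<Rightarrow> real) \<Rightarrow> real" where "dual_sqnorm l = (\<Sum>e\<in>A. (l e)\<^sup>2)"
definition pairing :: "'a \<Rightarrow> ('e \<Rightarrow> real) \<Rightarrow> real" where "pairing x l = (\<Sum>e\<in>A. B x e * l e)"
definition lagr :: "'a \<Rightarrow> ('e \<Rightarrow> real) \<Rightarrow> real" where "lagr x l = g x + pairing x l"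
definition increment :: "nat \<Rightarrow> 'a" where "increment n = p n - p (n - 1)"

text \<open>The distance of the iterate to \<open>(q, l)\<close>, corrected by terms that account for the dual step having used
an extrapolated primal point.\<close>

definition energy :: "nat \<Rightarrow> 'a \<Rightarrow> ('e \<Rightarrow> real) \<Rightarrow> real" where
  "energy n q l = sqnorm (q - p n) / (2 * \<tau>) + dual_sqnorm (\<lambda>e. l e - lam n e) / (2 * \<sigma>)
     + sqnorm (increment n) / (2 * \<tau>) - pairing (increment n) (\<lambda>e. l e - lam n e)"

lemma sqnorm_nonneg: "0 \<le> sqnorm x"
  by (simp add: sqnorm_def ip_nonneg)

lemma dual_sqnorm_nonneg: "0 \<le> dual_sqnorm l"
  by (simp add: dual_sqnorm_def sum_nonneg)

lemmas ip_expand = bilinear_ladd[OF ip_bilinear] bilinear_radd[OF ip_bilinear]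
  bilinear_lsub[OF ip_bilinear] bilinear_rsub[OF ip_bilinear]

lemma Cauchy_Schwarz: "\<bar>ip x y\<bar> \<le> sqrt (sqnorm x) * sqrt (sqnorm y)"
proof -
  have quad: "0 \<le> sqnorm x - 2 * t * ip x y + t\<^sup>2 * sqnorm y" for t
    using sqnorm_nonneg[of "x - t *\<^sub>R y"] ip_sym[of x y] unfolding sqnorm_def ip_expand
    by (simp add: bilinear_lmul[OF ip_bilinear] bilinear_rmul[OF ip_bilinear] power2_eq_square)
  have "(ip x y)\<^sup>2 \<le> sqnorm x * sqnorm y"
  proof (cases "sqnorm y = 0")
    case True
    \<comment> \<open>a nonzero value would make the quadratic negative at this \<open>t\<close>\<close>
    have "ip x y = 0"
      using quad[of "(sqnorm x + 1) / (2 * ip x y)"] True by (cases "ip x y = 0") auto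
    with True show ?thesis by simp
  next
    case False
    then have "0 < sqnorm y" using sqnorm_nonneg[of y] by simp
    with quad[of "ip x y / sqnorm y"] show ?thesis by (simp add: field_simps power2_eq_square)
  qed
  then show ?thesis by (metis real_sqrt_abs real_sqrt_le_mono real_sqrt_mult)
qed

lemma polarisation: "ip (a - b) (q - b) = (sqnorm (b - a) + sqnorm (q - b) - sqnorm (q - a)) / 2"
  unfolding sqnorm_def ip_expand using ip_sym[of a b] ip_sym[of a q] ip_sym[of b q] by simp

lemma pairing_diff: "pairing (x - y) l = pairing x l - pairing y l"
  by (simp add: pairing_def linear_diff[OF B_linear] algebra_simps sum_subtractf)

lemma pairing_diff_right: "pairing x (\<lambda>e. l e - m e) = pairing x l - pairing x m"
  by (simp add: pairing_def algebra_simps sum_subtractf)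

text \<open>Young's inequality with weights chosen such that the coupling is absorbed by the fraction \<open>c\<close> of the
squared lengths, in the metric in which the step sizes measure.\<close>

lemma young: "pairing x l \<le> c / 2 * (sqnorm x / \<tau> + dual_sqnorm l / \<sigma>)"
proof -
  have pt: "B x e * l e \<le> \<sigma> / (2 * c) * (B x e)\<^sup>2 + c / (2 * \<sigma>) * (l e)\<^sup>2" for e
  proof -
    have "0 \<le> (\<sigma> * B x e - c * l e)\<^sup>2 / (2 * c * \<sigma>)"
      using \<sigma>_pos c_pos by simp
    also have "\<dots> = \<sigma> / (2 * c) * (B x e)\<^sup>2 + c / (2 * \<sigma>) * (l e)\<^sup>2 - B x e * l e"
      using \<sigma>_pos c_pos by (simp add: field_simps power2_eq_square)
    finally show ?thesis by simp
  qed
  have "pairing x l \<le> (\<Sum>e\<in>A. \<sigma> / (2 * c) * (B x e)\<^sup>2 + c / (2 * \<sigma>) * (l e)\<^sup>2)"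
    unfolding pairing_def by (intro sum_mono pt)
  also have "\<dots> = \<sigma> / (2 * c) * (\<Sum>e\<in>A. (B x e)\<^sup>2) + c / (2 * \<sigma>) * dual_sqnorm l"
    by (simp add: sum.distrib sum_distrib_left dual_sqnorm_def)
  also have "\<sigma> / (2 * c) * (\<Sum>e\<in>A. (B x e)\<^sup>2) \<le> \<sigma> / (2 * c) * (K * sqnorm x)"
    using B_bound[of x] \<sigma>_pos c_pos by (intro mult_left_mono) (auto simp: sqnorm_def)
  also have "\<sigma> / (2 * c) * (K * sqnorm x) = (\<tau> * \<sigma> * K) * (sqnorm x / (2 * c * \<tau>))"
    using \<tau>_pos c_pos by (simp add: field_simps)
  also have "\<dots> \<le> c\<^sup>2 * (sqnorm x / (2 * c * \<tau>))"
    using step_sizes \<tau>_pos c_pos sqnorm_nonneg by (intro mult_right_mono) auto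
  also have "\<dots> = c / 2 * (sqnorm x / \<tau>)"
    using \<tau>_pos c_pos by (simp add: field_simps power2_eq_square)
  finally show ?thesis by (simp add: algebra_simps)
qed

text \<open>The dual step solved for \<open>B\<close> at the new point: the extrapolation error consists of a term that
telescopes and of \<open>pairing (increment n)\<close>, which is small by Young's inequality.\<close>

lemma dual_identity:
  "pairing (p (Suc n)) (\<lambda>e. l e - lam (Suc n) e) =
     (dual_sqnorm (\<lambda>e. l e - lam n e) - dual_sqnorm (\<lambda>e. l e - lam (Suc n) e)
        - dual_sqnorm (\<lambda>e. lam (Suc n) e - lam n e)) / (2 * \<sigma>)
     + pairing (increment (Suc n)) (\<lambda>e. l e - lam (Suc n) e) - pairing (increment n) (\<lambda>e. l e - lam n e)
     + pairing (increment n) (\<lambda>e. lam (Suc n) e - lam n e)"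
proof -
  have "B (p (Suc n)) e * (l e - lam (Suc n) e) =
     ((l e - lam n e)\<^sup>2 - (l e - lam (Suc n) e)\<^sup>2 - (lam (Suc n) e - lam n e)\<^sup>2) / (2 * \<sigma>)
     + B (increment (Suc n)) e * (l e - lam (Suc n) e) - B (increment n) e * (l e - lam n e)
     + B (increment n) e * (lam (Suc n) e - lam n e)" if "e \<in> A" for e
  proof -
    define b where "b = B (p n) e + B (increment n) e"
    have "B (2 *\<^sub>R p n - p (n - 1)) e = b"
      by (simp add: b_def increment_def linear_diff[OF B_linear] linear_scale[OF B_linear])
    then have eq: "lam (Suc n) e - lam n e = \<sigma> * b"
      using dual_step[OF that, of n] by simp
    have "(l e - lam n e)\<^sup>2 - (l e - lam (Suc n) e)\<^sup>2 - (lam (Suc n) e - lam n e)\<^sup>2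
        = 2 * (lam (Suc n) e - lam n e) * (l e - lam (Suc n) e)"
      by (simp add: power2_eq_square algebra_simps)
    then have "((l e - lam n e)\<^sup>2 - (l e - lam (Suc n) e)\<^sup>2 - (lam (Suc n) e - lam n e)\<^sup>2) / (2 * \<sigma>)
        = b * (l e - lam (Suc n) e)"
      unfolding eq using \<sigma>_pos by simp
    then show ?thesis
      by (simp add: b_def increment_def linear_diff[OF B_linear] algebra_simps)
  qed
  then have "pairing (p (Suc n)) (\<lambda>e. l e - lam (Suc n) e) = (\<Sum>e\<in>A.
     ((l e - lam n e)\<^sup>2 - (l e - lam (Suc n) e)\<^sup>2 - (lam (Suc n) e - lam n e)\<^sup>2) / (2 * \<sigma>)
     + B (increment (Suc n)) e * (l e - lam (Suc n) e) - B (increment n) e * (l e - lam n e)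
     + B (increment n) e * (lam (Suc n) e - lam n e))"
    unfolding pairing_def by (intro sum.cong) auto
  also have "\<dots> = (dual_sqnorm (\<lambda>e. l e - lam n e) - dual_sqnorm (\<lambda>e. l e - lam (Suc n) e)
        - dual_sqnorm (\<lambda>e. lam (Suc n) e - lam n e)) / (2 * \<sigma>)
     + pairing (increment (Suc n)) (\<lambda>e. l e - lam (Suc n) e) - pairing (increment n) (\<lambda>e. l e - lam n e)
     + pairing (increment n) (\<lambda>e. lam (Suc n) e - lam n e)"
    unfolding dual_sqnorm_def pairing_def sum_divide_distrib sum_subtractf[symmetric] sum.distrib[symmetric]
    by simp
  finally show ?thesis .
qed

text \<open>The three-point identities of the primal and of the dual step add up to the difference of the energies;
Young's inequality leaves the fraction \<open>1 - c\<close> of the squared steps.\<close>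

lemma energy_descent:
  assumes "q \<in> Dom"
  shows "lagr (p (Suc n)) l - lagr q (lam (Suc n))
      + (1 - c) / 2 * (sqnorm (increment n) / \<tau> + dual_sqnorm (\<lambda>e. lam (Suc n) e - lam n e) / \<sigma>)
    \<le> energy n q l - energy (Suc n) q l"
proof -
  have "g (p (Suc n)) - g q \<le> pairing (q - p (Suc n)) (lam (Suc n))
      - (1 / \<tau>) * ip (p n - p (Suc n)) (q - p (Suc n))"
    using primal_step[OF assms, of n] by (simp add: pairing_def)
  also have "(1 / \<tau>) * ip (p n - p (Suc n)) (q - p (Suc n))
      = (sqnorm (increment (Suc n)) + sqnorm (q - p (Suc n)) - sqnorm (q - p n)) / (2 * \<tau>)"
    by (simp add: polarisation increment_def)
  finally have 1: "g (p (Suc n)) - g q \<le> pairing (q - p (Suc n)) (lam (Suc n))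
      - (sqnorm (increment (Suc n)) + sqnorm (q - p (Suc n)) - sqnorm (q - p n)) / (2 * \<tau>)" .
  have 2: "lagr (p (Suc n)) l - lagr q (lam (Suc n)) =
      g (p (Suc n)) - g q - pairing (q - p (Suc n)) (lam (Suc n)) + pairing (p (Suc n)) (\<lambda>e. l e - lam (Suc n) e)"
    by (simp add: lagr_def pairing_diff pairing_diff_right)
  have 3: "pairing (increment n) (\<lambda>e. lam (Suc n) e - lam n e)
      \<le> c / 2 * (sqnorm (increment n) / \<tau> + dual_sqnorm (\<lambda>e. lam (Suc n) e - lam n e) / \<sigma>)"
    by (rule young)
  show ?thesis
    using 1 3 unfolding 2 dual_identity energy_def
    by (simp add: algebra_simps add_divide_distrib diff_divide_distrib)
qed

lemma energy_lower:
  "(1 - c) / 2 * (sqnorm (q - p n) / \<tau> + dual_sqnorm (\<lambda>e. l e - lam n e) / \<sigma>) \<le> energy n q l"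
proof -
  have "0 \<le> (1 - c) / 2 * (sqnorm (increment n) / \<tau>)" "0 \<le> c / 2 * (sqnorm (q - p n) / \<tau>)"
    using c_pos c_less_1 \<tau>_pos sqnorm_nonneg by simp_all
  with young[of "increment n" "\<lambda>e. l e - lam n e"] show ?thesis
    unfolding energy_def
    by (simp add: algebra_simps add_divide_distrib diff_divide_distrib)
qed

lemma energy_nonneg: "0 \<le> energy n q l"
proof -
  have "0 \<le> (1 - c) / 2 * (sqnorm (q - p n) / \<tau> + dual_sqnorm (\<lambda>e. l e - lam n e) / \<sigma>)"
    using c_less_1 \<tau>_pos \<sigma>_pos sqnorm_nonneg dual_sqnorm_nonneg by simp
  with energy_lower show ?thesis by (rule order_trans[rotated])
qed

text \<open>The energy at time 0 has no correction terms because the first increment vanishes.\<close>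

lemma gap_sum_bound:
  assumes "q \<in> Dom"
  shows "(\<Sum>i=1..n. lagr (p i) l - lagr q (lam i))
    \<le> sqnorm (q - p 0) / (2 * \<tau>) + dual_sqnorm (\<lambda>e. l e - lam 0 e) / (2 * \<sigma>)"
proof -
  have "lagr (p (Suc n)) l - lagr q (lam (Suc n)) \<le> energy n q l - energy (Suc n) q l" for n
  proof -
    have "0 \<le> (1 - c) / 2 * (sqnorm (increment n) / \<tau> + dual_sqnorm (\<lambda>e. lam (Suc n) e - lam n e) / \<sigma>)"
      using c_less_1 \<tau>_pos \<sigma>_pos sqnorm_nonneg dual_sqnorm_nonneg by simp
    with energy_descent[OF assms, of n l] show ?thesis by linarith
  qed
  then have "(\<Sum>i=1..n. lagr (p i) l - lagr q (lam i)) \<le> energy 0 q l - energy n q l"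
  proof (induction n)
    case (Suc n)
    from Suc.IH[OF Suc.prems] Suc.prems[of n] show ?case by simp
  qed simp
  also have "\<dots> \<le> energy 0 q l" using energy_nonneg by simp
  also have "\<dots> = sqnorm (q - p 0) / (2 * \<tau>) + dual_sqnorm (\<lambda>e. l e - lam 0 e) / (2 * \<sigma>)"
    by (simp add: energy_def increment_def sqnorm_def pairing_def bilinear_lzero[OF ip_bilinear] linear_0[OF B_linear])
  finally show ?thesis .
qed

end

text \<open>Bolzano-Weierstrass for functions on a finite index set inside an arbitrary type, where no Euclidean
structure is available.\<close>

lemma bounded_convergent_on_finite:
  fixes f :: "nat \<Rightarrow> 'e \<Rightarrow> real"
  assumes "finite A" "\<And>e. e \<in> A \<Longrightarrow> \<exists>M. \<forall>n. \<bar>f n e\<bar> \<le> M"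
  shows "\<exists>r l. strict_mono r \<and> (\<forall>e\<in>A. (\<lambda>n. f (r n) e) \<longlonglongrightarrow> l e)"
  using assms
proof (induction A)
  case empty
  show ?case by (intro exI[of _ id]) (auto simp: strict_mono_def)
next
  case (insert a A)
  then obtain r l where r: "strict_mono (r::nat\<Rightarrow>nat)" "\<forall>e\<in>A. (\<lambda>n. f (r n) e) \<longlonglongrightarrow> l e"
    by blast
  obtain M where "\<And>n. \<bar>f n a\<bar> \<le> M" using insert.prems by blast
  then have "bounded (range (\<lambda>n. f (r n) a))"
    by (auto simp: bounded_iff)
  then obtain l0 and r' where r': "strict_mono (r'::nat\<Rightarrow>nat)" "((\<lambda>n. f (r n) a) \<circ> r') \<longlonglongrightarrow> l0"
    using bounded_imp_convergent_subsequence by blast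
  have "(\<lambda>n. f ((r \<circ> r') n) e) \<longlonglongrightarrow> (l(a := l0)) e" if "e \<in> insert a A" for e
  proof (cases "e = a")
    case True
    with r' show ?thesis by (simp add: comp_def)
  next
    case False
    with that r have "(\<lambda>n. f (r n) e) \<longlonglongrightarrow> l e" by simp
    from LIMSEQ_subseq_LIMSEQ[OF this r'(1)] False show ?thesis by (simp add: comp_def)
  qed
  with strict_mono_o[OF r(1) r'(1)] show ?case by blast
qed

context primal_dual_iteration begin

text \<open>Opial's argument.  The assumption \<open>closed\<close> says that the epigraph of \<open>g\<close> is sequentially closed, which
yields both that the cluster point lies in the domain and that it satisfies the limit of the
variational inequalities.\<close>

lemma convergence:
  assumes saddle: "qs \<in> Dom" "\<And>x. x \<in> Dom \<Longrightarrow> lagr qs ls \<le> lagr x ls"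
      "\<And>l. lagr qs l \<le> lagr qs ls"
    and bounded_Dom: "bounded Dom"
    and closed: "\<And>X x C C0. \<lbrakk>\<And>k. X k \<in> Dom; X \<longlonglongrightarrow> x; \<And>k. g (X k) \<le> C k; C \<longlonglongrightarrow> C0\<rbrakk>
      \<Longrightarrow> x \<in> Dom \<and> g x \<le> C0"
  shows "\<exists>pb lb. pb \<in> Dom \<and> (\<forall>q\<in>Dom. lagr pb lb \<le> lagr q lb) \<and> (\<forall>e\<in>A. B pb e = 0)
    \<and> (\<lambda>n. sqnorm (p n - pb)) \<longlonglongrightarrow> 0 \<and> (\<lambda>n. dual_sqnorm (\<lambda>e. lam n e - lb e)) \<longlonglongrightarrow> 0"
proof -
  define \<epsilon> where "\<epsilon> = (1 - c) / 2"
  have eps: "0 < \<epsilon>" using c_less_1 by (simp add: \<epsilon>_def)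
  define res where "res n = sqnorm (increment n) / \<tau> + dual_sqnorm (\<lambda>e. lam (Suc n) e - lam n e) / \<sigma>" for n
  have res_nonneg: "0 \<le> res n" for n
    using sqnorm_nonneg dual_sqnorm_nonneg \<tau>_pos \<sigma>_pos by (simp add: res_def)
  have descent: "energy (Suc n) q l + \<epsilon> * res n \<le> energy n q l"
    if "q \<in> Dom" "\<And>x. x \<in> Dom \<Longrightarrow> lagr q l \<le> lagr x l" "\<And>m. lagr q m \<le> lagr q l" for n q l
    using energy_descent[OF that(1), of n l] that(2)[OF p_Dom, of n] that(3)[of "lam (Suc n)"]
    unfolding \<epsilon>_def res_def by linarith
  note desc = descent[OF saddle]
  have tele: "energy n qs ls + \<epsilon> * (\<Sum>i<n. res i) \<le> energy 0 qs ls" for n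
  proof (induction n)
    case (Suc n)
    with desc[of n] show ?case by (simp add: algebra_simps)
  qed simp
  have sum_res: "(\<Sum>i<n. res i) \<le> energy 0 qs ls / \<epsilon>" for n
    using tele[of n] energy_nonneg[of n qs ls] eps by (simp add: field_simps)
  have "summable res"
    by (rule summableI_nonneg_bounded[OF res_nonneg sum_res])
  then have res_lim: "res \<longlonglongrightarrow> 0" by (rule summable_LIMSEQ_zero)
  have sqd: "(\<lambda>n. sqnorm (increment n)) \<longlonglongrightarrow> 0"
  proof (rule tendsto_sandwich[of "\<lambda>_. 0" _ _ "\<lambda>n. \<tau> * res n"])
    show "(\<lambda>n. \<tau> * res n) \<longlonglongrightarrow> 0" using tendsto_mult_right_zero[OF res_lim] by simp
    show "\<forall>\<^sub>F n in sequentially. sqnorm (increment n) \<le> \<tau> * res n"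
      using \<tau>_pos \<sigma>_pos dual_sqnorm_nonneg by (simp add: res_def field_simps)
  qed (auto simp: sqnorm_nonneg)
  have dsqd: "(\<lambda>n. dual_sqnorm (\<lambda>e. lam (Suc n) e - lam n e)) \<longlonglongrightarrow> 0"
  proof (rule tendsto_sandwich[of "\<lambda>_. 0" _ _ "\<lambda>n. \<sigma> * res n"])
    show "(\<lambda>n. \<sigma> * res n) \<longlonglongrightarrow> 0" using tendsto_mult_right_zero[OF res_lim] by simp
    show "\<forall>\<^sub>F n in sequentially. dual_sqnorm (\<lambda>e. lam (Suc n) e - lam n e) \<le> \<sigma> * res n"
      using \<tau>_pos \<sigma>_pos sqnorm_nonneg by (simp add: res_def field_simps)
  qed (auto simp: dual_sqnorm_nonneg)
  have comp_le: "\<bar>f e\<bar> \<le> sqrt (dual_sqnorm f)" if "e \<in> A" for e and f :: "'e \<Rightarrow> real"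
    using member_le_sum[OF that, of "\<lambda>e. (f e)\<^sup>2"] finite_A
    by (intro real_le_rsqrt) (auto simp: dual_sqnorm_def)
  have comp_lim: "(\<lambda>n. f n e) \<longlonglongrightarrow> 0" if "(\<lambda>n. dual_sqnorm (f n)) \<longlonglongrightarrow> 0" "e \<in> A"
    for e and f :: "nat \<Rightarrow> 'e \<Rightarrow> real"
  proof (rule Lim_null_comparison)
    show "(\<lambda>n. sqrt (dual_sqnorm (f n))) \<longlonglongrightarrow> 0" using tendsto_real_sqrt[OF that(1)] by simp
    show "\<forall>\<^sub>F n in sequentially. norm (f n e) \<le> sqrt (dual_sqnorm (f n))"
      using comp_le[OF that(2)] by simp
  qed
  have "dual_sqnorm (\<lambda>e. ls e - lam n e) \<le> \<sigma> * energy 0 qs ls / \<epsilon>" for n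
  proof -
    have "\<epsilon> * (sqnorm (qs - p n) / \<tau> + dual_sqnorm (\<lambda>e. ls e - lam n e) / \<sigma>) \<le> energy n qs ls"
      using energy_lower unfolding \<epsilon>_def .
    also have "\<dots> \<le> energy 0 qs ls"
      using tele[of n] mult_nonneg_nonneg[OF less_imp_le[OF eps] sum_nonneg[of "{..<n}" res]]
        res_nonneg by force
    finally have "\<epsilon> * (sqnorm (qs - p n) / \<tau>) + \<epsilon> * (dual_sqnorm (\<lambda>e. ls e - lam n e) / \<sigma>) \<le> energy 0 qs ls"
      by (simp add: algebra_simps)
    moreover have "0 \<le> \<epsilon> * (sqnorm (qs - p n) / \<tau>)" using eps \<tau>_pos sqnorm_nonneg by simp
    ultimately have "\<epsilon> * (dual_sqnorm (\<lambda>e. ls e - lam n e) / \<sigma>) \<le> energy 0 qs ls" by linarith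
    then show ?thesis using eps \<sigma>_pos by (simp add: field_simps)
  qed
  then have lam_bd: "\<exists>M. \<forall>n. \<bar>lam (Suc n) e\<bar> \<le> M" if "e \<in> A" for e
  proof -
    have "\<bar>lam n e\<bar> \<le> \<bar>ls e\<bar> + sqrt (\<sigma> * energy 0 qs ls / \<epsilon>)" for n
      using comp_le[OF that, of "\<lambda>e. ls e - lam n e"] real_sqrt_le_mono[OF \<open>\<And>n. dual_sqnorm (\<lambda>e. ls e - lam n e) \<le> \<sigma> * energy 0 qs ls / \<epsilon>\<close>, of n]
      by linarith
    then show ?thesis by blast
  qed
  have "bounded (range (\<lambda>n. p (Suc n)))"
    using bounded_Dom p_Dom by (auto intro: bounded_subset)
  then obtain pb and r1 where r1: "strict_mono (r1::nat\<Rightarrow>nat)" "((\<lambda>n. p (Suc n)) \<circ> r1) \<longlonglongrightarrow> pb"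
    using bounded_imp_convergent_subsequence by blast
  obtain r2 lb where r2: "strict_mono (r2::nat\<Rightarrow>nat)"
      "\<forall>e\<in>A. (\<lambda>n. lam (Suc (r1 (r2 n))) e) \<longlonglongrightarrow> lb e"
    using bounded_convergent_on_finite[OF finite_A, of "\<lambda>n. lam (Suc (r1 n))"] lam_bd by blast
  define r where "r = r1 \<circ> r2"
  have r: "strict_mono r" using strict_mono_o[OF r1(1) r2(1)] by (simp add: r_def)
  have p_lim: "(\<lambda>k. p (Suc (r k))) \<longlonglongrightarrow> pb"
    using LIMSEQ_subseq_LIMSEQ[OF r1(2) r2(1)] by (simp add: comp_def r_def)
  have l_lim: "(\<lambda>k. lam (Suc (r k)) e) \<longlonglongrightarrow> lb e" if "e \<in> A" for e
    using r2(2) that by (simp add: r_def)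
  have r_Suc: "strict_mono (\<lambda>k. Suc (r k))" using r by (auto simp: strict_mono_def)
  have sub0: "(\<lambda>k. f (Suc (r k))) \<longlonglongrightarrow> 0" if "f \<longlonglongrightarrow> 0" for f :: "nat \<Rightarrow> real"
    using LIMSEQ_subseq_LIMSEQ[OF that r_Suc] by (simp add: comp_def)
  have B_lim: "(\<lambda>k. B (X k) e) \<longlonglongrightarrow> B x e" if "X \<longlonglongrightarrow> x" for X x e
    using bounded_linear.tendsto[OF _ that, of "\<lambda>x. B x e"] B_linear
    by (simp add: linear_conv_bounded_linear)
  have ip_bounded: "bounded_bilinear ip"
    using ip_bilinear by (simp add: bilinear_conv_bounded_bilinear)
  have sq_lim: "(\<lambda>k. sqnorm (X k)) \<longlonglongrightarrow> sqnorm x" if "X \<longlonglongrightarrow> x" for X x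
    unfolding sqnorm_def by (intro bounded_bilinear.tendsto[OF ip_bounded] that)
  have Bd_lim: "(\<lambda>n. B (increment n) e) \<longlonglongrightarrow> 0" if "e \<in> A" for e
  proof -
    have "(\<lambda>n. dual_sqnorm (B (increment n))) \<longlonglongrightarrow> 0"
    proof (rule tendsto_sandwich[of "\<lambda>_. 0" _ _ "\<lambda>n. K * sqnorm (increment n)"])
      show "(\<lambda>n. K * sqnorm (increment n)) \<longlonglongrightarrow> 0" using tendsto_mult_right_zero[OF sqd] by simp
    qed (use B_bound in \<open>auto simp: dual_sqnorm_def sqnorm_def sum_nonneg\<close>)
    from comp_lim[OF this that] show ?thesis .
  qed
  \<comment> \<open>the dual steps and the increments tend to 0, hence so does \<open>B\<close> along the iterates\<close>
  have B_pb: "B pb e = 0" if e: "e \<in> A" for e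
  proof -
    have "B (p n) e = (lam (Suc n) e - lam n e) / \<sigma> - B (increment n) e" for n
    proof -
      have "B (2 *\<^sub>R p n - p (n - 1)) e = B (p n) e + B (increment n) e"
        by (simp add: increment_def linear_diff[OF B_linear] linear_scale[OF B_linear])
      then show ?thesis using dual_step[OF e, of n] \<sigma>_pos by (simp add: field_simps)
    qed
    moreover have "(\<lambda>n. (lam (Suc n) e - lam n e) / \<sigma> - B (increment n) e) \<longlonglongrightarrow> 0 / \<sigma> - 0"
      using \<sigma>_pos by (intro tendsto_diff tendsto_divide tendsto_const comp_lim[OF dsqd e] Bd_lim[OF e]) simp
    ultimately have "(\<lambda>n. B (p n) e) \<longlonglongrightarrow> 0" by simp
    from sub0[OF this] B_lim[OF p_lim, of e] show ?thesis by (rule LIMSEQ_unique[symmetric])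
  qed
  have limit: "pb \<in> Dom \<and> g pb \<le> g q + pairing (q - pb) lb" if q: "q \<in> Dom" for q
  proof (rule closed)
    show "p (Suc (r k)) \<in> Dom" for k by (rule p_Dom)
    show "(\<lambda>k. p (Suc (r k))) \<longlonglongrightarrow> pb" by (rule p_lim)
    let ?ip = "\<lambda>k. ip (p (r k) - p (Suc (r k))) (q - p (Suc (r k)))"
    show "g (p (Suc (r k))) \<le> g q + pairing (q - p (Suc (r k))) (lam (Suc (r k))) - (1 / \<tau>) * ?ip k" for k
      using primal_step[OF q, of "r k"] by (simp add: pairing_def)
    have "?ip \<longlonglongrightarrow> 0"
    proof (rule Lim_null_comparison)
      have "sqnorm (p (r k) - p (Suc (r k))) = sqnorm (increment (Suc (r k)))" for k
        by (simp add: sqnorm_def increment_def ip_expand)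
      then show "\<forall>\<^sub>F k in sequentially. norm (?ip k)
          \<le> sqrt (sqnorm (increment (Suc (r k)))) * sqrt (sqnorm (q - p (Suc (r k))))"
        using Cauchy_Schwarz[of "p (r k) - p (Suc (r k))" "q - p (Suc (r k))" for k] by simp
      have "(\<lambda>k. sqrt (sqnorm (increment (Suc (r k)))) * sqrt (sqnorm (q - p (Suc (r k)))))
          \<longlonglongrightarrow> sqrt 0 * sqrt (sqnorm (q - pb))"
        by (intro tendsto_mult tendsto_real_sqrt sub0[OF sqd] sq_lim[OF tendsto_diff] tendsto_const p_lim)
      then show "(\<lambda>k. sqrt (sqnorm (increment (Suc (r k)))) * sqrt (sqnorm (q - p (Suc (r k))))) \<longlonglongrightarrow> 0" by simp
    qed
    moreover have "(\<lambda>k. pairing (q - p (Suc (r k))) (lam (Suc (r k)))) \<longlonglongrightarrow> pairing (q - pb) lb"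
      unfolding pairing_def by (intro tendsto_sum tendsto_mult B_lim tendsto_diff tendsto_const p_lim l_lim)
    ultimately have "(\<lambda>k. g q + pairing (q - p (Suc (r k))) (lam (Suc (r k))) - (1 / \<tau>) * ?ip k)
        \<longlonglongrightarrow> g q + pairing (q - pb) lb - (1 / \<tau>) * 0"
      by (intro tendsto_intros)
    then show "(\<lambda>k. g q + pairing (q - p (Suc (r k))) (lam (Suc (r k))) - (1 / \<tau>) * ?ip k)
        \<longlonglongrightarrow> g q + pairing (q - pb) lb" by simp
  qed
  have pb: "pb \<in> Dom" using limit[OF saddle(1)] by blast
  have min: "lagr pb lb \<le> lagr q lb" if "q \<in> Dom" for q
    using limit[OF that] by (simp add: lagr_def pairing_diff)
  have max: "lagr pb l \<le> lagr pb lb" for l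
    by (simp add: lagr_def pairing_def B_pb)
  \<comment> \<open>the descent is now used relative to the cluster point itself\<close>
  let ?E = "\<lambda>n. energy n pb lb"
  have dec: "decseq ?E"
  proof (rule decseq_SucI)
    show "energy (Suc n) pb lb \<le> energy n pb lb" for n
      using descent[OF pb min max, of n] mult_nonneg_nonneg[OF less_imp_le[OF eps] res_nonneg[of n]]
      by linarith
  qed
  obtain E0 where E0: "?E \<longlonglongrightarrow> E0"
    using decseq_convergent[OF dec, of 0] energy_nonneg by metis
  have "(\<lambda>k. pb - p (Suc (r k))) \<longlonglongrightarrow> pb - pb"
    by (intro tendsto_diff tendsto_const p_lim)
  from sq_lim[OF this] have e1: "(\<lambda>k. sqnorm (pb - p (Suc (r k)))) \<longlonglongrightarrow> 0"
    by (simp add: sqnorm_def bilinear_lzero[OF ip_bilinear] del: tendsto_const_iff)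
  have l0: "(\<lambda>k. lb e - lam (Suc (r k)) e) \<longlonglongrightarrow> 0" if "e \<in> A" for e
    using tendsto_diff[OF tendsto_const l_lim[OF that], of "lb e"] by simp
  have e2: "(\<lambda>k. dual_sqnorm (\<lambda>e. lb e - lam (Suc (r k)) e)) \<longlonglongrightarrow> 0"
  proof -
    have "(\<lambda>k. \<Sum>e\<in>A. (lb e - lam (Suc (r k)) e)\<^sup>2) \<longlonglongrightarrow> (\<Sum>e\<in>A. 0\<^sup>2)"
      by (intro tendsto_sum tendsto_power l0)
    then show ?thesis by (simp add: dual_sqnorm_def)
  qed
  have e3: "(\<lambda>k. pairing (increment (Suc (r k))) (\<lambda>e. lb e - lam (Suc (r k)) e)) \<longlonglongrightarrow> 0"
  proof -
    have "(\<lambda>k. \<Sum>e\<in>A. B (increment (Suc (r k))) e * (lb e - lam (Suc (r k)) e)) \<longlonglongrightarrow> (\<Sum>e\<in>A. 0 * 0)"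
      by (intro tendsto_sum tendsto_mult sub0[OF Bd_lim] l0)
    then show ?thesis by (simp add: pairing_def)
  qed
  have "(\<lambda>k. ?E (Suc (r k))) \<longlonglongrightarrow> 0 / (2 * \<tau>) + 0 / (2 * \<sigma>) + 0 / (2 * \<tau>) - 0"
    unfolding energy_def
    using \<tau>_pos \<sigma>_pos
    by (intro tendsto_diff tendsto_add tendsto_divide tendsto_const e1 e2 e3 sub0[OF sqd]) auto
  then have "(\<lambda>k. ?E (Suc (r k))) \<longlonglongrightarrow> 0" by simp
  moreover have "(\<lambda>k. ?E (Suc (r k))) \<longlonglongrightarrow> E0"
    using LIMSEQ_subseq_LIMSEQ[OF E0 r_Suc] by (simp add: comp_def)
  ultimately have "E0 = 0" by (rule LIMSEQ_unique[symmetric])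
  with E0 have E_lim: "?E \<longlonglongrightarrow> 0" by simp
  have bound: "\<epsilon> * (sqnorm (p n - pb) / \<tau>) + \<epsilon> * (dual_sqnorm (\<lambda>e. lam n e - lb e) / \<sigma>) \<le> ?E n" for n
  proof -
    have "sqnorm (p n - pb) = sqnorm (pb - p n)" by (simp add: sqnorm_def ip_expand)
    moreover have "dual_sqnorm (\<lambda>e. lam n e - lb e) = dual_sqnorm (\<lambda>e. lb e - lam n e)"
      by (simp add: dual_sqnorm_def power2_commute)
    ultimately show ?thesis
      using energy_lower[of pb n lb] unfolding \<epsilon>_def by (simp add: distrib_left)
  qed
  have nonneg: "0 \<le> \<epsilon> * (sqnorm x / \<tau>)" "0 \<le> \<epsilon> * (dual_sqnorm l / \<sigma>)" for x l
    using eps \<tau>_pos \<sigma>_pos sqnorm_nonneg dual_sqnorm_nonneg by simp_all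
  have "(\<lambda>n. sqnorm (p n - pb)) \<longlonglongrightarrow> 0"
  proof (rule tendsto_sandwich[of "\<lambda>_. 0" _ _ "\<lambda>n. \<tau> / \<epsilon> * ?E n"])
    show "(\<lambda>n. \<tau> / \<epsilon> * ?E n) \<longlonglongrightarrow> 0"
      by (rule tendsto_mult_right_zero[OF E_lim])
    have "\<epsilon> * (sqnorm (p n - pb) / \<tau>) \<le> ?E n" for n
      using bound[of n] nonneg(2)[of "\<lambda>e. lam n e - lb e"] by linarith
    then show "\<forall>\<^sub>F n in sequentially. sqnorm (p n - pb) \<le> \<tau> / \<epsilon> * ?E n"
      using eps \<tau>_pos by (simp add: field_simps)
  qed (auto simp: sqnorm_nonneg)
  moreover have "(\<lambda>n. dual_sqnorm (\<lambda>e. lam n e - lb e)) \<longlonglongrightarrow> 0"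
  proof (rule tendsto_sandwich[of "\<lambda>_. 0" _ _ "\<lambda>n. \<sigma> / \<epsilon> * ?E n"])
    show "(\<lambda>n. \<sigma> / \<epsilon> * ?E n) \<longlonglongrightarrow> 0"
      by (rule tendsto_mult_right_zero[OF E_lim])
    have "\<epsilon> * (dual_sqnorm (\<lambda>e. lam n e - lb e) / \<sigma>) \<le> ?E n" for n
      using bound[of n] nonneg(1)[of "p n - pb"] by linarith
    then show "\<forall>\<^sub>F n in sequentially. dual_sqnorm (\<lambda>e. lam n e - lb e) \<le> \<sigma> / \<epsilon> * ?E n"
      using eps \<sigma>_pos by (simp add: field_simps)
  qed (auto simp: dual_sqnorm_nonneg)
  ultimately show ?thesis using pb min B_pb by (intro exI[of _ pb] exI[of _ lb]) simp
qed

end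

section \<open>Green's formula on a pixel\<close>

text \<open>The sign of the fixed edge normal relative to the outer normal of the square with the given corner;
only meaningful for the four edges of that square.\<close>

fun outward_sign :: "edge \<Rightarrow> nat \<times> nat \<Rightarrow> real" where
  "outward_sign (VEdge i j) (k, l) = (if k = i then - 1 else 1)"
| "outward_sign (HEdge i j) (k, l) = (if l = j then - 1 else 1)"

definition square_edges :: "nat \<times> nat \<Rightarrow> edge set" where
  "square_edges c = {e. edge_of_square e c}"

definition normal_comp :: "rt0 \<Rightarrow> edge \<Rightarrow> real" where
  "normal_comp r e = rt0_eval r (edge_mid e) \<bullet> edge_normal e"

fun edge_integral :: "(real \<times> real \<Rightarrow> real) \<Rightarrow> edge \<Rightarrow> real" where
  "edge_integral \<phi> (VEdge i j) = integral {real j..real j + 1} (\<lambda>y. \<phi> (real i, y))"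
| "edge_integral \<phi> (HEdge i j) = integral {real i..real i + 1} (\<lambda>x. \<phi> (x, real j))"

lemma square_edges_eq:
  "square_edges (k, l) = {VEdge k l, VEdge (Suc k) l, HEdge k l, HEdge k (Suc l)}"
proof (rule set_eqI)
  show "e \<in> square_edges (k, l) \<longleftrightarrow> e \<in> {VEdge k l, VEdge (Suc k) l, HEdge k l, HEdge k (Suc l)}" for e
    by (cases e) (auto simp: square_edges_def)
qed

lemma finite_square_edges [simp]: "finite (square_edges c)"
  by (cases c) (simp add: square_edges_eq)

lemma sum_square_edges:
  "(\<Sum>e\<in>square_edges (k, l). f e) = f (VEdge k l) + f (VEdge (Suc k) l) + f (HEdge k l) + f (HEdge k (Suc l))"
  for f :: "edge \<Rightarrow> real"
  by (simp add: square_edges_eq)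

lemma rt0_eval_alt:
  "rt0_eval r x = (fst (fst r) + snd (fst r) * fst x, fst (snd r) + snd (snd r) * snd x)"
  by (cases r; cases x; cases "fst r"; cases "snd r") auto

lemma rt0_div_alt: "rt0_div r = snd (fst r) + snd (snd r)"
  by (cases r; cases "fst r"; cases "snd r") auto

lemma normal_comp_simps [simp]:
  "normal_comp r (VEdge i j) = fst (fst r) + snd (fst r) * real i"
  "normal_comp r (HEdge i j) = fst (snd r) + snd (snd r) * real j"
  by (simp_all add: normal_comp_def rt0_eval_alt)

text \<open>The divergence theorem for a constant test function.\<close>

lemma rt0_div_eq_flux: "rt0_div r = (\<Sum>e\<in>square_edges c. outward_sign e c * normal_comp r e)"
  by (cases c) (simp add: sum_square_edges rt0_div_alt algebra_simps)

lemma cell_borel [measurable]: "cell c \<in> sets borel"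
  unfolding cell_def by (intro borel_Times) auto

text \<open>Half-open cells and closed squares differ by a null set, so that iterated integrals and the fundamental
theorem of calculus become available.\<close>

lemma cell_integral:
  fixes f :: "real \<times> real \<Rightarrow> real"
  assumes "continuous_on UNIV f"
  shows "set_integrable lborel (cell (k, l)) f"
    and "(LINT x:cell (k, l)|lborel. f x) = integral (cbox (real k, real l) (real k + 1, real l + 1)) f"
proof -
  let ?C = "cbox (real k, real l) (real k + 1, real l + 1)"
  have sub: "cell (k, l) \<subseteq> ?C" and sup: "box (real k, real l) (real k + 1, real l + 1) \<subseteq> cell (k, l)"
    by (auto simp: cell_def cbox_Pair_eq mem_box Basis_prod_def)
  have "set_integrable lborel ?C f"
    unfolding set_integrable_def
    by (intro borel_integrable_compact compact_cbox continuous_on_subset[OF assms]) auto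
  then show int: "set_integrable lborel (cell (k, l)) f"
    by (rule set_integrable_subset) (use sub cell_borel in auto)
  have "integral (cell (k, l)) f = integral ?C f"
  proof (rule integral_spike_set)
    show "negligible {x \<in> cell (k, l) - ?C. f x \<noteq> 0}"
      using sub by (auto intro: negligible_subset[OF negligible_empty])
    show "negligible {x \<in> ?C - cell (k, l). f x \<noteq> 0}"
      using sup by (auto intro: negligible_subset[OF negligible_frontier_interval])
  qed
  with set_borel_integral_eq_integral(2)[OF int]
  show "(LINT x:cell (k, l)|lborel. f x) = integral ?C f" by simp
qed

lemma GDERIV_slice:
  fixes \<phi> :: "real \<times> real \<Rightarrow> real"
  assumes "GDERIV \<phi> (x, y) :> g"
  shows "((\<lambda>x. \<phi> (x, y)) has_vector_derivative fst g) (at x within S)"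
    and "((\<lambda>y. \<phi> (x, y)) has_vector_derivative snd g) (at y within S)"
proof -
  have d: "(\<phi> has_derivative (\<lambda>h. h \<bullet> g)) (at (x, y))"
    using assms by (simp add: gderiv_def)
  have "((\<lambda>x. \<phi> (x, y)) has_derivative (\<lambda>h. (h, 0) \<bullet> g)) (at x within S)"
    by (rule has_derivative_compose[of "\<lambda>x. (x, y)" "\<lambda>h. (h, 0)" x S \<phi>, OF _ d])
      (auto intro!: derivative_eq_intros)
  then show "((\<lambda>x. \<phi> (x, y)) has_vector_derivative fst g) (at x within S)"
    by (simp add: has_vector_derivative_def inner_prod_def)
  have "((\<lambda>y. \<phi> (x, y)) has_derivative (\<lambda>h. (0, h) \<bullet> g)) (at y within S)"
    by (rule has_derivative_compose[of "\<lambda>y. (x, y)" "\<lambda>h. (0, h)" y S \<phi>, OF _ d])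
      (auto intro!: derivative_eq_intros)
  then show "((\<lambda>y. \<phi> (x, y)) has_vector_derivative snd g) (at y within S)"
    by (simp add: has_vector_derivative_def inner_prod_def)
qed

lemma GDERIV_continuous: "(\<And>x. GDERIV \<phi> x :> G x) \<Longrightarrow> continuous_on UNIV \<phi>"
  unfolding gderiv_def by (meson has_derivative_at_withinI has_derivative_continuous_on)

lemma continuous_rt0_eval: "continuous_on S (rt0_eval r)"
  unfolding rt0_eval_alt by (intro continuous_intros)

text \<open>The first component of the field depends on \<open>x\<^sub>1\<close> only, so integrating by parts in \<open>x\<^sub>1\<close> for fixed \<open>x\<^sub>2\<close>
leaves the two vertical edges with constant normal component; likewise for the second component.\<close>

lemma green_cell:
  fixes \<phi> :: "real \<times> real \<Rightarrow> real"
  assumes d: "\<And>x. GDERIV \<phi> x :> G x" and G: "continuous_on UNIV G"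
  shows "(LINT x:cell c|lborel. rt0_eval r x \<bullet> G x + rt0_div r * \<phi> x)
    = (\<Sum>e\<in>square_edges c. outward_sign e c * normal_comp r e * edge_integral \<phi> e)"
proof -
  obtain k l where c: "c = (k, l)" by (cases c)
  have \<phi>: "continuous_on UNIV \<phi>" by (rule GDERIV_continuous[OF d])
  have \<phi>_slice: "continuous_on S (\<lambda>x. \<phi> (x, y))" "continuous_on S (\<lambda>y. \<phi> (x, y))" for S x y
    by (auto intro!: continuous_on_compose2[OF \<phi>] continuous_intros)
  let ?a1 = "fst (fst r)" and ?b1 = "snd (fst r)" and ?a2 = "fst (snd r)" and ?b2 = "snd (snd r)"
  define f1 where "f1 x y = (?a1 + ?b1 * x) * fst (G (x, y)) + ?b1 * \<phi> (x, y)" for x y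
  define f2 where "f2 x y = (?a2 + ?b2 * y) * snd (G (x, y)) + ?b2 * \<phi> (x, y)" for x y
  have f12: "rt0_eval r x \<bullet> G x + rt0_div r * \<phi> x = f1 (fst x) (snd x) + f2 (fst x) (snd x)" for x
    by (cases x) (simp add: f1_def f2_def rt0_eval_alt rt0_div_alt inner_prod_def algebra_simps)
  have cont: "continuous_on S (\<lambda>(x, y). f1 x y)" "continuous_on S (\<lambda>(x, y). f2 x y)" for S
    unfolding f1_def f2_def case_prod_beta
    by (intro continuous_intros continuous_on_compose2[OF \<phi>] continuous_on_compose2[OF G]; simp)+
  let ?C = "cbox (real k, real l) (real k + 1, real l + 1)"
  have "(LINT x:cell c|lborel. rt0_eval r x \<bullet> G x + rt0_div r * \<phi> x)
      = integral ?C (\<lambda>x. f1 (fst x) (snd x) + f2 (fst x) (snd x))"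
    unfolding f12 c using cont[of UNIV]
    by (intro cell_integral(2) continuous_on_add) (auto simp: case_prod_beta)
  also have "\<dots> = integral ?C (\<lambda>x. f1 (fst x) (snd x)) + integral ?C (\<lambda>x. f2 (fst x) (snd x))"
    using cont[of ?C] by (intro integral_add integrable_continuous) (auto simp: case_prod_beta)
  also have "integral ?C (\<lambda>x. f1 (fst x) (snd x))
      = integral (cbox (real l) (real l + 1)) (\<lambda>y. integral (cbox (real k) (real k + 1)) (\<lambda>x. f1 x y))"
    using integral_prod_continuous[of "real k" "real l" "real k + 1" "real l + 1" "\<lambda>x. f1 (fst x) (snd x)"]
      integral_swap_continuous[OF cont(1)[of ?C]] cont(1)[of ?C]
    by (simp add: case_prod_beta)
  also have "\<dots> = integral {real l..real l + 1} (\<lambda>y. (?a1 + ?b1 * (real k + 1)) * \<phi> (real k + 1, y)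
        - (?a1 + ?b1 * real k) * \<phi> (real k, y))"
  proof -
    have FTC: "((\<lambda>x. f1 x y) has_integral ((?a1 + ?b1 * (real k + 1)) * \<phi> (real k + 1, y)
        - (?a1 + ?b1 * real k) * \<phi> (real k, y))) {real k..real k + 1}" for y
      unfolding f1_def
      by (rule fundamental_theorem_of_calculus)
        (auto intro!: derivative_eq_intros GDERIV_slice(1)[OF d] simp: mult.commute)
    show ?thesis by (simp add: integral_unique[OF FTC])
  qed
  also have "\<dots> = normal_comp r (VEdge (Suc k) l) * edge_integral \<phi> (VEdge (Suc k) l)
        - normal_comp r (VEdge k l) * edge_integral \<phi> (VEdge k l)"
    by (subst integral_diff)
      (auto intro!: integrable_continuous_interval continuous_on_mult continuous_on_const \<phi>_slice simp: add.commute)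
  also have "integral ?C (\<lambda>x. f2 (fst x) (snd x))
      = integral (cbox (real k) (real k + 1)) (\<lambda>x. integral (cbox (real l) (real l + 1)) (\<lambda>y. f2 x y))"
    using integral_prod_continuous[of "real k" "real l" "real k + 1" "real l + 1" "\<lambda>x. f2 (fst x) (snd x)"]
      cont(2)[of ?C]
    by (simp add: case_prod_beta)
  also have "\<dots> = integral {real k..real k + 1} (\<lambda>x. (?a2 + ?b2 * (real l + 1)) * \<phi> (x, real l + 1)
        - (?a2 + ?b2 * real l) * \<phi> (x, real l))"
  proof -
    have FTC: "((\<lambda>y. f2 x y) has_integral ((?a2 + ?b2 * (real l + 1)) * \<phi> (x, real l + 1)
        - (?a2 + ?b2 * real l) * \<phi> (x, real l))) {real l..real l + 1}" for x
      unfolding f2_def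
      by (rule fundamental_theorem_of_calculus)
        (auto intro!: derivative_eq_intros GDERIV_slice(2)[OF d] simp: mult.commute)
    show ?thesis by (simp add: integral_unique[OF FTC])
  qed
  also have "\<dots> = normal_comp r (HEdge k (Suc l)) * edge_integral \<phi> (HEdge k (Suc l))
        - normal_comp r (HEdge k l) * edge_integral \<phi> (HEdge k l)"
    by (subst integral_diff)
      (auto intro!: integrable_continuous_interval continuous_on_mult continuous_on_const \<phi>_slice simp: add.commute)
  finally show ?thesis
    by (simp add: c sum_square_edges algebra_simps)
qed

section \<open>Test functions concentrated at an edge\<close>

text \<open>A bump of class \<open>C\<^sup>1\<close> with support \<open>[-1, 1]\<close>, which is all the smoothness that test functions need.\<close>

definition bump :: "real \<Rightarrow> real" where "bump t = (max 0 (1 - t\<^sup>2))\<^sup>2"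
definition dbump :: "real \<Rightarrow> real" where "dbump t = - 4 * t * max 0 (1 - t\<^sup>2)"

text \<open>Squaring removes the kink of the positive part.\<close>

lemma DERIV_max_square: "((\<lambda>s::real. (max 0 s)\<^sup>2) has_real_derivative 2 * max 0 s) (at s)"
proof -
  consider "s < 0" | "s = 0" | "0 < s" by linarith
  then show ?thesis
  proof cases
    case 1
    have "((\<lambda>s::real. 0) has_real_derivative 2 * max 0 s) (at s)" using 1 by simp
    then show ?thesis
      by (rule has_field_derivative_transform_within_open[of _ _ _ "{..<0}"]) (use 1 in auto)
  next
    case 2
    have "((\<lambda>h::real. max 0 h) \<longlongrightarrow> max 0 0) (at 0)" by (intro tendsto_intros)
    moreover have "\<forall>\<^sub>F h::real in at 0. max 0 h = ((max 0 (0 + h))\<^sup>2 - (max 0 0)\<^sup>2) / h"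
      by (auto simp: eventually_at_filter max_def power2_eq_square)
    ultimately have "((\<lambda>h::real. ((max 0 (0 + h))\<^sup>2 - (max 0 0)\<^sup>2) / h) \<longlongrightarrow> max 0 0) (at 0)"
      by (rule Lim_transform_eventually)
    then show ?thesis using 2 by (simp add: DERIV_def)
  next
    case 3
    have "((\<lambda>s::real. s\<^sup>2) has_real_derivative 2 * max 0 s) (at s)"
      using 3 by (auto intro!: derivative_eq_intros)
    then show ?thesis
      by (rule has_field_derivative_transform_within_open[of _ _ _ "{0<..}"]) (use 3 in auto)
  qed
qed

lemma DERIV_bump: "(bump has_real_derivative dbump t) (at t)"
proof -
  have "((\<lambda>t::real. 1 - t\<^sup>2) has_real_derivative - 2 * t) (at t)"
    by (auto intro!: derivative_eq_intros)
  from DERIV_chain2[OF DERIV_max_square this] show ?thesis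
    by (simp add: bump_def[abs_def] dbump_def algebra_simps)
qed

lemma bump_0 [simp]: "bump 0 = 1" by (simp add: bump_def)

lemma bump_nonneg: "0 \<le> bump t" by (simp add: bump_def)

lemma bump_le_1: "bump t \<le> 1"
  unfolding bump_def by (intro power_le_one) auto

lemma bump_eq_0: "1 \<le> \<bar>t\<bar> \<Longrightarrow> bump t = 0"
  using power_mono[of 1 "\<bar>t\<bar>" 2] by (simp add: bump_def max_def)

lemma continuous_bump: "continuous_on S bump"
  by (meson DERIV_bump DERIV_isCont continuous_at_imp_continuous_on)

lemma continuous_dbump: "continuous_on S dbump"
  unfolding dbump_def[abs_def] by (intro continuous_intros)

lemma test_function_bump:
  fixes x0 y0 a b :: real
  assumes a: "0 < a" and b: "0 < b"
    and sub: "cbox (x0 - 1 / a, y0 - 1 / b) (x0 + 1 / a, y0 + 1 / b) \<subseteq> U"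
  shows "\<exists>G. test_function U (\<lambda>z. bump (a * (fst z - x0)) * bump (b * (snd z - y0))) G"
proof -
  have g1: "GDERIV (\<lambda>z::real\<times>real. a * (fst z - x0)) z :> (a, 0)"
    and g2: "GDERIV (\<lambda>z::real\<times>real. b * (snd z - y0)) z :> (0, b)" for z
    unfolding gderiv_def by (auto intro!: derivative_eq_intros simp: inner_prod_def)
  let ?G = "\<lambda>z. bump (a * (fst z - x0)) *\<^sub>R (dbump (b * (snd z - y0)) *\<^sub>R (0, b))
    + bump (b * (snd z - y0)) *\<^sub>R (dbump (a * (fst z - x0)) *\<^sub>R (a, 0))"
  have "test_function U (\<lambda>z. bump (a * (fst z - x0)) * bump (b * (snd z - y0))) ?G"
    unfolding test_function_def
  proof (intro conjI allI)
    show "GDERIV (\<lambda>z. bump (a * (fst z - x0)) * bump (b * (snd z - y0))) z :> ?G z" for z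
      by (intro GDERIV_mult GDERIV_DERIV_compose g1 g2 DERIV_bump)
    show "continuous_on UNIV ?G"
      by (intro continuous_intros continuous_on_compose2[OF continuous_bump[of UNIV]]
          continuous_on_compose2[OF continuous_dbump[of UNIV]]; simp)
    let ?K = "cbox (x0 - 1 / a, y0 - 1 / b) (x0 + 1 / a, y0 + 1 / b)"
    have zero: "bump (a * (fst z - x0)) * bump (b * (snd z - y0)) = 0" if "z \<notin> ?K" for z
    proof -
      have *: "1 \<le> \<bar>m * (t - t0)\<bar>" if "0 < m" "\<not> (t0 - 1 / m \<le> t \<and> t \<le> t0 + 1 / m)" for m t t0 :: real
      proof -
        have "1 / m \<le> \<bar>t - t0\<bar>" using that(2) by linarith
        then have "1 \<le> m * \<bar>t - t0\<bar>" using that(1) by (simp add: field_simps)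
        also have "\<dots> = \<bar>m * (t - t0)\<bar>" using that(1) by (simp add: abs_mult)
        finally show ?thesis .
      qed
      from that have "\<not> (x0 - 1 / a \<le> fst z \<and> fst z \<le> x0 + 1 / a) \<or> \<not> (y0 - 1 / b \<le> snd z \<and> snd z \<le> y0 + 1 / b)"
        by (cases z) (auto simp: cbox_Pair_eq)
      with bump_eq_0[OF *[OF a]] bump_eq_0[OF *[OF b]] show ?thesis by auto
    qed
    show "\<exists>K. compact K \<and> K \<subseteq> U \<and> (\<forall>z. z \<notin> K \<longrightarrow> bump (a * (fst z - x0)) * bump (b * (snd z - y0)) = 0)"
      using sub zero by (intro exI[of _ ?K]) (auto intro: compact_cbox)
  qed
  then show ?thesis by blast
qed

text \<open>Across the edge the support shrinks like \<open>1/m\<close>; along the edge it stays in the middle two thirds, so that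
no other edge is met.\<close>

fun edge_bump :: "real \<Rightarrow> edge \<Rightarrow> real \<times> real \<Rightarrow> real" where
  "edge_bump m (VEdge i j) z = bump (m * (fst z - real i)) * bump (3 * (snd z - (real j + 1 / 2)))"
| "edge_bump m (HEdge i j) z = bump (3 * (fst z - (real i + 1 / 2))) * bump (m * (snd z - real j))"

lemma bump_nat_eq_0: "bump (m * (real i' - real i)) = 0" if "1 \<le> m" "i' \<noteq> i"
proof (rule bump_eq_0)
  have "1 \<le> \<bar>real i' - real i\<bar>" using that(2) by linarith
  with mult_mono[of 1 m 1 "\<bar>real i' - real i\<bar>"] that(1) show "1 \<le> \<bar>m * (real i' - real i)\<bar>"
    by (simp add: abs_mult)
qed

lemma bump_half_eq_0: "bump (3 * t - (3 * real j + 3 / 2)) = 0" if "t \<notin> {real j<..<real j + 1}"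
  using that by (intro bump_eq_0) auto

lemma edge_integral_edge_bump_other:
  assumes "1 \<le> m" "e' \<noteq> e"
  shows "edge_integral (edge_bump m e) e' = 0"
proof -
  have other: "t \<notin> {real j<..<real j + 1}" if "real j' \<le> t" "t \<le> real j' + 1" "j' \<noteq> j" for t j j'
    using that by auto
  have nat: "real j' \<notin> {real j<..<real j + 1}" for j j' by auto
  obtain i j where "e = VEdge i j \<or> e = HEdge i j" by (cases e) auto
  moreover obtain i' j' where "e' = VEdge i' j' \<or> e' = HEdge i' j'" by (cases e') auto
  ultimately show ?thesis using assms
    by (auto intro!: integral_unique[OF has_integral_is_0] simp: bump_nat_eq_0 bump_half_eq_0 other nat)
qed

lemma edge_integral_edge_bump_same: "edge_integral (edge_bump m e) e = edge_integral (edge_bump 1 e) e"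
  by (cases e) auto

lemma edge_integral_edge_bump_pos: "0 < edge_integral (edge_bump m e) e"
proof -
  have "0 < integral {real j..real j + 1} (\<lambda>y. bump (3 * (y - (real j + 1 / 2))))" (is "0 < ?I") for j
  proof -
    have cont: "continuous_on {real j..real j + 1} (\<lambda>y. bump (3 * (y - (real j + 1 / 2))))"
      by (intro continuous_on_compose2[OF continuous_bump[of UNIV]] continuous_intros) auto
    have "0 \<le> ?I" by (intro integral_nonneg integrable_continuous_interval cont bump_nonneg)
    moreover have "?I \<noteq> 0"
    proof
      assume "?I = 0"
      then have "((\<lambda>y. bump (3 * (y - (real j + 1 / 2)))) has_integral 0) (cbox (real j) (real j + 1))"
        using integrable_integral[OF integrable_continuous_interval[OF cont]] by simp
      from has_integral_0_cbox_imp_0[OF _ _ this, of "real j + 1 / 2"] cont bump_nonneg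
      show False by (auto simp: box_real)
    qed
    ultimately show ?thesis by simp
  qed
  then show ?thesis by (cases e) auto
qed

section \<open>Weak divergence of piecewise fields\<close>

lemma test_function_support:
  assumes "test_function U \<phi> G" "x \<notin> U"
  shows "\<phi> x = 0" "G x = 0"
proof -
  obtain K where K: "compact K" "K \<subseteq> U" "\<And>x. x \<notin> K \<Longrightarrow> \<phi> x = 0"
    and d: "\<And>x. GDERIV \<phi> x :> G x"
    using assms(1) by (auto simp: test_function_def)
  have x: "x \<in> - K" using K(2) assms(2) by auto
  then show "\<phi> x = 0" using K(3) by simp
  have "((\<lambda>_. 0) has_derivative (\<lambda>h. 0)) (at x)" by simp
  then have "(\<phi> has_derivative (\<lambda>h. 0)) (at x)"
    by (rule has_derivative_transform_within_open[of _ _ _ _ "- K"])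
      (use K x compact_imp_closed in auto)
  with d[of x] have "(\<lambda>h. h \<bullet> G x) = (\<lambda>h. 0)"
    unfolding gderiv_def using has_derivative_unique by blast
  then show "G x = 0" using inner_eq_zero_iff by metis
qed

definition pixels_in :: "'p decomp \<Rightarrow> nat \<times> nat \<Rightarrow> nat \<times> nat \<Rightarrow> 'p set" where
  "pixels_in D a b = {T. fst a \<le> fst (corner D T) \<and> fst (corner D T) < fst b \<and>
                         snd a \<le> snd (corner D T) \<and> snd (corner D T) < snd b}"

lemma cell_disjoint_rect:
  assumes "T \<notin> pixels_in D a b"
  shows "cell (corner D T) \<inter> open_rect a b = {}"
proof -
  have "fst (corner D T) + 1 \<le> fst a \<or> fst b \<le> fst (corner D T) \<or>
      snd (corner D T) + 1 \<le> snd a \<or> snd b \<le> snd (corner D T)"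
    using assms by (auto simp: pixels_in_def)
  then have "real (fst (corner D T)) + 1 \<le> real (fst a) \<or> real (fst b) \<le> real (fst (corner D T)) \<or>
      real (snd (corner D T)) + 1 \<le> real (snd a) \<or> real (snd b) \<le> real (snd (corner D T))"
    by (metis of_nat_1 of_nat_add of_nat_le_iff)
  then show ?thesis by (auto simp: cell_def open_rect_def)
qed

definition div_field :: "'p::finite decomp \<Rightarrow> rt0 ^ 'p \<Rightarrow> real \<times> real \<Rightarrow> real" where
  "div_field D q x = (\<Sum>T\<in>UNIV. indicator (cell (corner D T)) x * rt0_div (q $ T))"

text \<open>The net outward flux through an edge; if two pixels of \<open>S\<close> meet there, this is up to sign the jump of
the normal component.\<close>

definition edge_flux :: "'p::finite decomp \<Rightarrow> 'p set \<Rightarrow> rt0 ^ 'p \<Rightarrow> edge \<Rightarrow> real" where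
  "edge_flux D S q e = (\<Sum>T\<in>{T\<in>S. pixel_edge D e T}. outward_sign e (corner D T) * normal_comp (q $ T) e)"

lemma edges_eq: "edges D S = (\<Union>T\<in>S. square_edges (corner D T))"
  by (auto simp: edges_def pixel_edge_def square_edges_def)

lemma finite_edges [simp]: "finite (edges D (S :: 'p::finite set))"
  by (simp add: edges_eq)

lemma sum_pixels_edges:
  fixes D :: "'p::finite decomp" and f :: "'p \<Rightarrow> edge \<Rightarrow> real"
  shows "(\<Sum>T\<in>S. \<Sum>e\<in>square_edges (corner D T). f T e)
    = (\<Sum>e\<in>edges D S. \<Sum>T\<in>{T\<in>S. pixel_edge D e T}. f T e)"
proof -
  have "(\<Sum>T\<in>S. \<Sum>e\<in>square_edges (corner D T). f T e)
      = (\<Sum>T\<in>S. \<Sum>e\<in>{e\<in>edges D S. pixel_edge D e T}. f T e)"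
    by (intro sum.cong) (auto simp: edges_def square_edges_def pixel_edge_def)
  also have "\<dots> = (\<Sum>e\<in>edges D S. \<Sum>T\<in>{T\<in>S. pixel_edge D e T}. f T e)"
    by (rule sum.swap_restrict) auto
  finally show ?thesis .
qed

lemma open_rect_borel [measurable]: "open_rect a b \<in> sets borel"
  unfolding open_rect_def by (intro borel_Times) auto

lemma set_integral_pieces:
  fixes D :: "'p::finite decomp" and f :: "'p \<Rightarrow> real \<times> real \<Rightarrow> real"
  assumes cont: "\<And>T. continuous_on UNIV (f T)"
    and zero: "\<And>T x. x \<notin> open_rect a b \<Longrightarrow> f T x = 0"
  shows "(LINT x:open_rect a b|lborel. (\<Sum>T\<in>UNIV. indicator (cell (corner D T)) x * f T x))
    = (\<Sum>T\<in>pixels_in D a b. LINT x:cell (corner D T)|lborel. f T x)"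
proof -
  have "indicator (open_rect a b) x * (\<Sum>T\<in>UNIV. indicator (cell (corner D T)) x * f T x)
      = (\<Sum>T\<in>pixels_in D a b. indicator (cell (corner D T)) x * f T x)" for x
  proof (cases "x \<in> open_rect a b")
    case True
    have "(\<Sum>T\<in>UNIV. indicator (cell (corner D T)) x * f T x)
        = (\<Sum>T\<in>pixels_in D a b. indicator (cell (corner D T)) x * f T x)"
      using cell_disjoint_rect[of _ D a b] True
      by (intro sum.mono_neutral_right) (auto simp: indicator_def)
    with True show ?thesis by simp
  next
    case False
    then show ?thesis by (simp add: zero)
  qed
  then have "(LINT x:open_rect a b|lborel. (\<Sum>T\<in>UNIV. indicator (cell (corner D T)) x * f T x))
      = (LINT x|lborel. (\<Sum>T\<in>pixels_in D a b. indicator (cell (corner D T)) x * f T x))"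
    by (simp add: set_lebesgue_integral_def)
  also have "\<dots> = (\<Sum>T\<in>pixels_in D a b. LINT x|lborel. indicator (cell (corner D T)) x * f T x)"
    using cell_integral(1)[OF cont]
    by (intro Bochner_Integration.integral_sum) (simp add: set_integrable_def, metis surj_pair)
  finally show ?thesis by (simp add: set_lebesgue_integral_def)
qed

text \<open>Summing Green's formula over the pixels and collecting the terms of each edge: the only obstruction
to the pixelwise divergence being the weak divergence are the fluxes through the edges.\<close>

lemma weak_divergence_defect:
  fixes D :: "'p::finite decomp"
  assumes t: "test_function (open_rect a b) \<phi> G"
  shows "(LINT x:open_rect a b|lborel. field D q x \<bullet> G x) + (LINT x:open_rect a b|lborel. div_field D q x * \<phi> x)
    = (\<Sum>e\<in>edges D (pixels_in D a b). edge_integral \<phi> e * edge_flux D (pixels_in D a b) q e)"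
proof -
  let ?S = "pixels_in D a b"
  have d: "\<And>x. GDERIV \<phi> x :> G x" and G: "continuous_on UNIV G"
    using t by (auto simp: test_function_def)
  have \<phi>: "continuous_on UNIV \<phi>" by (rule GDERIV_continuous[OF d])
  have c1: "continuous_on UNIV (\<lambda>x. rt0_eval (q $ T) x \<bullet> G x)" for T
    by (intro continuous_intros continuous_rt0_eval G)
  have c2: "continuous_on UNIV (\<lambda>x. rt0_div (q $ T) * \<phi> x)" for T
    by (intro continuous_intros \<phi>)
  have "(LINT x:open_rect a b|lborel. field D q x \<bullet> G x)
      = (\<Sum>T\<in>?S. LINT x:cell (corner D T)|lborel. rt0_eval (q $ T) x \<bullet> G x)"
    unfolding field_def inner_sum_left inner_scaleR_left
    by (rule set_integral_pieces[OF c1]) (simp add: test_function_support[OF t])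
  moreover have "(LINT x:open_rect a b|lborel. div_field D q x * \<phi> x)
      = (\<Sum>T\<in>?S. LINT x:cell (corner D T)|lborel. rt0_div (q $ T) * \<phi> x)"
    unfolding div_field_def sum_distrib_right mult.assoc
    by (rule set_integral_pieces[OF c2]) (simp add: test_function_support[OF t])
  moreover have "(LINT x:cell c|lborel. rt0_eval (q $ T) x \<bullet> G x) + (LINT x:cell c|lborel. rt0_div (q $ T) * \<phi> x)
      = (\<Sum>e\<in>square_edges c. outward_sign e c * normal_comp (q $ T) e * edge_integral \<phi> e)" for T c
    unfolding green_cell[OF d G, symmetric]
    by (cases c) (simp add: set_integral_add(2) cell_integral(1)[OF c1] cell_integral(1)[OF c2])
  ultimately have "(LINT x:open_rect a b|lborel. field D q x \<bullet> G x) + (LINT x:open_rect a b|lborel. div_field D q x * \<phi> x)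
      = (\<Sum>T\<in>?S. \<Sum>e\<in>square_edges (corner D T). outward_sign e (corner D T) * normal_comp (q $ T) e * edge_integral \<phi> e)"
    by (simp add: sum.distrib[symmetric])
  also have "\<dots> = (\<Sum>e\<in>edges D ?S. edge_integral \<phi> e * edge_flux D ?S q e)"
    unfolding sum_pixels_edges edge_flux_def by (simp add: sum_distrib_left mult.commute mult.left_commute)
  finally show ?thesis .
qed

lemma L2_on_bounded:
  fixes f :: "real \<times> real \<Rightarrow> 'b::{second_countable_topology,banach}"
  assumes [measurable]: "f \<in> borel_measurable borel" and bd: "\<And>x. x \<in> open_rect a b \<Longrightarrow> norm (f x) \<le> M"
  shows "f \<in> L2_on (open_rect a b)"
proof -
  have fin: "emeasure lborel (open_rect a b) < \<infinity>"
  proof -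
    have "emeasure lborel (open_rect a b)
        \<le> emeasure lborel (cbox (real (fst a), real (snd a)) (real (fst b), real (snd b)))"
      by (intro emeasure_mono) (auto simp: open_rect_def)
    also have "\<dots> < \<infinity>" by (rule emeasure_lborel_cbox_finite)
    finally show ?thesis .
  qed
  have "set_integrable lborel (open_rect a b) (\<lambda>x. (norm (f x))\<^sup>2)"
    unfolding set_integrable_def
  proof (rule Bochner_Integration.integrable_bound)
    show "integrable lborel (\<lambda>x. indicator (open_rect a b) x *\<^sub>R M\<^sup>2)"
      using fin by (intro integrable_scaleR_left integrable_real_indicator) auto
    show "AE x in lborel. norm (indicator (open_rect a b) x *\<^sub>R (norm (f x))\<^sup>2)
        \<le> norm (indicator (open_rect a b) x *\<^sub>R M\<^sup>2)"
      using bd by (intro AE_I2) (auto simp: indicator_def intro: power_mono)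
  qed measurable
  then show ?thesis
    unfolding L2_on_def set_borel_measurable_def by simp
qed

lemma field_L2: "field D q \<in> L2_on (open_rect a b)"
proof -
  let ?C = "cbox (real (fst a), real (snd a)) (real (fst b), real (snd b))"
  have "\<exists>M. \<forall>x\<in>?C. norm (rt0_eval (q $ T) x) \<le> M" for T
  proof -
    have "compact (rt0_eval (q $ T) ` ?C)"
      by (intro compact_continuous_image continuous_rt0_eval compact_cbox)
    then show ?thesis by (metis bounded_iff compact_imp_bounded image_eqI)
  qed
  then obtain M where M: "\<And>T x. x \<in> ?C \<Longrightarrow> norm (rt0_eval (q $ T) x) \<le> M T" by metis
  show ?thesis
  proof (rule L2_on_bounded)
    have [measurable]: "rt0_eval r \<in> borel_measurable borel" for r
      by (intro borel_measurable_continuous_onI continuous_rt0_eval)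
    show "field D q \<in> borel_measurable borel"
      unfolding field_def[abs_def] by measurable
    show "norm (field D q x) \<le> (\<Sum>T\<in>UNIV. M T)" if "x \<in> open_rect a b" for x
    proof -
      have x: "x \<in> ?C" using that by (auto simp: open_rect_def)
      have "norm (indicator (cell (corner D T)) x *\<^sub>R rt0_eval (q $ T) x) \<le> M T" for T
        using M[OF x, of T] norm_ge_zero[of "rt0_eval (q $ T) x"] by (auto simp: indicator_def intro: order_trans[OF norm_ge_zero])
      then show ?thesis unfolding field_def by (intro norm_sum[THEN order_trans] sum_mono)
    qed
  qed
qed

lemma div_field_L2: "div_field D q \<in> L2_on (open_rect a b)"
proof (rule L2_on_bounded)
  show "div_field D q \<in> borel_measurable borel"
    unfolding div_field_def[abs_def] by measurable
  show "norm (div_field D q x) \<le> (\<Sum>T\<in>UNIV. \<bar>rt0_div (q $ T)\<bar>)" for x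
    unfolding div_field_def by (intro norm_sum[THEN order_trans] sum_mono) (auto simp: indicator_def)
qed

section \<open>Characterisation of H(div) by normal components\<close>

lemma opposite_outward_sign:
  assumes "inj (corner D)" "pixel_edge D e T" "pixel_edge D e T'" "T \<noteq> T'"
  shows "outward_sign e (corner D T') = - outward_sign e (corner D T)"
proof -
  have "corner D T \<noteq> corner D T'" using assms by (auto dest: injD)
  with assms show ?thesis unfolding pixel_edge_def
    by (cases "corner D T"; cases "corner D T'"; cases e) auto
qed

lemma third_pixel:
  assumes "inj (corner D)" "pixel_edge D e T" "pixel_edge D e T'" "pixel_edge D e T''" "T \<noteq> T'"
  shows "T'' = T \<or> T'' = T'"
proof -
  have ne: "corner D T \<noteq> corner D T'" using assms by (auto dest: injD)
  have "corner D T'' = corner D T \<or> corner D T'' = corner D T'"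
    using ne assms(2-4) unfolding pixel_edge_def
    by (cases "corner D T"; cases "corner D T'"; cases "corner D T''"; cases e) auto
  then show ?thesis using assms(1) by (auto dest: injD)
qed

lemma pixels_of_edge:
  assumes "inj (corner D)" "T \<in> S" "T' \<in> S" "pixel_edge D e T" "pixel_edge D e T'" "T \<noteq> T'"
  shows "{T\<in>S. pixel_edge D e T} = {T, T'}"
  using assms third_pixel[OF assms(1,4,5) _ assms(6)] by auto

lemma outward_sign_cases: "outward_sign e c = 1 \<or> outward_sign e c = - 1"
  by (cases e; cases c) auto

lemma edge_flux_two_pixels:
  assumes "inj (corner D)" "T \<in> S" "T' \<in> S" "pixel_edge D e T" "pixel_edge D e T'" "T \<noteq> T'"
  shows "edge_flux D S q e = outward_sign e (corner D T) * (normal_comp (q $ T) e - normal_comp (q $ T') e)"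
  unfolding edge_flux_def pixels_of_edge[OF assms] using assms(6) opposite_outward_sign[OF assms(1,4,5,6)]
  by (simp add: algebra_simps)

lemma decomposition_inj: "decomposition D \<Longrightarrow> inj (corner D)"
  by (simp add: decomposition_def bij_betw_def)

lemma pixel_at: 
  assumes "decomposition D" "i < width D" "j < height D"
  obtains T where "corner D T = (i, j)"
proof -
  have "(i, j) \<in> range (corner D)"
    using assms by (auto simp: decomposition_def bij_betw_def)
  then show ?thesis using that by auto
qed

text \<open>An edge with only one neighbour among the pixels of a rectangle lies on the boundary of the rectangle,
where test functions vanish.\<close>

lemma edge_integral_boundary:
  assumes D: "decomposition D" and b: "fst b \<le> width D" "snd b \<le> height D"
    and T: "T \<in> pixels_in D a b" "pixel_edge D e T"
    and uniq: "\<And>T'. T' \<in> pixels_in D a b \<Longrightarrow> pixel_edge D e T' \<Longrightarrow> T' = T"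
    and zero: "\<And>x. x \<notin> open_rect a b \<Longrightarrow> \<phi> x = 0"
  shows "edge_integral \<phi> e = 0"
proof (cases e)
  case (VEdge i j)
  obtain k where k: "corner D T = (k, j)" "k = i \<or> Suc k = i"
    using T(2) VEdge by (cases "corner D T") (auto simp: pixel_edge_def)
  have j: "snd a \<le> j" "j < snd b" and ki: "fst a \<le> k" "k < fst b"
    using T(1) k(1) by (auto simp: pixels_in_def)
  have "i = fst a \<or> i = fst b"
  proof (rule ccontr)
    assume ne: "\<not> (i = fst a \<or> i = fst b)"
    \<comment> \<open>the other square at the edge, which would be a second neighbour\<close>
    define k' where "k' = (if k = i then i - 1 else i)"
    have k': "fst a \<le> k'" "k' < fst b" "k' \<noteq> k" "k' = i \<or> Suc k' = i"
      using ne k(2) ki unfolding k'_def by auto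
    obtain T' where T': "corner D T' = (k', j)"
      using pixel_at[OF D, of k' j] k' j b by auto
    then have "T' \<in> pixels_in D a b" "pixel_edge D e T'"
      using k' j VEdge by (auto simp: pixels_in_def pixel_edge_def)
    from uniq[OF this] T' k k'(3) show False by simp
  qed
  then have "(real i, y) \<notin> open_rect a b" for y by (auto simp: open_rect_def)
  with zero VEdge show ?thesis by simp
next
  case (HEdge i j)
  obtain l where l: "corner D T = (i, l)" "l = j \<or> Suc l = j"
    using T(2) HEdge by (cases "corner D T") (auto simp: pixel_edge_def)
  have i: "fst a \<le> i" "i < fst b" and lj: "snd a \<le> l" "l < snd b"
    using T(1) l(1) by (auto simp: pixels_in_def)
  have "j = snd a \<or> j = snd b"
  proof (rule ccontr)
    assume ne: "\<not> (j = snd a \<or> j = snd b)"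
    \<comment> \<open>the other square at the edge, which would be a second neighbour\<close>
    define l' where "l' = (if l = j then j - 1 else j)"
    have l': "snd a \<le> l'" "l' < snd b" "l' \<noteq> l" "l' = j \<or> Suc l' = j"
      using ne l(2) lj unfolding l'_def by auto
    obtain T' where T': "corner D T' = (i, l')"
      using pixel_at[OF D, of i l'] l' i b by auto
    then have "T' \<in> pixels_in D a b" "pixel_edge D e T'"
      using l' i HEdge by (auto simp: pixels_in_def pixel_edge_def)
    from uniq[OF this] T' l l'(3) show False by simp
  qed
  then have "(x, real j) \<notin> open_rect a b" for x by (auto simp: open_rect_def)
  with zero HEdge show ?thesis by simp
qed

lemma edge_bump_eq:
  "edge_bump m (VEdge i j) = (\<lambda>z. bump (m * (fst z - real i)) * bump (3 * (snd z - (real j + 1 / 2))))"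
  "edge_bump m (HEdge i j) = (\<lambda>z. bump (3 * (fst z - (real i + 1 / 2))) * bump (m * (snd z - real j)))"
  by auto

lemma edge_bump_test_function:
  assumes T: "T \<in> pixels_in D a b" "T' \<in> pixels_in D a b" "corner D T \<noteq> corner D T'"
    and e: "pixel_edge D e T" "pixel_edge D e T'" and m: "2 \<le> m"
  shows "\<exists>G. test_function (open_rect a b) (edge_bump m e) G"
proof (cases e)
  case (VEdge i j)
  have c: "fst a + 1 \<le> i" "i + 1 \<le> fst b" "snd a \<le> j" "j + 1 \<le> snd b"
    using T e VEdge
    by (cases "corner D T"; cases "corner D T'"; auto simp: pixels_in_def pixel_edge_def)+
  have "real (fst a) + 1 \<le> real i" "real i + 1 \<le> real (fst b)" "real (snd a) \<le> real j" "real j + 1 \<le> real (snd b)"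
    using c[folded of_nat_le_iff[where 'a=real]] by simp_all
  moreover have "1 / m < 1" using m by simp
  ultimately have "cbox (real i - 1 / m, real j + 1 / 2 - 1 / 3) (real i + 1 / m, real j + 1 / 2 + 1 / 3)
      \<subseteq> open_rect a b"
    by (auto simp: open_rect_def)
  then have "\<exists>G. test_function (open_rect a b)
      (\<lambda>z. bump (m * (fst z - real i)) * bump (3 * (snd z - (real j + 1 / 2)))) G"
    using m by (intro test_function_bump) auto
  then show ?thesis by (simp add: VEdge edge_bump_eq)
next
  case (HEdge i j)
  have c: "fst a \<le> i" "i + 1 \<le> fst b" "snd a + 1 \<le> j" "j + 1 \<le> snd b"
    using T e HEdge
    by (cases "corner D T"; cases "corner D T'"; auto simp: pixels_in_def pixel_edge_def)+
  have "real (fst a) \<le> real i" "real i + 1 \<le> real (fst b)" "real (snd a) + 1 \<le> real j" "real j + 1 \<le> real (snd b)"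
    using c[folded of_nat_le_iff[where 'a=real]] by simp_all
  moreover have "1 / m < 1" using m by simp
  ultimately have "cbox (real i + 1 / 2 - 1 / 3, real j - 1 / m) (real i + 1 / 2 + 1 / 3, real j + 1 / m)
      \<subseteq> open_rect a b"
    by (auto simp: open_rect_def)
  then have "\<exists>G. test_function (open_rect a b)
      (\<lambda>z. bump (3 * (fst z - (real i + 1 / 2))) * bump (m * (snd z - real j))) G"
    using m by (intro test_function_bump) auto
  then show ?thesis by (simp add: HEdge edge_bump_eq)
qed

lemma bump_concentrates: "(\<lambda>n. bump ((real n + 2) * t)) \<longlonglongrightarrow> 0" if "t \<noteq> 0"
proof (rule tendsto_eventually)
  obtain n0 :: nat where n0: "1 / \<bar>t\<bar> \<le> real n0" using real_arch_simple by blast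
  have "bump ((real n + 2) * t) = 0" if "n0 \<le> n" for n
  proof (rule bump_eq_0)
    have "1 \<le> real n0 * \<bar>t\<bar>" using n0 \<open>t \<noteq> 0\<close> by (simp add: field_simps)
    also have "\<dots> \<le> (real n + 2) * \<bar>t\<bar>" using that by (intro mult_right_mono) auto
    also have "\<dots> = \<bar>(real n + 2) * t\<bar>" by (simp add: abs_mult)
    finally show "1 \<le> \<bar>(real n + 2) * t\<bar>" .
  qed
  then show "\<forall>\<^sub>F n in sequentially. bump ((real n + 2) * t) = 0"
    by (auto simp: eventually_sequentially)
qed

lemma AE_edge_bump_lim: "AE x in lborel. (\<lambda>n. edge_bump (real n + 2) e x) \<longlonglongrightarrow> 0"
proof -
  have AE_hyper: "AE x::real\<times>real in lborel. x \<bullet> k \<noteq> c" if "k \<in> Basis" for k c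
  proof -
    have "{x::real\<times>real. x \<bullet> k = c} \<in> null_sets lebesgue"
      using negligible_standard_hyperplane[OF that] by (simp add: negligible_iff_null_sets)
    then have "AE x::real\<times>real in lebesgue. x \<bullet> k \<noteq> c" by (auto dest: AE_not_in)
    then show ?thesis by (simp add: AE_completion_iff)
  qed
  have "AE x::real\<times>real in lborel. fst x \<noteq> c" "AE x::real\<times>real in lborel. snd x \<noteq> c" for c
    using AE_hyper[of "(1, 0)" c] AE_hyper[of "(0, 1)" c]
    by (auto simp: Basis_prod_def inner_prod_def)
  then show ?thesis
  proof (cases e)
    case (VEdge i j)
    have "AE x::real\<times>real in lborel. fst x \<noteq> real i" by fact
    then show ?thesis
      by eventually_elim
        (use VEdge in \<open>auto intro!: tendsto_mult_left_zero bump_concentrates\<close>)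
  next
    case (HEdge i j)
    have "AE x::real\<times>real in lborel. snd x \<noteq> real j" by fact
    then show ?thesis
      by eventually_elim
        (use HEdge in \<open>auto intro!: tendsto_mult_right_zero bump_concentrates\<close>)
  qed
qed

lemma edge_bump_bounds: "0 \<le> edge_bump m e x" "edge_bump m e x \<le> 1"
  by (cases e; simp add: bump_nonneg bump_le_1 mult_le_one)+

lemma continuous_edge_bump: "continuous_on UNIV (edge_bump m e)"
proof (cases e)
  case (VEdge i j)
  then have "edge_bump m e = (\<lambda>z. bump (m * (fst z - real i)) * bump (3 * (snd z - (real j + 1 / 2))))"
    by auto
  then show ?thesis
    by (simp only:) (intro continuous_on_mult continuous_on_compose2[OF continuous_bump[of UNIV]] continuous_intros; simp)
next
  case (HEdge i j)
  then have "edge_bump m e = (\<lambda>z. bump (3 * (fst z - (real i + 1 / 2))) * bump (m * (snd z - real j)))"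
    by auto
  then show ?thesis
    by (simp only:) (intro continuous_on_mult continuous_on_compose2[OF continuous_bump[of UNIV]] continuous_intros; simp)
qed

text \<open>Dominated convergence: the supports shrink to a segment, which is a null set.\<close>

lemma L2_edge_bump_lim:
  fixes f :: "real \<times> real \<Rightarrow> real"
  assumes f: "f \<in> L2_on (open_rect a b)"
  shows "(\<lambda>n. LINT x:open_rect a b|lborel. f x * edge_bump (real n + 2) e x) \<longlonglongrightarrow> 0"
proof -
  let ?U = "open_rect a b"
  have meas: "(\<lambda>x. indicator ?U x *\<^sub>R f x) \<in> borel_measurable lborel"
    and int: "integrable lborel (\<lambda>x. indicator ?U x *\<^sub>R (norm (f x))\<^sup>2)"
    using f by (auto simp: L2_on_def set_borel_measurable_def set_integrable_def)
  have "(\<lambda>x. 1::real) \<in> L2_on ?U" by (rule L2_on_bounded[of _ _ _ 1]) auto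
  then have one: "integrable lborel (\<lambda>x. indicator ?U x *\<^sub>R (1::real))"
    by (auto simp: L2_on_def set_integrable_def)
  have [measurable]: "edge_bump m e \<in> borel_measurable lborel" for m
    using borel_measurable_continuous_onI[OF continuous_edge_bump] by simp
  have "(\<lambda>n. LINT x|lborel. (indicator ?U x *\<^sub>R f x) * edge_bump (real n + 2) e x)
      \<longlonglongrightarrow> (LINT x::real\<times>real|lborel. 0::real)"
  proof (rule integral_dominated_convergence)
    show "(\<lambda>x. (indicator ?U x *\<^sub>R f x) * edge_bump (real n + 2) e x) \<in> borel_measurable lborel" for n
      by (intro borel_measurable_times meas) measurable
    show "integrable lborel (\<lambda>x. indicator ?U x *\<^sub>R 1 + indicator ?U x *\<^sub>R (norm (f x))\<^sup>2)"
      by (intro Bochner_Integration.integrable_add one int)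
    show "AE x in lborel. (\<lambda>n. (indicator ?U x *\<^sub>R f x) * edge_bump (real n + 2) e x) \<longlonglongrightarrow> 0"
      using AE_edge_bump_lim[of e] by eventually_elim (rule tendsto_mult_right_zero)
    show "AE x in lborel. norm ((indicator ?U x *\<^sub>R f x) * edge_bump (real n + 2) e x)
        \<le> indicator ?U x *\<^sub>R 1 + indicator ?U x *\<^sub>R (norm (f x))\<^sup>2" for n
    proof (rule AE_I2)
      fix x
      have "\<bar>f x\<bar> * edge_bump (real n + 2) e x \<le> \<bar>f x\<bar> * 1"
        by (intro mult_left_mono edge_bump_bounds) auto
      also have "\<bar>f x\<bar> * 1 \<le> 1 + (f x)\<^sup>2"
        using sum_squares_bound[of 1 "\<bar>f x\<bar>"] by simp
      finally show "norm ((indicator ?U x *\<^sub>R f x) * edge_bump (real n + 2) e x)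
        \<le> indicator ?U x *\<^sub>R 1 + indicator ?U x *\<^sub>R (norm (f x))\<^sup>2"
        using edge_bump_bounds by (simp add: indicator_def abs_mult)
    qed
  qed simp
  then show ?thesis by (simp add: set_lebesgue_integral_def mult.assoc)
qed

text \<open>If the normal components agree, the fluxes through interior edges cancel, and test functions do not see
the boundary edges.  Conversely, the bumps at an edge isolate its flux, while the integrals against the
square-integrable functions involved tend to 0.\<close>

theorem Hdiv_iff:
  assumes D: "decomposition (D :: 'p::finite decomp)" and b: "fst b \<le> width D" "snd b \<le> height D"
  shows "field D q \<in> Hdiv (open_rect a b) \<longleftrightarrow>
    (\<forall>e. \<forall>T\<in>pixels_in D a b. \<forall>T'\<in>pixels_in D a b. pixel_edge D e T \<longrightarrow> pixel_edge D e T' \<longrightarrow>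
      normal_comp (q $ T) e = normal_comp (q $ T') e)" (is "?L \<longleftrightarrow> ?R")
proof
  let ?U = "open_rect a b" and ?S = "pixels_in D a b"
  assume R: ?R
  have "(LINT x:?U|lborel. field D q x \<bullet> G x) = - (LINT x:?U|lborel. div_field D q x * \<phi> x)"
    if t: "test_function ?U \<phi> G" for \<phi> G
  proof -
    have "edge_integral \<phi> e * edge_flux D ?S q e = 0" if e: "e \<in> edges D ?S" for e
    proof -
      obtain T where T: "T \<in> ?S" "pixel_edge D e T" using e by (auto simp: edges_def)
      show ?thesis
      proof (cases "\<exists>T'\<in>?S. pixel_edge D e T' \<and> T' \<noteq> T")
        case True
        then obtain T' where T': "T' \<in> ?S" "pixel_edge D e T'" "T \<noteq> T'" by auto
        have "normal_comp (q $ T) e = normal_comp (q $ T') e" using R T T'(1,2) by blast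
        then show ?thesis
          using edge_flux_two_pixels[OF decomposition_inj[OF D] T(1) T'(1) T(2) T'(2,3), of q] by simp
      next
        case False
        then show ?thesis
          using edge_integral_boundary[OF D b T, of \<phi>] test_function_support(1)[OF t] by auto
      qed
    qed
    then have "(\<Sum>e\<in>edges D ?S. edge_integral \<phi> e * edge_flux D ?S q e) = 0"
      by (intro sum.neutral) blast
    then show ?thesis using weak_divergence_defect[OF t, of D q] by simp
  qed
  then show ?L
    unfolding Hdiv_def using field_L2 div_field_L2 by blast
next
  let ?U = "open_rect a b" and ?S = "pixels_in D a b"
  assume ?L
  then obtain g where g: "g \<in> L2_on ?U" and weak: "\<And>\<phi> G. test_function ?U \<phi> G \<Longrightarrow>
      (LINT x:?U|lborel. field D q x \<bullet> G x) = - (LINT x:?U|lborel. g x * \<phi> x)"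
    by (auto simp: Hdiv_def)
  have "normal_comp (q $ T) e = normal_comp (q $ T') e"
    if T: "T \<in> ?S" "T' \<in> ?S" "pixel_edge D e T" "pixel_edge D e T'" "T \<noteq> T'" for e T T'
  proof -
    have inj: "inj (corner D)" by (rule decomposition_inj[OF D])
    have ne: "corner D T \<noteq> corner D T'" using inj T(5) by (auto dest: injD)
    have eq: "- (LINT x:?U|lborel. g x * edge_bump (real n + 2) e x)
        + (LINT x:?U|lborel. div_field D q x * edge_bump (real n + 2) e x)
        = edge_integral (edge_bump 1 e) e * edge_flux D ?S q e" for n
    proof -
      obtain G where t: "test_function ?U (edge_bump (real n + 2) e) G"
        using edge_bump_test_function[OF T(1,2) ne T(3,4), of "real n + 2"] by auto
      have "(\<Sum>e'\<in>edges D ?S. edge_integral (edge_bump (real n + 2) e) e' * edge_flux D ?S q e')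
          = (\<Sum>e'\<in>{e}. edge_integral (edge_bump (real n + 2) e) e' * edge_flux D ?S q e')"
      proof (rule sum.mono_neutral_right)
        show "{e} \<subseteq> edges D ?S" using T by (auto simp: edges_def)
      qed (auto simp: edge_integral_edge_bump_other)
      with weak_divergence_defect[OF t, of D q] weak[OF t] show ?thesis
        by (simp add: edge_integral_edge_bump_same[of "real n + 2"])
    qed
    have "(\<lambda>n. - (LINT x:?U|lborel. g x * edge_bump (real n + 2) e x)
        + (LINT x:?U|lborel. div_field D q x * edge_bump (real n + 2) e x)) \<longlonglongrightarrow> - 0 + 0"
      by (intro tendsto_add tendsto_minus L2_edge_bump_lim g div_field_L2)
    then have "edge_integral (edge_bump 1 e) e * edge_flux D ?S q e = 0"
      unfolding eq by (simp add: LIMSEQ_const_iff)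
    then have "edge_flux D ?S q e = 0" using edge_integral_edge_bump_pos[of 1 e] by simp
    then show ?thesis
      using edge_flux_two_pixels[OF inj T(1-5)] outward_sign_cases[of e "corner D T"] by auto
  qed
  then show ?R by blast
qed

section \<open>Fields in terms of their degrees of freedom\<close>

lemma linear_normal_comp: "linear (\<lambda>r. normal_comp r e)"
  by (cases e) (auto intro!: linearI simp: algebra_simps)

text \<open>The four normal components determine a field of lowest order, since each component of it is affine in
one variable and is prescribed at two points.\<close>

lemma rt0_eq_0:
  assumes "\<And>e. e \<in> square_edges c \<Longrightarrow> normal_comp r e = 0"
  shows "r = 0"
proof -
  obtain k l where c: "c = (k, l)" by (cases c)
  have "normal_comp r (VEdge k l) = 0" "normal_comp r (VEdge (Suc k) l) = 0" "normal_comp r (HEdge k l) = 0" "normal_comp r (HEdge k (Suc l)) = 0"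
    by (rule assms; simp add: c square_edges_eq)+
  then have eqs: "fst (fst r) + snd (fst r) * real k = 0" "fst (fst r) + snd (fst r) * real (Suc k) = 0"
      "fst (snd r) + snd (snd r) * real l = 0" "fst (snd r) + snd (snd r) * real (Suc l) = 0"
    by simp_all
  have "snd (fst r) = 0" "snd (snd r) = 0"
    using eqs(1,2) eqs(3,4) by (simp_all add: algebra_simps)
  with eqs(1,3) show ?thesis by (simp add: prod_eq_iff)
qed

lemma pixels_eq: "pixels D s = pixels_in D (sub_lo D s) (sub_hi D s)"
  by (simp add: pixels_def pixels_in_def)

lemma UNIV_eq: "decomposition D \<Longrightarrow> UNIV = pixels_in D (0, 0) (width D, height D)"
proof -
  assume "decomposition D"
  then have "corner D T \<in> {..<width D} \<times> {..<height D}" for T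
    unfolding decomposition_def bij_betw_def by blast
  then show ?thesis by (auto simp: pixels_in_def mem_Times_iff)
qed

definition sub_of :: "'p decomp \<Rightarrow> 'p \<Rightarrow> nat" where
  "sub_of D T = (THE s. s \<in> subs D \<and> T \<in> pixels D s)"

lemma sub_of:
  assumes "decomposition D"
  shows "sub_of D T \<in> subs D" "T \<in> pixels D (sub_of D T)"
proof -
  have "\<exists>!s. s \<in> subs D \<and> T \<in> pixels D s" using assms by (simp add: decomposition_def)
  from theI'[OF this] show "sub_of D T \<in> subs D" "T \<in> pixels D (sub_of D T)"
    by (simp_all add: sub_of_def)
qed

lemma pixels_iff_sub_of:
  assumes "decomposition D" "s \<in> subs D"
  shows "T \<in> pixels D s \<longleftrightarrow> sub_of D T = s"
proof -
  have "\<exists>!s. s \<in> subs D \<and> T \<in> pixels D s" using assms by (simp add: decomposition_def)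
  with assms sub_of[OF assms(1), of T] show ?thesis by blast
qed

lemma finite_subs [simp]: "finite (subs D)" by (simp add: subs_def)

lemma Hdiv_Omega_sub:
  assumes D: "decomposition (D :: 'p::finite decomp)" and s: "s \<in> subs D"
  shows "field D q \<in> Hdiv (Omega_sub D s) \<longleftrightarrow>
    (\<forall>e. \<forall>T\<in>pixels D s. \<forall>T'\<in>pixels D s. pixel_edge D e T \<longrightarrow> pixel_edge D e T' \<longrightarrow>
      normal_comp (q $ T) e = normal_comp (q $ T') e)"
  unfolding Omega_sub_def pixels_eq using D s
  by (intro Hdiv_iff[OF D]) (auto simp: decomposition_def)

lemma Hdiv_Omega:
  assumes D: "decomposition (D :: 'p::finite decomp)"
  shows "field D q \<in> Hdiv (Omega D) \<longleftrightarrow>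
    (\<forall>e T T'. pixel_edge D e T \<longrightarrow> pixel_edge D e T' \<longrightarrow> normal_comp (q $ T) e = normal_comp (q $ T') e)"
  unfolding Omega_def
  using Hdiv_iff[OF D, where b = "(width D, height D)" and a = "(0, 0)" and q = q]
  by (simp add: UNIV_eq[OF D, symmetric])

lemma boundary_edges_pixel:
  "e \<in> boundary_edges D S \<Longrightarrow> T \<in> S \<Longrightarrow> pixel_edge D e T \<Longrightarrow>
    (SOME T. T \<in> S \<and> pixel_edge D e T) = T"
  unfolding boundary_edges_def by (rule some_equality) auto

lemma edge_trace_boundary:
  assumes "e \<in> boundary_edges D S" "T \<in> S" "pixel_edge D e T"
  shows "edge_trace D S q e (edge_normal e) = normal_comp (q $ T) e"
  unfolding edge_trace_def boundary_edges_pixel[OF assms] normal_comp_def ..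

text \<open>An edge has at most two neighbouring pixels, so if they belong to different subdomains, the edge is a
boundary edge of both.\<close>

lemma Gamma_iff:
  assumes D: "decomposition D"
  shows "e \<in> Gamma D \<longleftrightarrow> (\<exists>T T'. pixel_edge D e T \<and> pixel_edge D e T' \<and> sub_of D T \<noteq> sub_of D T')"
proof
  assume "e \<in> Gamma D"
  then obtain s t where st: "s \<in> subs D" "t \<in> subs D" "s < t" "e \<in> boundary_edges D (pixels D s)"
      "e \<in> boundary_edges D (pixels D t)"
    by (auto simp: Gamma_def Gamma_st_def)
  then obtain T T' where "T \<in> pixels D s" "pixel_edge D e T" "T' \<in> pixels D t" "pixel_edge D e T'"
    by (auto simp: boundary_edges_def)
  then show "\<exists>T T'. pixel_edge D e T \<and> pixel_edge D e T' \<and> sub_of D T \<noteq> sub_of D T'"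
    using st pixels_iff_sub_of[OF D] by (metis less_irrefl)
next
  assume "\<exists>T T'. pixel_edge D e T \<and> pixel_edge D e T' \<and> sub_of D T \<noteq> sub_of D T'"
  then obtain T T' where T: "pixel_edge D e T" "pixel_edge D e T'" "sub_of D T < sub_of D T'"
    by (metis linorder_neqE_nat)
  then have ne: "T \<noteq> T'" by auto
  have "e \<in> boundary_edges D (pixels D (sub_of D T))" "e \<in> boundary_edges D (pixels D (sub_of D T'))"
    unfolding boundary_edges_def
    using third_pixel[OF decomposition_inj[OF D] T(1,2) _ ne] T sub_of[OF D]
      pixels_iff_sub_of[OF D sub_of(1)[OF D]] by (auto, metis nat_neq_iff, metis nat_neq_iff)
  then show "e \<in> Gamma D" using T(3) sub_of(1)[OF D] by (auto simp: Gamma_def Gamma_st_def)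
qed

lemma Gamma_subset_edges:
  assumes "decomposition D" shows "Gamma D \<subseteq> edges D UNIV"
  using Gamma_iff[OF assms] by (auto simp: edges_def)

lemma finite_Gamma: "decomposition (D :: 'p::finite decomp) \<Longrightarrow> finite (Gamma D)"
  by (rule finite_subset[OF Gamma_subset_edges finite_edges])

lemma boundary_UNIV_iff:
  assumes D: "decomposition D" and s: "s \<in> subs D"
  shows "e \<in> boundary_edges D (pixels D s) - Gamma D \<longleftrightarrow>
    e \<in> boundary_edges D UNIV \<and> (\<exists>T\<in>pixels D s. pixel_edge D e T)"
proof -
  have "e \<notin> Gamma D \<longleftrightarrow> (\<forall>T T'. pixel_edge D e T \<longrightarrow> pixel_edge D e T' \<longrightarrow> sub_of D T = sub_of D T')"
    unfolding Gamma_iff[OF D] by blast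
  moreover have "T' \<in> pixels D s \<longleftrightarrow> sub_of D T' = s" for T'
    by (rule pixels_iff_sub_of[OF D s])
  ultimately show ?thesis
    unfolding boundary_edges_def by (simp add: Bex_def Ex1_def) blast
qed

lemma restr_nth: "restr S q $ T = (if T \<in> S then q $ T else 0)"
  by (simp add: restr_def)

text \<open>All spaces are described by the values \<open>normal_comp (q $ T) e\<close> with a pixel \<open>T\<close> and an edge \<open>e\<close> of it.
This form makes them visibly linear and easy to compare.\<close>

lemma Yt_sub_iff:
  assumes D: "decomposition (D :: 'p::finite decomp)" and s: "s \<in> subs D"
  shows "q \<in> Yt_sub D s \<longleftrightarrow> (\<forall>T. T \<notin> pixels D s \<longrightarrow> q $ T = 0) \<and>
    (\<forall>e. \<forall>T\<in>pixels D s. \<forall>T'\<in>pixels D s. pixel_edge D e T \<longrightarrow> pixel_edge D e T' \<longrightarrow>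
      normal_comp (q $ T) e = normal_comp (q $ T') e) \<and>
    (\<forall>e\<in>boundary_edges D UNIV. \<forall>T\<in>pixels D s. pixel_edge D e T \<longrightarrow> normal_comp (q $ T) e = 0)"
proof -
  have "(\<forall>e\<in>boundary_edges D (pixels D s) - Gamma D. edge_trace D (pixels D s) q e (edge_normal e) = 0)
    \<longleftrightarrow> (\<forall>e\<in>boundary_edges D UNIV. \<forall>T\<in>pixels D s. pixel_edge D e T \<longrightarrow> normal_comp (q $ T) e = 0)"
    (is "?L = ?R")
  proof
    assume L: ?L
    show ?R
    proof (intro ballI impI)
      fix e T assume e: "e \<in> boundary_edges D UNIV" and T: "T \<in> pixels D s" "pixel_edge D e T"
      then have e': "e \<in> boundary_edges D (pixels D s) - Gamma D"
        using boundary_UNIV_iff[OF D s] by blast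
      with L edge_trace_boundary[OF _ T, of q] show "normal_comp (q $ T) e = 0" by auto
    qed
  next
    assume R: ?R
    show ?L
    proof
      fix e assume e: "e \<in> boundary_edges D (pixels D s) - Gamma D"
      then obtain T where T: "e \<in> boundary_edges D UNIV" "T \<in> pixels D s" "pixel_edge D e T"
        using boundary_UNIV_iff[OF D s] by blast
      with e R show "edge_trace D (pixels D s) q e (edge_normal e) = 0"
        using edge_trace_boundary[of e D "pixels D s" T q] by auto
    qed
  qed
  then show ?thesis
    unfolding Yt_sub_def RT_space_def mem_Collect_eq Hdiv_Omega_sub[OF D s] by simp
qed

lemma Yt_iff:
  assumes D: "decomposition (D :: 'p::finite decomp)"
  shows "q \<in> Yt D \<longleftrightarrow>
    (\<forall>e T T'. pixel_edge D e T \<longrightarrow> pixel_edge D e T' \<longrightarrow> sub_of D T = sub_of D T' \<longrightarrow>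
      normal_comp (q $ T) e = normal_comp (q $ T') e) \<and>
    (\<forall>e\<in>boundary_edges D UNIV. \<forall>T. pixel_edge D e T \<longrightarrow> normal_comp (q $ T) e = 0)"
proof -
  have "q \<in> Yt D \<longleftrightarrow> (\<forall>s\<in>subs D. 
    (\<forall>e. \<forall>T\<in>pixels D s. \<forall>T'\<in>pixels D s. pixel_edge D e T \<longrightarrow> pixel_edge D e T' \<longrightarrow>
      normal_comp (q $ T) e = normal_comp (q $ T') e) \<and>
    (\<forall>e\<in>boundary_edges D UNIV. \<forall>T\<in>pixels D s. pixel_edge D e T \<longrightarrow> normal_comp (q $ T) e = 0))"
    unfolding Yt_def by (simp add: Yt_sub_iff[OF D] restr_nth)
  also have "\<dots> \<longleftrightarrow> (\<forall>e T T'. pixel_edge D e T \<longrightarrow> pixel_edge D e T' \<longrightarrow> sub_of D T = sub_of D T' \<longrightarrow>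
      normal_comp (q $ T) e = normal_comp (q $ T') e) \<and>
    (\<forall>e\<in>boundary_edges D UNIV. \<forall>T. pixel_edge D e T \<longrightarrow> normal_comp (q $ T) e = 0)"
    (is "?L \<longleftrightarrow> ?R")
  proof
    assume L: ?L
    show ?R
    proof (intro conjI allI ballI impI)
      fix e T T' assume "pixel_edge D e T" "pixel_edge D e T'" "sub_of D T = sub_of D T'"
      then show "normal_comp (q $ T) e = normal_comp (q $ T') e"
        using L sub_of[OF D, of T] sub_of[OF D, of T'] by metis
    next
      fix e T assume "e \<in> boundary_edges D UNIV" "pixel_edge D e T"
      then show "normal_comp (q $ T) e = 0" using L sub_of[OF D, of T] by blast
    qed
  next
    assume R: ?R
    have "sub_of D T = s" if "s \<in> subs D" "T \<in> pixels D s" for s T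
      using pixels_iff_sub_of[OF D that(1)] that(2) by simp
    with R show ?L by blast
  qed
  finally show ?thesis .
qed

lemma Y_space_iff:
  assumes D: "decomposition (D :: 'p::finite decomp)"
  shows "q \<in> Y_space D \<longleftrightarrow>
    (\<forall>e T T'. pixel_edge D e T \<longrightarrow> pixel_edge D e T' \<longrightarrow> normal_comp (q $ T) e = normal_comp (q $ T') e) \<and>
    (\<forall>e\<in>boundary_edges D UNIV. \<forall>T. pixel_edge D e T \<longrightarrow> normal_comp (q $ T) e = 0)"
proof -
  have "(\<forall>e\<in>boundary_edges D UNIV. edge_trace D UNIV q e (edge_normal e) = 0)
    \<longleftrightarrow> (\<forall>e\<in>boundary_edges D UNIV. \<forall>T. pixel_edge D e T \<longrightarrow> normal_comp (q $ T) e = 0)"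
  proof -
    have "edge_trace D UNIV q e (edge_normal e) = normal_comp (q $ T) e"
      if "e \<in> boundary_edges D UNIV" "pixel_edge D e T" for e T
      using edge_trace_boundary[OF that(1) _ that(2)] by simp
    moreover have "\<exists>T. pixel_edge D e T" if "e \<in> boundary_edges D UNIV" for e
      using that by (auto simp: boundary_edges_def)
    ultimately show ?thesis by metis
  qed
  then show ?thesis
    unfolding Y_space_def RT_space_def mem_Collect_eq Hdiv_Omega[OF D] by simp
qed

lemma Y_subset_Yt:
  assumes "decomposition (D :: 'p::finite decomp)" shows "Y_space D \<subseteq> Yt D"
  using Y_space_iff[OF assms] Yt_iff[OF assms] by blast

lemma normal_comp_0 [simp]: "normal_comp 0 e = 0" by (rule linear_0[OF linear_normal_comp])

lemma subspace_Yt: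
  assumes "decomposition (D :: 'p::finite decomp)" shows "subspace (Yt D)"
proof (rule subspaceI)
  show "0 \<in> Yt D" by (simp add: Yt_iff[OF assms])
next
  fix x y assume "x \<in> Yt D" "y \<in> Yt D"
  then show "x + y \<in> Yt D"
    unfolding Yt_iff[OF assms] vector_add_component linear_add[OF linear_normal_comp] by (metis add_0)
next
  fix c x assume "x \<in> Yt D"
  then show "c *\<^sub>R x \<in> Yt D"
    unfolding Yt_iff[OF assms] vector_scaleR_component linear_scale[OF linear_normal_comp] by (metis scaleR_zero_right)
qed

lemma subspace_Yt_sub:
  assumes "decomposition (D :: 'p::finite decomp)" "s \<in> subs D" shows "subspace (Yt_sub D s)"
proof (rule subspaceI)
  show "0 \<in> Yt_sub D s" by (simp add: Yt_sub_iff[OF assms])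
next
  fix x y assume "x \<in> Yt_sub D s" "y \<in> Yt_sub D s"
  then show "x + y \<in> Yt_sub D s"
    unfolding Yt_sub_iff[OF assms] vector_add_component linear_add[OF linear_normal_comp] by (metis add_0)
next
  fix c x assume "x \<in> Yt_sub D s"
  then show "c *\<^sub>R x \<in> Yt_sub D s"
    unfolding Yt_sub_iff[OF assms] vector_scaleR_component linear_scale[OF linear_normal_comp] by (metis scaleR_zero_right)
qed

text \<open>The choice of a neighbouring pixel in \<open>dof\<close> is immaterial once the one-sided normal components agree.\<close>

lemma dof_eq:
  assumes "T \<in> S" "pixel_edge D e T"
    and "\<And>T'. T' \<in> S \<Longrightarrow> pixel_edge D e T' \<Longrightarrow> normal_comp (q $ T') e = normal_comp (q $ T) e"
  shows "dof D S q e = normal_comp (q $ T) e"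
proof -
  have "(SOME T. T \<in> S \<and> pixel_edge D e T) \<in> S \<and> pixel_edge D e (SOME T. T \<in> S \<and> pixel_edge D e T)"
    using someI[of "\<lambda>T. T \<in> S \<and> pixel_edge D e T" T] assms(1,2) by blast
  with assms(3) show ?thesis by (simp add: dof_def edge_trace_def normal_comp_def)
qed

lemma dofs_Yt_sub_iff:
  assumes D: "decomposition (D :: 'p::finite decomp)" and s: "s \<in> subs D"
  shows "e \<in> dofs_Yt_sub D s \<longleftrightarrow> (\<exists>T\<in>pixels D s. pixel_edge D e T) \<and> e \<notin> boundary_edges D UNIV"
  unfolding dofs_Yt_sub_def using boundary_UNIV_iff[OF D s, of e] by (auto simp: edges_def)

lemma finite_dofs [simp]: "finite (dofs_Yt_sub (D :: 'p::finite decomp) s)"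
  unfolding dofs_Yt_sub_def by simp

lemma Ct_sub_iff:
  assumes D: "decomposition (D :: 'p::finite decomp)" and s: "s \<in> subs D"
  shows "q \<in> Ct_sub D s \<longleftrightarrow> q \<in> Yt_sub D s \<and>
    (\<forall>e. \<forall>T\<in>pixels D s. pixel_edge D e T \<longrightarrow> \<bar>normal_comp (q $ T) e\<bar> \<le> 1)"
proof (cases "q \<in> Yt_sub D s")
  case True
  note Y = True[unfolded Yt_sub_iff[OF D s]]
  have dof: "dof D (pixels D s) q e = normal_comp (q $ T) e" if "T \<in> pixels D s" "pixel_edge D e T" for e T
    using that Y by (intro dof_eq) blast+
  have "(\<forall>e\<in>dofs_Yt_sub D s. \<bar>dof D (pixels D s) q e\<bar> \<le> 1) \<longleftrightarrow>
    (\<forall>e. \<forall>T\<in>pixels D s. pixel_edge D e T \<longrightarrow> \<bar>normal_comp (q $ T) e\<bar> \<le> 1)" (is "?L \<longleftrightarrow> ?R")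
  proof
    assume L: ?L
    show ?R
    proof (intro allI ballI impI)
      fix e T assume T: "T \<in> pixels D s" "pixel_edge D e T"
      show "\<bar>normal_comp (q $ T) e\<bar> \<le> 1"
      proof (cases "e \<in> boundary_edges D UNIV")
        case True
        then have "normal_comp (q $ T) e = 0" using Y T by blast
        then show ?thesis by simp
      next
        case False
        then have "e \<in> dofs_Yt_sub D s" using T dofs_Yt_sub_iff[OF D s] by blast
        with L dof[OF T] show ?thesis by auto
      qed
    qed
  next
    assume R: ?R
    show ?L
    proof
      fix e assume "e \<in> dofs_Yt_sub D s"
      then obtain T where "T \<in> pixels D s" "pixel_edge D e T" using dofs_Yt_sub_iff[OF D s] by blast
      with R dof show "\<bar>dof D (pixels D s) q e\<bar> \<le> 1" by simp
    qed
  qed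
  with True show ?thesis by (simp add: Ct_sub_def)
qed (simp add: Ct_sub_def)

text \<open>The product of the sets \<open>Ct_sub\<close>, see \<open>Ct_iff_Ct_sub\<close>.  Bounding the normal components on all edges is
equivalent to bounding the degrees of freedom, because the remaining ones vanish.\<close>

definition Ct :: "'p::finite decomp \<Rightarrow> (rt0 ^ 'p) set" where
  "Ct D = {q \<in> Yt D. \<forall>e T. pixel_edge D e T \<longrightarrow> \<bar>normal_comp (q $ T) e\<bar> \<le> 1}"

lemma Ct_iff_Ct_sub:
  assumes D: "decomposition (D :: 'p::finite decomp)"
  shows "q \<in> Ct D \<longleftrightarrow> (\<forall>s\<in>subs D. restr (pixels D s) q \<in> Ct_sub D s)"
proof -
  have "(\<forall>s\<in>subs D. restr (pixels D s) q \<in> Ct_sub D s) \<longleftrightarrow> q \<in> Yt D \<and>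
     (\<forall>s\<in>subs D. \<forall>e. \<forall>T\<in>pixels D s. pixel_edge D e T \<longrightarrow> \<bar>normal_comp (q $ T) e\<bar> \<le> 1)"
    by (auto simp: Ct_sub_iff[OF D] Yt_def restr_nth)
  also have "(\<forall>s\<in>subs D. \<forall>e. \<forall>T\<in>pixels D s. pixel_edge D e T \<longrightarrow> \<bar>normal_comp (q $ T) e\<bar> \<le> 1)
      \<longleftrightarrow> (\<forall>e T. pixel_edge D e T \<longrightarrow> \<bar>normal_comp (q $ T) e\<bar> \<le> 1)"
    using sub_of[OF D] by blast
  finally show ?thesis by (auto simp: Ct_def)
qed

lemma C_set_iff:
  assumes D: "decomposition (D :: 'p::finite decomp)"
  shows "q \<in> C_set D \<longleftrightarrow> q \<in> Y_space D \<and> (\<forall>e T. pixel_edge D e T \<longrightarrow> \<bar>normal_comp (q $ T) e\<bar> \<le> 1)"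
proof (cases "q \<in> Y_space D")
  case True
  note Y = True[unfolded Y_space_iff[OF D]]
  have dof: "dof D UNIV q e = normal_comp (q $ T) e" if "pixel_edge D e T" for e T
    using that Y by (intro dof_eq) blast+
  have "\<bar>normal_comp (q $ T) e\<bar> \<le> 1" if "\<forall>e\<in>dofs_Y D. \<bar>dof D UNIV q e\<bar> \<le> 1" "pixel_edge D e T" for e T
  proof (cases "e \<in> boundary_edges D UNIV")
    case True
    then have "normal_comp (q $ T) e = 0" using Y that(2) by blast
    then show ?thesis by simp
  next
    case False
    then have "e \<in> dofs_Y D" using that(2) by (auto simp: dofs_Y_def edges_def)
    with that dof show ?thesis by auto
  qed
  moreover have "\<bar>dof D UNIV q e\<bar> \<le> 1"
    if bd: "\<forall>e T. pixel_edge D e T \<longrightarrow> \<bar>normal_comp (q $ T) e\<bar> \<le> 1" and e: "e \<in> dofs_Y D" for e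
  proof -
    obtain T where "pixel_edge D e T" using e by (auto simp: dofs_Y_def edges_def)
    with bd dof show ?thesis by simp
  qed
  ultimately show ?thesis using True unfolding C_set_def by blast
qed (simp add: C_set_def)

lemma C_subset_Ct: "decomposition (D :: 'p::finite decomp) \<Longrightarrow> C_set D \<subseteq> Ct D"
  using Y_subset_Yt[of D] by (auto simp: C_set_iff Ct_def)

section \<open>The jump operator\<close>

text \<open>On an interface edge the sum in \<open>jump\<close> has one term, belonging to the two pixels at the edge; \<open>\<kappa>\<close>
compares the interface normal with the edge normal.\<close>

lemma Gamma_pixels:
  assumes D: "decomposition (D :: 'p::finite decomp)" and e: "e \<in> Gamma D"
  obtains T T' \<kappa> where "pixel_edge D e T" "pixel_edge D e T'" "sub_of D T < sub_of D T'"
    "\<kappa> = 1 \<or> \<kappa> = - 1"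
    "\<And>q. jump D q e = \<kappa> * (normal_comp (q $ T) e - normal_comp (q $ T') e)"
proof -
  obtain T T' where T: "pixel_edge D e T" "pixel_edge D e T'" "sub_of D T < sub_of D T'"
    using e unfolding Gamma_iff[OF D] by (metis linorder_neqE_nat)
  then have ne: "T \<noteq> T'" by auto
  note third = third_pixel[OF decomposition_inj[OF D] T(1,2) _ ne]
  let ?s = "sub_of D T" and ?t = "sub_of D T'"
  have pix: "T'' \<in> pixels D s \<longleftrightarrow> sub_of D T'' = s" if "s \<in> subs D" for s T''
    by (rule pixels_iff_sub_of[OF D that])
  have bd: "e \<in> boundary_edges D (pixels D s) \<longleftrightarrow> s = ?s \<or> s = ?t" if "s \<in> subs D" for s
  proof
    assume "e \<in> boundary_edges D (pixels D s)"
    then obtain T'' where "T'' \<in> pixels D s" "pixel_edge D e T''" by (auto simp: boundary_edges_def)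
    then show "s = ?s \<or> s = ?t" using third pix[OF that] by metis
  next
    assume "s = ?s \<or> s = ?t"
    then show "e \<in> boundary_edges D (pixels D s)"
      unfolding boundary_edges_def mem_Collect_eq pix[OF that]
      using T third by (metis less_irrefl)
  qed
  have s: "?s \<in> subs D" "?t \<in> subs D" using sub_of(1)[OF D] by auto
  have "{(s, t). s \<in> subs D \<and> t \<in> subs D \<and> s < t \<and> e \<in> Gamma_st D s t} = {(?s, ?t)}"
    using s T(3) by (auto simp: Gamma_st_def bd)
  then have jump: "jump D q e = edge_trace D (pixels D ?s) (restr (pixels D ?s) q) e (nrm D ?s ?t)
        - edge_trace D (pixels D ?t) (restr (pixels D ?t) q) e (nrm D ?s ?t)" for q
    by (simp add: jump_def)
  have "e \<in> Gamma_st D ?s ?t" using bd s by (simp add: Gamma_st_def)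
  then have nrm: "nrm D ?s ?t = edge_normal e \<or> nrm D ?s ?t = - edge_normal e"
    using D s T(3) unfolding decomposition_def by blast
  have tr: "edge_trace D (pixels D ?s) (restr (pixels D ?s) q) e v = rt0_eval (q $ T) (edge_mid e) \<bullet> v"
    "edge_trace D (pixels D ?t) (restr (pixels D ?t) q) e v = rt0_eval (q $ T') (edge_mid e) \<bullet> v" for q v
    unfolding edge_trace_def
    using boundary_edges_pixel[of e D "pixels D ?s" T] boundary_edges_pixel[of e D "pixels D ?t" T'] bd s T
      sub_of(2)[OF D] by (simp_all add: restr_nth)
  define \<kappa> :: real where "\<kappa> = (if nrm D ?s ?t = edge_normal e then 1 else - 1)"
  have "nrm D ?s ?t = \<kappa> *\<^sub>R edge_normal e" using nrm by (auto simp: \<kappa>_def)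
  then have "jump D q e = \<kappa> * (normal_comp (q $ T) e - normal_comp (q $ T') e)" for q
    unfolding jump tr by (simp add: normal_comp_def algebra_simps)
  with T show thesis by (intro that[of T T' \<kappa>]) (auto simp: \<kappa>_def)
qed

lemma linear_jump: "linear (\<lambda>q. jump D q e)"
proof -
  have "linear (\<lambda>q. edge_trace D S (restr S q) e v)" for S v
    unfolding edge_trace_def restr_nth rt0_eval_alt
    by (auto intro!: linearI simp: inner_prod_def algebra_simps)
  then show ?thesis
    unfolding jump_def case_prod_beta
    by (intro linear_compose_sum linear_compose_sub ballI)
qed

lemma linear_dof: "linear (\<lambda>q. dof D S (restr S q) e)"
  unfolding dof_def edge_trace_def restr_nth rt0_eval_alt
  by (auto intro!: linearI simp: inner_prod_def algebra_simps)

lemma inner_Yt_sym: "inner_Yt D p q = inner_Yt D q p"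
  by (simp add: inner_Yt_def inner_Yt_sub_def mult.commute)

lemma bilinear_inner_Yt: "bilinear (inner_Yt D)"
proof -
  have "linear (\<lambda>q. inner_Yt D p q)" for p
    unfolding inner_Yt_def inner_Yt_sub_def
    by (intro linearI) (simp_all add: linear_add[OF linear_dof] linear_scale[OF linear_dof]
        sum.distrib sum_distrib_left algebra_simps)
  moreover have "(\<lambda>p. inner_Yt D p q) = inner_Yt D q" for q
    by (rule ext) (rule inner_Yt_sym)
  ultimately show ?thesis by (simp add: bilinear_def)
qed

lemma inner_Yt_sub_nonneg: "0 \<le> inner_Yt_sub D s p p"
  by (simp add: inner_Yt_sub_def sum_nonneg)

lemma inner_Yt_nonneg: "0 \<le> inner_Yt D p p"
  by (simp add: inner_Yt_def sum_nonneg inner_Yt_sub_nonneg)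

text \<open>Definiteness only holds on \<open>Yt D\<close>, where the degrees of freedom determine the field.\<close>

lemma inner_Yt_definite:
  assumes D: "decomposition (D :: 'p::finite decomp)" and q: "q \<in> Yt D" and 0: "inner_Yt D q q = 0"
  shows "q = 0"
proof -
  note Y = q[unfolded Yt_iff[OF D]]
  have "normal_comp (q $ T) e = 0" if T: "pixel_edge D e T" for e T
  proof (cases "e \<in> boundary_edges D UNIV")
    case True then show ?thesis using Y T by blast
  next
    case False
    let ?s = "sub_of D T"
    have s: "?s \<in> subs D" "T \<in> pixels D ?s" using sub_of[OF D] by auto
    then have e: "e \<in> dofs_Yt_sub D ?s" using dofs_Yt_sub_iff[OF D] T False by blast
    have "inner_Yt_sub D ?s (restr (pixels D ?s) q) (restr (pixels D ?s) q) = 0"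
      using 0 s(1) unfolding inner_Yt_def
      by (subst (asm) sum_nonneg_eq_0_iff) (auto intro: inner_Yt_sub_nonneg)
    then have "dof D (pixels D ?s) (restr (pixels D ?s) q) e = 0"
      using e unfolding inner_Yt_sub_def by (subst (asm) sum_nonneg_eq_0_iff) auto
    moreover have "dof D (pixels D ?s) (restr (pixels D ?s) q) e = normal_comp (restr (pixels D ?s) q $ T) e"
    proof (rule dof_eq[OF s(2) T])
      fix T' assume T': "T' \<in> pixels D ?s" "pixel_edge D e T'"
      then have "normal_comp (q $ T') e = normal_comp (q $ T) e"
        using Y T pixels_iff_sub_of[OF D s(1)] by blast
      then show "normal_comp (restr (pixels D ?s) q $ T') e = normal_comp (restr (pixels D ?s) q $ T) e"
        using T' s by (simp add: restr_nth)
    qed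
    ultimately show ?thesis using s by (simp add: restr_nth)
  qed
  then have "q $ T = 0" for T
    by (intro rt0_eq_0[of "corner D T"]) (simp add: pixel_edge_def square_edges_def)
  then show ?thesis by (simp add: vec_eq_iff)
qed

text \<open>Each jump is a difference of two degrees of freedom that occur in no other jump, and
\<open>(a - b)\<^sup>2 \<le> 2 (a\<^sup>2 + b\<^sup>2)\<close>.\<close>

lemma jump_bound:
  assumes D: "decomposition (D :: 'p::finite decomp)"
  shows "(\<Sum>e\<in>Gamma D. (jump D q e)\<^sup>2) \<le> 2 * inner_Yt D q q"
proof -
  define f where "f s e = (dof D (pixels D s) (restr (pixels D s) q) e)\<^sup>2" for s e
  have f: "0 \<le> f s e" for s e by (simp add: f_def)
  have "(jump D q e)\<^sup>2 \<le> 2 * (\<Sum>s\<in>{s\<in>subs D. e \<in> dofs_Yt_sub D s}. f s e)" if e: "e \<in> Gamma D" for e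
  proof -
    obtain T T' \<kappa> where T: "pixel_edge D e T" "pixel_edge D e T'" "sub_of D T < sub_of D T'"
      and \<kappa>: "\<kappa> = 1 \<or> \<kappa> = - 1" and J: "\<And>q. jump D q e = \<kappa> * (normal_comp (q $ T) e - normal_comp (q $ T') e)"
      using Gamma_pixels[OF D e] by metis
    let ?s = "sub_of D T" and ?t = "sub_of D T'"
    have ne: "T \<noteq> T'" using T by auto
    note third = third_pixel[OF decomposition_inj[OF D] T(1,2) _ ne]
    have st: "?s \<in> subs D" "?t \<in> subs D" "T \<in> pixels D ?s" "T' \<in> pixels D ?t"
      using sub_of[OF D] by auto
    have "e \<notin> boundary_edges D UNIV" using T ne by (auto simp: boundary_edges_def)
    then have dofs: "e \<in> dofs_Yt_sub D ?s" "e \<in> dofs_Yt_sub D ?t"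
      using dofs_Yt_sub_iff[OF D] T st by blast+
    have ds: "dof D (pixels D ?s) (restr (pixels D ?s) q) e = normal_comp (restr (pixels D ?s) q $ T) e"
      using third T(3) pixels_iff_sub_of[OF D st(1)] by (intro dof_eq st(3) T(1)) (metis less_irrefl)
    have dt: "dof D (pixels D ?t) (restr (pixels D ?t) q) e = normal_comp (restr (pixels D ?t) q $ T') e"
      using third T(3) pixels_iff_sub_of[OF D st(2)] by (intro dof_eq st(4) T(2)) (metis less_irrefl)
    have "(jump D q e)\<^sup>2 = (normal_comp (q $ T) e - normal_comp (q $ T') e)\<^sup>2"
      using \<kappa> by (auto simp: J power_mult_distrib)
    also have "\<dots> \<le> 2 * ((normal_comp (q $ T) e)\<^sup>2 + (normal_comp (q $ T') e)\<^sup>2)"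
      using zero_le_power2[of "normal_comp (q $ T) e + normal_comp (q $ T') e"] by (simp add: power2_eq_square algebra_simps)
    also have "\<dots> = 2 * (\<Sum>s\<in>{?s, ?t}. f s e)"
      using T(3) st by (simp add: f_def ds dt restr_nth)
    also have "\<dots> \<le> 2 * (\<Sum>s\<in>{s\<in>subs D. e \<in> dofs_Yt_sub D s}. f s e)"
      using st dofs f by (intro mult_left_mono sum_mono2) auto
    finally show ?thesis .
  qed
  then have "(\<Sum>e\<in>Gamma D. (jump D q e)\<^sup>2)
      \<le> (\<Sum>e\<in>Gamma D. 2 * (\<Sum>s\<in>{s\<in>subs D. e \<in> dofs_Yt_sub D s}. f s e))"
    by (rule sum_mono)
  also have "\<dots> = 2 * (\<Sum>e\<in>Gamma D. \<Sum>s\<in>{s\<in>subs D. e \<in> dofs_Yt_sub D s}. f s e)"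
    by (simp add: sum_distrib_left)
  also have "(\<Sum>e\<in>Gamma D. \<Sum>s\<in>{s\<in>subs D. e \<in> dofs_Yt_sub D s}. f s e)
      = (\<Sum>s\<in>subs D. \<Sum>e\<in>{e\<in>Gamma D. e \<in> dofs_Yt_sub D s}. f s e)"
    by (rule sum.swap_restrict) (simp_all add: finite_Gamma[OF D])
  also have "\<dots> \<le> (\<Sum>s\<in>subs D. \<Sum>e\<in>dofs_Yt_sub D s. f s e)"
    using f by (intro sum_mono sum_mono2) auto
  also have "\<dots> = inner_Yt D q q"
    by (simp add: inner_Yt_def inner_Yt_sub_def f_def power2_eq_square)
  finally show ?thesis by simp
qed

text \<open>Riesz representation for an inner product unrelated to the ambient one.  The vector whose coordinates
in an orthonormal basis of \<open>V\<close> are the pairings of \<open>w\<close> with the basis depends linearly and injectively on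
\<open>w\<close>, hence is an arbitrary element of \<open>V\<close>.\<close>

lemma Riesz_subspace:
  fixes ip :: "'a::euclidean_space \<Rightarrow> 'a \<Rightarrow> real"
  assumes V: "subspace V" and ip: "bilinear ip"
    and definite: "\<And>x. x \<in> V \<Longrightarrow> ip x x = 0 \<Longrightarrow> x = 0" and f: "linear f"
  shows "\<exists>!w. w \<in> V \<and> (\<forall>x\<in>V. f x = ip x w)"
proof -
  obtain Bs where Bs: "Bs \<subseteq> V" "pairwise orthogonal Bs" "\<And>b. b \<in> Bs \<Longrightarrow> norm b = 1"
    "independent Bs" "card Bs = dim V" "span Bs = V"
    using orthonormal_basis_subspace[OF V] by metis
  have fin: "finite Bs" using Bs(4) by (rule independent_imp_finite)
  define \<Psi> where "\<Psi> w = (\<Sum>b\<in>Bs. ip b w *\<^sub>R b)" for w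
  have coeff: "(\<Sum>b\<in>Bs. c b *\<^sub>R b) \<bullet> b' = c b'" if "b' \<in> Bs" for c b'
  proof -
    have "(\<Sum>b\<in>Bs. c b *\<^sub>R b) \<bullet> b' = (\<Sum>b\<in>Bs. if b = b' then c b' else 0)"
      unfolding inner_sum_left
    proof (rule sum.cong[OF refl])
      fix b assume b: "b \<in> Bs"
      show "(c b *\<^sub>R b) \<bullet> b' = (if b = b' then c b' else 0)"
      proof (cases "b = b'")
        case True
        with Bs(3)[OF b] show ?thesis by (simp add: dot_square_norm)
      next
        case False
        with Bs(2) b that have "b \<bullet> b' = 0" by (auto simp: pairwise_def orthogonal_def)
        with False show ?thesis by simp
      qed
    qed
    then show ?thesis using fin that by simp
  qed
  have lin_r: "linear (ip x)" for x using ip by (simp add: bilinear_def)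
  have lin_l: "linear (\<lambda>x. ip x w)" for w using ip by (simp add: bilinear_def)
  have lin: "linear \<Psi>"
    unfolding \<Psi>_def
    by (intro linear_compose_sum ballI linearI) (simp_all add: linear_add[OF lin_r] linear_scale[OF lin_r] scaleR_add_left)
  have ext: "g x = h x" if "linear g" "linear h" "\<And>b. b \<in> Bs \<Longrightarrow> g b = h b" "x \<in> V"
    for g h :: "'a \<Rightarrow> real" and x
    using linear_eq_on_span[OF that(1,2)] that(3,4) Bs(6) by blast
  have inj0: "w = 0" if "w \<in> V" "\<Psi> w = 0" for w
  proof -
    have "ip b w = 0" if "b \<in> Bs" for b
      using coeff[OF that, of "\<lambda>b. ip b w"] \<open>\<Psi> w = 0\<close> by (simp add: \<Psi>_def)
    then have "ip w w = 0"
      using ext[of "\<lambda>x. ip x w" "\<lambda>_. 0" w] lin_l that(1) by (simp add: linear_zero)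
    with definite that(1) show "w = 0" by blast
  qed
  have inj: "inj_on \<Psi> V"
    using linear_injective_on_subspace_0[OF lin V] inj0 by blast
  have "\<Psi> ` V \<subseteq> V"
    unfolding \<Psi>_def using Bs(1) by (auto intro!: subspace_sum[OF V] subspace_scale[OF V])
  moreover have "dim (\<Psi> ` V) = dim V"
    by (rule dim_image_eq[OF lin]) (use inj V in \<open>simp add: span_eq_iff[THEN iffD2]\<close>)
  ultimately have surj: "\<Psi> ` V = V"
    using subspace_dim_equal[OF linear_subspace_image[OF lin V] V] by simp
  have "(\<Sum>b\<in>Bs. f b *\<^sub>R b) \<in> V"
    using Bs(1) by (auto intro!: subspace_sum[OF V] subspace_scale[OF V])
  then obtain w where w: "w \<in> V" "\<Psi> w = (\<Sum>b\<in>Bs. f b *\<^sub>R b)" using surj by (metis imageE)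
  have "f b = ip b w" if "b \<in> Bs" for b
    using coeff[OF that, of "\<lambda>b. ip b w"] coeff[OF that, of f] w(2) by (simp add: \<Psi>_def)
  then have repr: "\<forall>x\<in>V. f x = ip x w"
    using ext[OF f lin_l[of w]] by blast
  show ?thesis
  proof (rule ex1I[of _ w])
    show "w \<in> V \<and> (\<forall>x\<in>V. f x = ip x w)" using w(1) repr by blast
    fix w' assume w': "w' \<in> V \<and> (\<forall>x\<in>V. f x = ip x w')"
    have d: "w' - w \<in> V" using w' w(1) V by (simp add: subspace_diff)
    have "ip (w' - w) (w' - w) = 0"
      using w' repr d linear_diff[OF lin_r, of "w' - w" w' w] by simp
    with definite[OF d] show "w' = w" by simp
  qed
qed

lemma jump_adj:
  assumes D: "decomposition (D :: 'p::finite decomp)"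
  shows "jump_adj D l \<in> Yt D" "p \<in> Yt D \<Longrightarrow> inner_Gamma D (jump D p) l = inner_Yt D p (jump_adj D l)"
proof -
  have "linear (\<lambda>p. inner_Gamma D (jump D p) l)"
    unfolding inner_Gamma_def
    by (auto intro!: linearI simp: linear_add[OF linear_jump] linear_scale[OF linear_jump]
        sum.distrib sum_distrib_left algebra_simps)
  from theI'[OF Riesz_subspace[OF subspace_Yt[OF D] bilinear_inner_Yt inner_Yt_definite[OF D] this]]
  show "jump_adj D l \<in> Yt D" "p \<in> Yt D \<Longrightarrow> inner_Gamma D (jump D p) l = inner_Yt D p (jump_adj D l)"
    unfolding jump_adj_def by blast+
qed

section \<open>Averaging across the interfaces\<close>

text \<open>On each pixel, the field of lowest order with normal components \<open>f\<close> on the four edges.\<close>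

definition field_of_dofs :: "'p::finite decomp \<Rightarrow> (edge \<Rightarrow> real) \<Rightarrow> rt0 ^ 'p" where
  "field_of_dofs D f = (\<chi> T. case corner D T of (k, l) \<Rightarrow>
     let b1 = f (VEdge (Suc k) l) - f (VEdge k l); b2 = f (HEdge k (Suc l)) - f (HEdge k l)
     in ((f (VEdge k l) - b1 * real k, b1), (f (HEdge k l) - b2 * real l, b2)))"

lemma normal_comp_field_of_dofs:
  assumes "pixel_edge D e T" shows "normal_comp (field_of_dofs D f $ T) e = f e"
  using assms by (cases e; cases "corner D T")
    (auto simp: field_of_dofs_def pixel_edge_def Let_def algebra_simps)

definition edge_average :: "'p::finite decomp \<Rightarrow> rt0 ^ 'p \<Rightarrow> edge \<Rightarrow> real" where
  "edge_average D q e = (\<Sum>T | pixel_edge D e T. normal_comp (q $ T) e) / card {T. pixel_edge D e T}"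

lemma edge_average_const:
  assumes "pixel_edge D e T" "\<And>T'. pixel_edge D e T' \<Longrightarrow> normal_comp (q $ T') e = c"
  shows "edge_average D q e = c"
proof -
  have "card {T. pixel_edge D e T} \<noteq> 0" using assms(1) by auto
  moreover have "(\<Sum>T | pixel_edge D e T. normal_comp (q $ T) e) = (\<Sum>T | pixel_edge D e T. c)"
    using assms(2) by (intro sum.cong) auto
  ultimately show ?thesis by (simp add: edge_average_def)
qed

text \<open>Averages of numbers in \<open>[-1, 1]\<close> stay there, and averaging makes the normal components single-valued.\<close>

lemma averaged_field_in_C:
  assumes D: "decomposition (D :: 'p::finite decomp)" and q: "q \<in> Ct D"
  shows "field_of_dofs D (edge_average D q) \<in> C_set D"
proof -
  have Y: "q \<in> Yt D" and bd: "\<And>e T. pixel_edge D e T \<Longrightarrow> \<bar>normal_comp (q $ T) e\<bar> \<le> 1"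
    using q by (auto simp: Ct_def)
  have "edge_average D q e = 0" if "e \<in> boundary_edges D UNIV" "pixel_edge D e T" for e T
    using that Y unfolding Yt_iff[OF D] by (intro edge_average_const) blast+
  moreover have "\<bar>edge_average D q e\<bar> \<le> 1" if "pixel_edge D e T" for e T
  proof -
    let ?A = "{T. pixel_edge D e T}"
    have "0 < card ?A" using that by (auto simp: card_gt_0_iff)
    moreover have "\<bar>\<Sum>T\<in>?A. normal_comp (q $ T) e\<bar> \<le> (\<Sum>T\<in>?A. 1)"
      by (rule order_trans[OF sum_abs sum_mono]) (simp add: bd)
    ultimately show ?thesis unfolding edge_average_def abs_divide by (simp add: divide_le_eq_1)
  qed
  ultimately show ?thesis
    unfolding C_set_iff[OF D] Y_space_iff[OF D] by (auto simp: normal_comp_field_of_dofs)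
qed

text \<open>Summation by parts: every pixel contributes its one-sided normal component at an edge, weighted by the
value of \<open>u\<close> with the outward sign.\<close>

lemma inner_divp:
  fixes D :: "'p::finite decomp"
  shows "u \<bullet> divp q = (\<Sum>e\<in>edges D UNIV. \<Sum>T | pixel_edge D e T. u $ T * outward_sign e (corner D T) * normal_comp (q $ T) e)"
proof -
  have "u $ T * rt0_div (q $ T) = (\<Sum>e\<in>square_edges (corner D T). u $ T * outward_sign e (corner D T) * normal_comp (q $ T) e)" for T
    by (simp add: rt0_div_eq_flux[of _ "corner D T"] sum_distrib_left mult.assoc)
  then have "u \<bullet> divp q = (\<Sum>T\<in>UNIV. \<Sum>e\<in>square_edges (corner D T). u $ T * outward_sign e (corner D T) * normal_comp (q $ T) e)"
    by (simp add: inner_vec_def divp_def)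
  then show ?thesis by (simp add: sum_pixels_edges)
qed

text \<open>Away from the interfaces averaging changes nothing.  At an interface edge with neighbours \<open>T\<close> and \<open>T'\<close>,
whose outward signs are opposite, the two normal components move by half the jump in opposite
directions, so the change of \<open>\<langle>u, div q\<rangle>\<close> is the jump times the mean of \<open>u $ T\<close> and \<open>u $ T'\<close>.\<close>

lemma multiplier_for_averaging:
  assumes D: "decomposition (D :: 'p::finite decomp)"
  shows "\<exists>l. \<forall>q\<in>Yt D. u \<bullet> divp (field_of_dofs D (edge_average D q)) = u \<bullet> divp q + inner_Gamma D (jump D q) l"
proof -
  let ?\<delta> = "\<lambda>q e. \<Sum>T | pixel_edge D e T. u $ T * outward_sign e (corner D T) * (edge_average D q e - normal_comp (q $ T) e)"
  have off: "?\<delta> q e = 0" if q: "q \<in> Yt D" and e: "e \<notin> Gamma D" for q e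
  proof (rule sum.neutral, rule ballI)
    fix T assume "T \<in> {T. pixel_edge D e T}"
    then have T: "pixel_edge D e T" by simp
    have "normal_comp (q $ T') e = normal_comp (q $ T) e" if "pixel_edge D e T'" for T'
    proof -
      have "sub_of D T' = sub_of D T" using e T that unfolding Gamma_iff[OF D] by blast
      then show ?thesis using q T that unfolding Yt_iff[OF D] by blast
    qed
    from edge_average_const[OF T this] show "u $ T * outward_sign e (corner D T) * (edge_average D q e - normal_comp (q $ T) e) = 0" by simp
  qed
  have "\<exists>m. \<forall>q. ?\<delta> q e = jump D q e * m" if e: "e \<in> Gamma D" for e
  proof -
    obtain T T' \<kappa> where T: "pixel_edge D e T" "pixel_edge D e T'" "sub_of D T < sub_of D T'"
      and \<kappa>: "\<kappa> = 1 \<or> \<kappa> = - 1" and J: "\<And>q. jump D q e = \<kappa> * (normal_comp (q $ T) e - normal_comp (q $ T') e)"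
      using Gamma_pixels[OF D e] by metis
    have ne: "T \<noteq> T'" using T by auto
    have A: "{T. pixel_edge D e T} = {T, T'}"
      using pixels_of_edge[OF decomposition_inj[OF D] UNIV_I UNIV_I T(1,2) ne] by simp
    \<comment> \<open>the mean of the two values of u, with the sign that compares the interface normal with the outer normals\<close>
    let ?m = "- \<kappa> * outward_sign e (corner D T) * (u $ T + u $ T') / 2"
    have "?\<delta> q e = jump D q e * ?m" for q
    proof -
      define a b o1 where "a = normal_comp (q $ T) e" and "b = normal_comp (q $ T') e" and "o1 = outward_sign e (corner D T)"
      have "?\<delta> q e = u $ T * o1 * ((a + b) / 2 - a) + u $ T' * (- o1) * ((a + b) / 2 - b)"
        unfolding A edge_average_def using ne opposite_outward_sign[OF decomposition_inj[OF D] T(1,2) ne]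
        by (simp add: a_def b_def o1_def)
      also have "\<dots> = (\<kappa> * \<kappa>) * ((a - b) * (- o1 * (u $ T + u $ T') / 2))"
      proof -
        have half: "(a + b) / 2 - a = - ((a - b) / 2)" "(a + b) / 2 - b = (a - b) / 2"
          by (simp_all add: field_simps)
        have "\<kappa> * \<kappa> = 1" using \<kappa> by auto
        then show ?thesis unfolding half by (simp add: field_simps)
      qed
      also have "\<dots> = jump D q e * ?m"
        unfolding J a_def b_def o1_def by simp
      finally show ?thesis .
    qed
    then show ?thesis by blast
  qed
  then obtain l where "\<forall>e\<in>Gamma D. \<forall>q. ?\<delta> q e = jump D q e * l e"
    using bchoice[of "Gamma D" "\<lambda>e m. \<forall>q. ?\<delta> q e = jump D q e * m"] by blast
  then have l: "?\<delta> q e = jump D q e * l e" if "e \<in> Gamma D" for q e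
    using that by blast
  have "u \<bullet> divp (field_of_dofs D (edge_average D q)) = u \<bullet> divp q + inner_Gamma D (jump D q) l" if q: "q \<in> Yt D" for q
  proof -
    have "u \<bullet> divp (field_of_dofs D (edge_average D q)) - u \<bullet> divp q = (\<Sum>e\<in>edges D UNIV. ?\<delta> q e)"
      unfolding inner_divp[of _ _ D] sum_subtractf[symmetric]
      by (intro sum.cong refl) (simp add: normal_comp_field_of_dofs algebra_simps)
    also have "\<dots> = (\<Sum>e\<in>Gamma D. ?\<delta> q e)"
      using off[OF q] Gamma_subset_edges[OF D] by (intro sum.mono_neutral_right) auto
    also have "\<dots> = inner_Gamma D (jump D q) l"
      unfolding inner_Gamma_def by (intro sum.cong refl l)
    finally show ?thesis by simp
  qed
  then show ?thesis by blast
qed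

section \<open>Duality for a minimiser of a sum with a support function\<close>

text \<open>A minimax theorem at a given minimiser, equivalently the sum rule for subdifferentials.  Separating the
epigraph of \<open>f\<close> from the set below \<open>m - h\<close>, where \<open>h\<close> is the support function of \<open>K\<close> and \<open>m\<close> the minimum,
gives an affine function in between.  Since \<open>h\<close> is finite everywhere, the hyperplane is not vertical;
since \<open>h\<close> is positively homogeneous, its slope lies in \<open>K\<close>.\<close>

lemma support_point_of_minimizer:
  fixes f :: "'a::euclidean_space \<Rightarrow> real"
  assumes V: "convex V" and f: "convex_on V f" and K: "compact K" "convex K" "K \<noteq> {}"
    and u: "u \<in> V" and min: "\<And>v. v \<in> V \<Longrightarrow> f u + (SUP k\<in>K. u \<bullet> k) \<le> f v + (SUP k\<in>K. v \<bullet> k)"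
  shows "\<exists>k\<in>K. (\<forall>v\<in>V. f u + u \<bullet> k \<le> f v + v \<bullet> k) \<and> (\<forall>k'\<in>K. u \<bullet> k' \<le> u \<bullet> k)"
proof -
  define h where "h v = (SUP k\<in>K. v \<bullet> k)" for v
  have bdd: "bdd_above ((\<bullet>) v ` K)" for v
    by (intro compact_imp_bounded bounded_imp_bdd_above compact_continuous_image K(1) continuous_intros)
  have h_upper: "v \<bullet> k \<le> h v" if "k \<in> K" for v k
    unfolding h_def using bdd that by (intro cSUP_upper) auto
  have h_least: "h v \<le> c" if "\<And>k. k \<in> K \<Longrightarrow> v \<bullet> k \<le> c" for v c
    unfolding h_def using K(3) that by (intro cSUP_least)
  have h_convex: "h ((1 - t) *\<^sub>R x + t *\<^sub>R y) \<le> (1 - t) * h x + t * h y" if "0 \<le> t" "t \<le> 1" for t x y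
    using that h_upper
    by (intro h_least) (auto simp: inner_add_left intro!: add_mono mult_left_mono)
  define m where "m = f u + h u"
  let ?A = "{x::'a \<times> real. fst x \<in> V \<and> f (fst x) \<le> snd x}"
  let ?B = "{x::'a \<times> real. snd x < m - h (fst x)}"
  have A: "convex ?A"
  proof (rule convexI)
    fix x y :: "'a \<times> real" and s t :: real
    assume xy: "x \<in> ?A" "y \<in> ?A" and st: "0 \<le> s" "0 \<le> t" "s + t = 1"
    have "f (s *\<^sub>R fst x + t *\<^sub>R fst y) \<le> s * f (fst x) + t * f (fst y)"
      using f xy st by (auto simp: convex_on_def)
    also have "\<dots> \<le> s * snd x + t * snd y" using xy st by (intro add_mono mult_left_mono) auto
    finally show "s *\<^sub>R x + t *\<^sub>R y \<in> ?A" using V xy st by (auto simp: convex_def)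
  qed
  have B: "convex ?B"
  proof (rule convexI)
    fix x y :: "'a \<times> real" and s t :: real
    assume xy: "x \<in> ?B" "y \<in> ?B" and st: "0 \<le> s" "0 \<le> t" "s + t = 1"
    have s: "s = 1 - t" using st by simp
    have "s * snd x + t * snd y < s * (m - h (fst x)) + t * (m - h (fst y))"
    proof (cases "s = 0")
      case True with xy st show ?thesis by simp
    next
      case False
      then have "0 < s" using st(1) by simp
      have "s * snd x < s * (m - h (fst x))" "t * snd y \<le> t * (m - h (fst y))"
        using xy st(2) \<open>0 < s\<close> by (simp_all add: mult_left_mono)
      then show ?thesis by (rule add_less_le_mono)
    qed
    also have "\<dots> \<le> m - h (s *\<^sub>R fst x + t *\<^sub>R fst y)"
      using h_convex[of t "fst x" "fst y"] st by (simp add: s algebra_simps)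
    finally show "s *\<^sub>R x + t *\<^sub>R y \<in> ?B" by simp
  qed
  have disj: "?A \<inter> ?B = {}" using min unfolding m_def h_def by fastforce
  have "(u, f u) \<in> ?A" "(0, m - h 0 - 1) \<in> ?B" using u by auto
  then obtain a b where a: "a \<noteq> 0" and aA: "\<And>x. x \<in> ?A \<Longrightarrow> a \<bullet> x \<le> b" and aB: "\<And>x. x \<in> ?B \<Longrightarrow> b \<le> a \<bullet> x"
    using separating_hyperplane_sets[OF A B _ _ disj] by blast
  obtain w \<rho> where a_eq: "a = (w, \<rho>)" by (cases a)
  have wA: "w \<bullet> v + \<rho> * r \<le> b" if "v \<in> V" "f v \<le> r" for v r
    using aA[of "(v, r)"] that by (simp add: a_eq)
  have wB: "b \<le> w \<bullet> v + \<rho> * r" if "r < m - h v" for v r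
    using aB[of "(v, r)"] that by (simp add: a_eq)
  have "\<rho> < 0"
  proof (rule ccontr)
    assume "\<not> \<rho> < 0"
    moreover have "\<not> 0 < \<rho>"
    proof
      assume pos: "0 < \<rho>"
      \<comment> \<open>a point of the epigraph high enough to violate the bound b\<close>
      let ?r = "max (f u) ((b - w \<bullet> u) / \<rho> + 1)"
      have "\<rho> * ((b - w \<bullet> u) / \<rho> + 1) \<le> \<rho> * ?r" using pos by (intro mult_left_mono) auto
      then have "b - w \<bullet> u + \<rho> \<le> \<rho> * ?r" using pos by (simp add: distrib_left)
      with wA[OF u, of ?r] pos show False by simp
    qed
    ultimately have \<rho>: "\<rho> = 0" by simp
    have lower: "b \<le> w \<bullet> v" for v using wB[of "m - h v - 1" v] \<rho> by simp
    have "w \<bullet> w = 0"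
    proof (rule ccontr)
      assume ne: "w \<bullet> w \<noteq> 0"
      have "b \<le> w \<bullet> (((b - 1) / (w \<bullet> w)) *\<^sub>R w)" by (rule lower)
      also have "\<dots> = b - 1" using ne by simp
      finally show False by simp
    qed
    with \<rho> a a_eq show False by (simp add: zero_prod_def)
  qed
  define k where "k = (1 / \<rho>) *\<^sub>R w"
  have vk: "v \<bullet> k = (w \<bullet> v) / \<rho>" for v by (simp add: k_def inner_commute)
  have kA: "b / \<rho> \<le> v \<bullet> k + f v" if "v \<in> V" for v
    using wA[OF that order_refl] \<open>\<rho> < 0\<close> unfolding vk by (simp add: field_simps)
  have kB: "v \<bullet> k + (m - h v) \<le> b / \<rho>" for v
  proof -
    have "v \<bullet> k + r \<le> b / \<rho>" if "r < m - h v" for r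
    proof -
      have "v \<bullet> k + r = (w \<bullet> v + \<rho> * r) / \<rho>"
        using \<open>\<rho> < 0\<close> by (simp add: vk field_simps)
      also have "\<dots> \<le> b / \<rho>"
        using wB[OF that] \<open>\<rho> < 0\<close> by (intro divide_right_mono_neg) auto
      finally show ?thesis .
    qed
    note below = this
    show ?thesis
    proof (rule dense_le)
      fix x assume "x < v \<bullet> k + (m - h v)"
      then show "x \<le> b / \<rho>" using below[of "x - v \<bullet> k"] by simp
    qed
  qed
  have b: "b / \<rho> = u \<bullet> k + f u" using kA[OF u] kB[of u] by (simp add: m_def)
  have 1: "f u + u \<bullet> k \<le> f v + v \<bullet> k" if "v \<in> V" for v using kA[OF that] b by simp
  have 2: "h u - u \<bullet> k \<le> h v - v \<bullet> k" for v using kB[of v] b by (simp add: m_def)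
  \<comment> \<open>the affine bound at 0 and at twice the minimiser forces equality there\<close>
  have "h u - u \<bullet> k \<le> 0" using 2[of 0] h_least[of 0 0] by simp
  moreover have "h (2 *\<^sub>R u) \<le> 2 * h u"
    using h_upper by (intro h_least) auto
  with 2[of "2 *\<^sub>R u"] have "0 \<le> h u - u \<bullet> k" by simp
  ultimately have hu: "h u = u \<bullet> k" by simp
  have k_le: "v \<bullet> k \<le> h v" for v using 2[of v] hu by simp
  have "k \<in> K"
  proof (rule ccontr)
    assume "k \<notin> K"
    then obtain a0 b0 where "a0 \<bullet> k < b0" "\<And>x. x \<in> K \<Longrightarrow> b0 < a0 \<bullet> x"
      using separating_hyperplane_closed_point[OF K(2) compact_imp_closed[OF K(1)]] by blast
    note a0 = this
    have "h (- a0) \<le> - b0" using a0(2) by (intro h_least) (simp add: less_imp_le)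
    moreover have "- b0 < (- a0) \<bullet> k" using a0(1) by simp
    ultimately have "h (- a0) < (- a0) \<bullet> k" by linarith
    with k_le[of "- a0"] show False by simp
  qed
  moreover have "u \<bullet> k' \<le> u \<bullet> k" if "k' \<in> K" for k'
    using h_upper[OF that, of u] hu by simp
  ultimately show ?thesis using 1 by blast
qed

section \<open>Separable suprema and the geometry of the discrete spaces\<close>

text \<open>A sum of suprema is the supremum over all independent choices; finite summands exclude the sum of
opposite infinities.\<close>

lemma sum_SUP_le:
  fixes h :: "'i \<Rightarrow> 'b \<Rightarrow> real"
  assumes "finite I" "\<And>i. i \<in> I \<Longrightarrow> A i \<noteq> {}"
    and "\<And>v. (\<And>i. i \<in> I \<Longrightarrow> v i \<in> A i) \<Longrightarrow> (\<Sum>i\<in>I. h i (v i)) \<le> c"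
  shows "(\<Sum>i\<in>I. SUP x\<in>A i. ereal (h i x)) \<le> ereal c"
  using assms
proof (induction I arbitrary: c)
  case (insert j I)
  let ?S = "\<Sum>i\<in>I. SUP x\<in>A i. ereal (h i x)"
  have S_le: "?S \<le> ereal (c - h j x)" if x: "x \<in> A j" for x
  proof (rule insert.IH)
    fix v assume v: "\<And>i. i \<in> I \<Longrightarrow> v i \<in> A i"
    have "(\<Sum>i\<in>insert j I. h i ((v(j := x)) i)) \<le> c"
      using v x by (intro insert.prems(2)) auto
    moreover have "(\<Sum>i\<in>I. h i ((v(j := x)) i)) = (\<Sum>i\<in>I. h i (v i))"
      using insert.hyps(2) by (intro sum.cong) auto
    ultimately show "(\<Sum>i\<in>I. h i (v i)) \<le> c - h j x"
      using insert.hyps by simp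
  qed (use insert.prems in auto)
  obtain x0 where x0: "x0 \<in> A j" using insert.prems(1)[of j] by auto
  have v0: "(SOME x. x \<in> A i) \<in> A i" if "i \<in> I" for i
    using insert.prems(1)[of i] that by (auto simp: some_in_eq)
  have "ereal (\<Sum>i\<in>I. h i (SOME x. x \<in> A i)) \<le> ?S"
    unfolding sum_ereal[symmetric] using v0 by (intro sum_mono SUP_upper)
  with S_le[OF x0] obtain r where r: "?S = ereal r" by (cases ?S) auto
  have "(SUP x\<in>A j. ereal (h j x)) \<le> ereal (c - r)"
  proof (rule SUP_least)
    fix x assume "x \<in> A j"
    from S_le[OF this] r show "ereal (h j x) \<le> ereal (c - r)" by simp
  qed
  then have "(SUP x\<in>A j. ereal (h j x)) + ?S \<le> ereal (c - r) + ereal r"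
    unfolding r by (rule add_right_mono)
  then show ?case using insert.hyps by simp
next
  case empty
  then show ?case using empty(2)[of undefined] by (simp add: zero_ereal_def)
qed

lemma linear_divp: "linear divp"
  by (rule linearI) (simp_all add: divp_def vec_eq_iff rt0_div_alt algebra_simps)

lemma divp_restr: "divp (restr S q) = restr S (divp q)"
  by (simp add: divp_def vec_eq_iff restr_nth rt0_div_alt)

lemma linear_restr: "linear (restr S :: 'a::real_vector ^ 'p::finite \<Rightarrow> _)"
  by (rule linearI) (simp_all add: vec_eq_iff restr_nth)

lemma restr_in_X_sub: "restr (pixels D s) v \<in> X_sub D s"
  by (simp add: X_sub_def restr_nth)

lemma inner_split:
  assumes D: "decomposition (D :: 'p::finite decomp)"
  shows "v \<bullet> w = (\<Sum>s\<in>subs D. restr (pixels D s) v \<bullet> restr (pixels D s) (w :: real ^ 'p))"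
proof -
  have "restr (pixels D s) v \<bullet> restr (pixels D s) w = (\<Sum>T\<in>{T\<in>UNIV. sub_of D T = s}. v $ T * w $ T)"
    if "s \<in> subs D" for s
    unfolding inner_vec_def restr_nth pixels_iff_sub_of[OF D that]
    by (intro sum.mono_neutral_cong_right) auto
  then have "(\<Sum>s\<in>subs D. restr (pixels D s) v \<bullet> restr (pixels D s) w)
      = (\<Sum>s\<in>subs D. \<Sum>T\<in>{T\<in>UNIV. sub_of D T = s}. v $ T * w $ T)"
    by (intro sum.cong) auto
  also have "\<dots> = (\<Sum>T\<in>UNIV. v $ T * w $ T)"
    by (rule sum.group) (auto simp: sub_of(1)[OF D])
  finally show ?thesis by (simp add: inner_vec_def)
qed

lemma glue:
  assumes D: "decomposition (D :: 'p::finite decomp)" and v: "\<And>s. s \<in> subs D \<Longrightarrow> v s \<in> X_sub D s"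
  shows "\<exists>x. \<forall>s\<in>subs D. restr (pixels D s) x = v s"
proof (intro exI ballI)
  fix s assume s: "s \<in> subs D"
  show "restr (pixels D s) (\<chi> T. v (sub_of D T) $ T) = v s"
    using v[OF s] pixels_iff_sub_of[OF D s] by (auto simp: vec_eq_iff restr_nth X_sub_def)
qed

lemma subspace_Y_space:
  assumes "decomposition (D :: 'p::finite decomp)" shows "subspace (Y_space D)"
proof (rule subspaceI)
  show "0 \<in> Y_space D" by (simp add: Y_space_iff[OF assms])
next
  fix x y assume "x \<in> Y_space D" "y \<in> Y_space D"
  then show "x + y \<in> Y_space D"
    unfolding Y_space_iff[OF assms] vector_add_component linear_add[OF linear_normal_comp] by (metis add_0)
next
  fix c x assume "x \<in> Y_space D"
  then show "c *\<^sub>R x \<in> Y_space D"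
    unfolding Y_space_iff[OF assms] vector_scaleR_component linear_scale[OF linear_normal_comp] by (metis scaleR_zero_right)
qed

text \<open>The box constraint on its own.  Intersecting it with the respective subspace gives \<open>C\<close>, its broken
version and the local sets, which are therefore compact and convex.\<close>

definition unit_dofs :: "'p::finite decomp \<Rightarrow> (rt0 ^ 'p) set" where
  "unit_dofs D = {q. \<forall>e T. pixel_edge D e T \<longrightarrow> \<bar>normal_comp (q $ T) e\<bar> \<le> 1}"

lemma convex_unit_dofs: "convex (unit_dofs D)"
proof (rule convexI)
  fix x y :: "rt0 ^ 'a" and s t :: real
  assume xy: "x \<in> unit_dofs D" "y \<in> unit_dofs D" and st: "0 \<le> s" "0 \<le> t" "s + t = 1"
  have "\<bar>s * normal_comp (x $ T) e + t * normal_comp (y $ T) e\<bar> \<le> 1" if "pixel_edge D e T" for e T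
  proof -
    have "\<bar>s * normal_comp (x $ T) e + t * normal_comp (y $ T) e\<bar> \<le> s * \<bar>normal_comp (x $ T) e\<bar> + t * \<bar>normal_comp (y $ T) e\<bar>"
      using st by (metis abs_mult abs_of_nonneg abs_triangle_ineq)
    also have "\<dots> \<le> s * 1 + t * 1"
      using xy st that by (intro add_mono mult_left_mono) (auto simp: unit_dofs_def)
    finally show ?thesis using st by simp
  qed
  then show "s *\<^sub>R x + t *\<^sub>R y \<in> unit_dofs D"
    by (simp add: unit_dofs_def linear_add[OF linear_normal_comp] linear_scale[OF linear_normal_comp])
qed

text \<open>Opposite edges of a pixel have distance 1, so bounds at both of them bound the slope, and then the
constant term, of each affine component.\<close>

lemma compact_unit_dofs: "compact (unit_dofs (D :: 'p::finite decomp))"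
proof -
  have cont: "continuous_on UNIV (\<lambda>q :: rt0 ^ 'p. normal_comp (q $ T) e)" for T e
  proof (rule linear_continuous_on)
    have "linear (\<lambda>q :: rt0 ^ 'p. normal_comp (q $ T) e)"
      by (rule linearI) (simp_all add: linear_add[OF linear_normal_comp] linear_scale[OF linear_normal_comp])
    then show "bounded_linear (\<lambda>q :: rt0 ^ 'p. normal_comp (q $ T) e)"
      by (simp add: linear_conv_bounded_linear)
  qed
  have "closed (\<Inter>e. \<Inter>T\<in>{T. pixel_edge D e T}. {q :: rt0 ^ 'p. \<bar>normal_comp (q $ T) e\<bar> \<le> 1})"
    by (intro closed_INT ballI closed_Collect_le continuous_on_const continuous_on_rabs cont)
  moreover have "unit_dofs D = (\<Inter>e. \<Inter>T\<in>{T. pixel_edge D e T}. {q. \<bar>normal_comp (q $ T) e\<bar> \<le> 1})"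
    by (auto simp: unit_dofs_def)
  ultimately have "closed (unit_dofs D)" by simp
  moreover have "bounded (unit_dofs D)"
  proof -
    define M where "M T = (3 + 2 * real (fst (corner D T))) + (3 + 2 * real (snd (corner D T)))" for T
    have "norm (q $ T) \<le> M T" if q: "q \<in> unit_dofs D" for q T
    proof -
      obtain k l where c: "corner D T = (k, l)" by (cases "corner D T")
      obtain a1 b1 a2 b2 where r: "q $ T = ((a1, b1), (a2, b2))" by (metis surj_pair)
      have *: "\<bar>normal_comp (q $ T) e\<bar> \<le> 1" if "e \<in> square_edges (k, l)" for e
        using q that by (auto simp: unit_dofs_def pixel_edge_def square_edges_def c)
      have bds: "\<bar>a + b * x\<bar> \<le> 1 \<Longrightarrow> \<bar>a + b * (x + 1)\<bar> \<le> 1 \<Longrightarrow> 0 \<le> x \<Longrightarrow> \<bar>a\<bar> + \<bar>b\<bar> \<le> 3 + 2 * x" for a b x :: real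
      proof -
        assume h: "\<bar>a + b * x\<bar> \<le> 1" "\<bar>a + b * (x + 1)\<bar> \<le> 1" "0 \<le> x"
        then have b: "\<bar>b\<bar> \<le> 2" by (simp add: distrib_left)
        have "\<bar>a\<bar> \<le> 1 + \<bar>b * x\<bar>" using h(1) by linarith
        also have "\<bar>b * x\<bar> \<le> 2 * x" using b h(3) by (simp add: abs_mult mult_right_mono)
        finally show ?thesis using b by simp
      qed
      have "norm (q $ T) \<le> norm (a1, b1) + norm (a2, b2)" unfolding r by (rule norm_Pair_le)
      also have "\<dots> \<le> (\<bar>a1\<bar> + \<bar>b1\<bar>) + (\<bar>a2\<bar> + \<bar>b2\<bar>)"
        using norm_Pair_le[of a1 b1] norm_Pair_le[of a2 b2] by simp
      also have "\<dots> \<le> M T"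
        using *[of "VEdge k l"] *[of "VEdge (Suc k) l"] *[of "HEdge k l"] *[of "HEdge k (Suc l)"]
        unfolding M_def c by (intro add_mono bds) (simp_all add: square_edges_eq r algebra_simps)
      finally show ?thesis .
    qed
    moreover have "norm q \<le> (\<Sum>T\<in>UNIV. norm (q $ T))" for q :: "rt0 ^ 'p"
      unfolding norm_vec_def by (rule L2_set_le_sum) simp
    ultimately have "\<forall>q\<in>unit_dofs D. norm q \<le> (\<Sum>T\<in>UNIV. M T)"
      by (meson order_trans sum_mono)
    then show ?thesis by (auto simp: bounded_iff)
  qed
  ultimately show ?thesis by (simp add: compact_eq_bounded_closed)
qed

lemma Ct_eq: "Ct D = Yt D \<inter> unit_dofs D"
  by (auto simp: Ct_def unit_dofs_def)

lemma C_set_eq: "decomposition (D :: 'p::finite decomp) \<Longrightarrow> C_set D = Y_space D \<inter> unit_dofs D"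
  by (auto simp: C_set_iff unit_dofs_def)

lemma
  assumes D: "decomposition (D :: 'p::finite decomp)"
  shows compact_Ct: "compact (Ct D)" and convex_Ct: "convex (Ct D)"
    and compact_C: "compact (C_set D)" and convex_C: "convex (C_set D)"
  unfolding Ct_eq C_set_eq[OF D]
  by (intro closed_Int_compact convex_Int convex_unit_dofs compact_unit_dofs
      closed_subspace subspace_imp_convex[OF subspace_Yt[OF D]]
      subspace_imp_convex[OF subspace_Y_space[OF D]] subspace_Yt[OF D] subspace_Y_space[OF D])+

lemma zero_in_C: "decomposition (D :: 'p::finite decomp) \<Longrightarrow> 0 \<in> C_set D"
  using subspace_0[OF subspace_Y_space] by (auto simp: C_set_eq unit_dofs_def)

lemma minus_in_C: "decomposition (D :: 'p::finite decomp) \<Longrightarrow> q \<in> C_set D \<Longrightarrow> - q \<in> C_set D"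
  using subspace_neg[OF subspace_Y_space, of D q]
  by (auto simp: C_set_eq unit_dofs_def linear_neg[OF linear_normal_comp])

lemma convex_Ct_sub:
  assumes D: "decomposition (D :: 'p::finite decomp)" and s: "s \<in> subs D"
  shows "convex (Ct_sub D s)"
proof -
  have "q \<in> Ct_sub D s \<longleftrightarrow> q \<in> Yt_sub D s \<and> q \<in> unit_dofs D" for q
    unfolding Ct_sub_iff[OF D s] unit_dofs_def mem_Collect_eq
  proof (intro conj_cong refl)
    assume "q \<in> Yt_sub D s"
    then have "q $ T = 0" if "T \<notin> pixels D s" for T using that Yt_sub_iff[OF D s] by blast
    then show "(\<forall>e. \<forall>T\<in>pixels D s. pixel_edge D e T \<longrightarrow> \<bar>normal_comp (q $ T) e\<bar> \<le> 1)
        \<longleftrightarrow> (\<forall>e T. pixel_edge D e T \<longrightarrow> \<bar>normal_comp (q $ T) e\<bar> \<le> 1)"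
      by (metis abs_zero normal_comp_0 zero_le_one)
  qed
  then have "Ct_sub D s = Yt_sub D s \<inter> unit_dofs D" by auto
  then show ?thesis
    by (simp add: convex_Int subspace_imp_convex subspace_Yt_sub[OF D s] convex_unit_dofs)
qed

section \<open>The local saddle point problems\<close>

lemma linear_dof_sub: "linear (\<lambda>q. dof D S q e)"
  unfolding dof_def edge_trace_def rt0_eval_alt
  by (auto intro!: linearI simp: inner_prod_def algebra_simps)

lemma bilinear_inner_Yt_sub: "bilinear (inner_Yt_sub D s)"
proof -
  have "linear (\<lambda>q. inner_Yt_sub D s p q)" for p
    unfolding inner_Yt_sub_def
    by (intro linearI) (simp_all add: linear_add[OF linear_dof_sub] linear_scale[OF linear_dof_sub]
        sum.distrib sum_distrib_left algebra_simps)
  moreover have "(\<lambda>p. inner_Yt_sub D s p q) = inner_Yt_sub D s q" for q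
    by (rule ext) (simp add: inner_Yt_sub_def mult.commute)
  ultimately show ?thesis by (simp add: bilinear_def)
qed

lemma inner_Yt_sub_sym: "inner_Yt_sub D s p q = inner_Yt_sub D s q p"
  by (simp add: inner_Yt_sub_def mult.commute)

lemma norm_Yt_sub_sq: "(norm_Yt_sub D s p)\<^sup>2 = inner_Yt_sub D s p p"
  by (simp add: norm_Yt_sub_def inner_Yt_sub_nonneg)

text \<open>The limit \<open>t \<rightarrow> 0\<close> in the first-order optimality condition below.\<close>

lemma nonneg_if_nonneg_perturbed:
  fixes x c :: real
  assumes "\<And>t. 0 < t \<Longrightarrow> t < 1 \<Longrightarrow> 0 \<le> x + t * c"
  shows "0 \<le> x"
proof (rule tendsto_lowerbound)
  show "((\<lambda>t. x + t * c) \<longlongrightarrow> x) (at_right 0)"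
    by (auto intro!: tendsto_eq_intros)
  show "\<forall>\<^sub>F t in at_right 0. 0 \<le> x + t * c"
    unfolding eventually_at_right_field using assms by (intro exI[of _ 1]) auto
qed simp

text \<open>Infinite values are excluded by comparison with a point of the domain of \<open>Fs s\<close> and with the zero
field.  Minimality in the first argument says that the supremum defining the conjugate at \<open>divp p\<close> is
attained at \<open>u\<close>; maximality in the second argument is a concave quadratic problem on a convex set and gives
a variational inequality.\<close>

lemma local_saddle:
  assumes D: "decomposition (D :: 'p::finite decomp)" and s: "s \<in> subs D" and \<alpha>: "0 < \<alpha>" and \<tau>: "0 < \<tau>"
    and proper: "proper_on (X_sub D s) (Fs s)"
    and saddle: "saddle_point (X_sub D s) (Yt_sub D s) (local_functional D \<alpha> \<tau> Fs s phat) u p"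
  shows "Fs s u \<noteq> \<infinity>" and "p \<in> Ct_sub D s"
    and "\<And>v. v \<in> X_sub D s \<Longrightarrow> Fs s v \<noteq> \<infinity> \<Longrightarrow>
      v \<bullet> divp p - \<alpha> * real_of_ereal (Fs s v) \<le> u \<bullet> divp p - \<alpha> * real_of_ereal (Fs s u)"
    and "\<And>q. q \<in> Ct_sub D s \<Longrightarrow>
      (1 / \<tau>) * inner_Yt_sub D s (restr (pixels D s) phat - p) (q - p) \<le> u \<bullet> divp q - u \<bullet> divp p"
proof -
  let ?K = "local_functional D \<alpha> \<tau> Fs s phat" and ?ph = "restr (pixels D s) phat"
  let ?r = "\<lambda>p. 1 / (2 * \<tau>) * (norm_Yt_sub D s (p - ?ph))\<^sup>2"
  have u: "u \<in> X_sub D s" and p: "p \<in> Yt_sub D s"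
    and pmax: "\<And>q. q \<in> Yt_sub D s \<Longrightarrow> ?K u q \<le> ?K u p"
    and umin: "\<And>v. v \<in> X_sub D s \<Longrightarrow> ?K u p \<le> ?K v p"
    using saddle by (auto simp: saddle_point_def)
  have fin: "Fs s v = ereal (real_of_ereal (Fs s v))" if "v \<in> X_sub D s" "Fs s v \<noteq> \<infinity>" for v
    using that proper by (cases "Fs s v") (auto simp: proper_on_def)
  have K_real: "?K v q = ereal (- (v \<bullet> divp q) + \<alpha> * real_of_ereal (Fs s v) - ?r q)"
    if "v \<in> X_sub D s" "Fs s v \<noteq> \<infinity>" "q \<in> Ct_sub D s" for v q
    using that(3) unfolding local_functional_def by (subst fin[OF that(1,2)]) (simp add: chi_def)
  obtain v0 where v0: "v0 \<in> X_sub D s" "Fs s v0 \<noteq> \<infinity>" using proper by (auto simp: proper_on_def)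
  show Fu: "Fs s u \<noteq> \<infinity>"
  proof
    assume "Fs s u = \<infinity>"
    then have "?K u p = \<infinity>" using \<alpha> by (simp add: local_functional_def chi_def)
    moreover have "?K v0 p \<noteq> \<infinity>"
      unfolding local_functional_def by (subst fin[OF v0]) (simp add: chi_def)
    ultimately show False using umin[OF v0(1)] by simp
  qed
  have "0 \<in> Yt_sub D s" using subspace_0[OF subspace_Yt_sub[OF D s]] .
  then have zero: "0 \<in> Ct_sub D s" by (simp add: Ct_sub_iff[OF D s])
  show pC: "p \<in> Ct_sub D s"
  proof (rule ccontr)
    assume "p \<notin> Ct_sub D s"
    then have "?K u p = - \<infinity>"
      unfolding local_functional_def by (subst fin[OF u Fu]) (simp add: chi_def)
    with pmax[OF \<open>0 \<in> Yt_sub D s\<close>] K_real[OF u Fu zero] show False by simp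
  qed
  show "v \<bullet> divp p - \<alpha> * real_of_ereal (Fs s v) \<le> u \<bullet> divp p - \<alpha> * real_of_ereal (Fs s u)"
    if v: "v \<in> X_sub D s" "Fs s v \<noteq> \<infinity>" for v
    using umin[OF v(1)] unfolding K_real[OF v pC] K_real[OF u Fu pC] by simp
  show "(1 / \<tau>) * inner_Yt_sub D s (?ph - p) (q - p) \<le> u \<bullet> divp q - u \<bullet> divp p" if q: "q \<in> Ct_sub D s" for q
  proof -
    let ?ip = "inner_Yt_sub D s"
    note expand = bilinear_ladd[OF bilinear_inner_Yt_sub] bilinear_radd[OF bilinear_inner_Yt_sub]
      bilinear_lmul[OF bilinear_inner_Yt_sub] bilinear_rmul[OF bilinear_inner_Yt_sub]
    define d where "d = q - p"
    define x where "x = u \<bullet> divp d + (1 / \<tau>) * ?ip (p - ?ph) d"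
    have "0 \<le> x + t * (?ip d d / (2 * \<tau>))" if t: "0 < t" "t < 1" for t
    proof -
      have "(1 - t) *\<^sub>R p + t *\<^sub>R q \<in> Ct_sub D s"
        using convexD_alt[OF convex_Ct_sub[OF D s] pC q] t by simp
      then have C: "p + t *\<^sub>R d \<in> Ct_sub D s" by (simp add: d_def algebra_simps)
      then have Y: "p + t *\<^sub>R d \<in> Yt_sub D s" by (simp add: Ct_sub_def)
      have shift: "p + t *\<^sub>R d - ?ph = (p - ?ph) + t *\<^sub>R d" by simp
      have sq: "(norm_Yt_sub D s (p + t *\<^sub>R d - ?ph))\<^sup>2
          = (norm_Yt_sub D s (p - ?ph))\<^sup>2 + 2 * t * ?ip (p - ?ph) d + t * t * ?ip d d"
        unfolding shift norm_Yt_sub_sq expand using inner_Yt_sub_sym[of D s d "p - ?ph"]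
        by (simp add: algebra_simps)
      have div: "u \<bullet> divp (p + t *\<^sub>R d) = u \<bullet> divp p + t * (u \<bullet> divp d)"
        by (simp add: linear_add[OF linear_divp] linear_scale[OF linear_divp] inner_add_right)
      have "0 \<le> u \<bullet> divp (p + t *\<^sub>R d) - u \<bullet> divp p + ?r (p + t *\<^sub>R d) - ?r p"
        using pmax[OF Y] unfolding K_real[OF u Fu pC] K_real[OF u Fu C] by simp
      also have "\<dots> = t * (x + t * (?ip d d / (2 * \<tau>)))"
        unfolding sq div x_def using \<tau> by (simp add: field_simps)
      finally show ?thesis using t by (simp add: zero_le_mult_iff)
    qed
    then have "0 \<le> x" by (rule nonneg_if_nonneg_perturbed)
    moreover have "?ip (?ph - p) d = - ?ip (p - ?ph) d"
      using bilinear_lneg[OF bilinear_inner_Yt_sub, of D s "p - ?ph" d] by simp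
    ultimately show ?thesis
      by (simp add: x_def d_def linear_diff[OF linear_divp] inner_diff_right)
  qed
qed

section \<open>The dual energy and the Lagrangian\<close>

locale model_problem =
  fixes D :: "'p::finite decomp" and \<alpha> :: real and F :: "real ^ 'p \<Rightarrow> ereal"
    and Fs :: "nat \<Rightarrow> real ^ 'p \<Rightarrow> ereal"
  assumes D: "decomposition D" and \<alpha>_pos: "0 < \<alpha>"
    and F_pcl: "proper_convex_lsc_on UNIV F"
    and Fs_pcl: "\<And>s. s \<in> subs D \<Longrightarrow> proper_convex_lsc_on (X_sub D s) (Fs s)"
    and F_split: "\<And>v. F v = (\<Sum>s\<in>subs D. Fs s (restr (pixels D s) v))"
begin

definition domF :: "(real ^ 'p) set" where "domF = {v. F v \<noteq> \<infinity>}"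
definition f :: "real ^ 'p \<Rightarrow> real" where "f v = real_of_ereal (F v)"
definition fs :: "nat \<Rightarrow> real ^ 'p \<Rightarrow> real" where "fs s v = real_of_ereal (Fs s v)"

text \<open>The real number \<open>c\<close> bounds \<open>(\<alpha> F)\<^sup>*(div p)\<close>.  Working with bounds avoids extended real arithmetic.\<close>

definition dual_bound :: "rt0 ^ 'p \<Rightarrow> real \<Rightarrow> bool" where
  "dual_bound p c \<longleftrightarrow> (\<forall>v\<in>domF. v \<bullet> divp p - \<alpha> * f v \<le> c)"

definition Dom :: "(rt0 ^ 'p) set" where "Dom = {p \<in> Ct D. \<exists>c. dual_bound p c}"

text \<open>The value \<open>(\<alpha> F)\<^sup>*(div p)\<close>, meaningful on \<open>Dom\<close>, where the supremum is finite.\<close>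

definition g :: "rt0 ^ 'p \<Rightarrow> real" where "g p = (SUP v\<in>domF. v \<bullet> divp p - \<alpha> * f v)"

lemma Fs_proper: "s \<in> subs D \<Longrightarrow> proper_on (X_sub D s) (Fs s)"
  using Fs_pcl by (simp add: proper_convex_lsc_on_def)

lemma Fs_not_MInf: "s \<in> subs D \<Longrightarrow> v \<in> X_sub D s \<Longrightarrow> Fs s v \<noteq> - \<infinity>"
  using Fs_proper by (auto simp: proper_on_def)

lemma Fs_eq: "s \<in> subs D \<Longrightarrow> v \<in> X_sub D s \<Longrightarrow> Fs s v \<noteq> \<infinity> \<Longrightarrow> Fs s v = ereal (fs s v)"
  using Fs_not_MInf by (cases "Fs s v") (auto simp: fs_def)

lemma F_not_MInf: "F v \<noteq> - \<infinity>"
  using F_pcl by (auto simp: proper_convex_lsc_on_def proper_on_def)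

lemma F_eq: "v \<in> domF \<Longrightarrow> F v = ereal (f v)"
  using F_not_MInf by (cases "F v") (auto simp: f_def domF_def)

lemma domF_nonempty: "domF \<noteq> {}"
  using F_pcl by (auto simp: proper_convex_lsc_on_def proper_on_def domF_def)

lemma domF_iff: "v \<in> domF \<longleftrightarrow> (\<forall>s\<in>subs D. Fs s (restr (pixels D s) v) \<noteq> \<infinity>)"
  by (simp add: domF_def F_split sum_Pinfty)

lemma f_split: "v \<in> domF \<Longrightarrow> f v = (\<Sum>s\<in>subs D. fs s (restr (pixels D s) v))"
proof -
  assume v: "v \<in> domF"
  have "F v = (\<Sum>s\<in>subs D. ereal (fs s (restr (pixels D s) v)))"
    unfolding F_split using v restr_in_X_sub
    by (intro sum.cong refl Fs_eq) (auto simp: domF_iff)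
  then show ?thesis by (simp add: f_def)
qed

lemma dual_split:
  assumes "v \<in> domF"
  shows "v \<bullet> divp p - \<alpha> * f v = (\<Sum>s\<in>subs D. restr (pixels D s) v \<bullet> divp (restr (pixels D s) p)
      - \<alpha> * fs s (restr (pixels D s) v))"
  unfolding f_split[OF assms] inner_split[OF D, of v] divp_restr
  by (simp add: sum_subtractf sum_distrib_left)

lemma domF_convex: "convex domF" and f_convex: "convex_on domF (\<lambda>v. \<alpha> * f v)"
proof -
  have cvx: "F ((1 - t) *\<^sub>R x + t *\<^sub>R y) \<le> ereal (1 - t) * F x + ereal t * F y" if "0 < t" "t < 1" for t x y
    using F_pcl that by (auto simp: proper_convex_lsc_on_def ereal_convex_on_def)
  have key: "(1 - t) *\<^sub>R x + t *\<^sub>R y \<in> domF \<and> f ((1 - t) *\<^sub>R x + t *\<^sub>R y) \<le> (1 - t) * f x + t * f y"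
    if "x \<in> domF" "y \<in> domF" "0 < t" "t < 1" for x y t
  proof -
    have le: "F ((1 - t) *\<^sub>R x + t *\<^sub>R y) \<le> ereal ((1 - t) * f x + t * f y)"
      using cvx[OF that(3,4), of x y] by (simp add: F_eq[OF that(1)] F_eq[OF that(2)])
    then have "(1 - t) *\<^sub>R x + t *\<^sub>R y \<in> domF" by (auto simp: domF_def)
    with le show ?thesis using F_eq by simp
  qed
  show dom: "convex domF"
    unfolding convex_alt
  proof (intro ballI allI impI)
    fix x y :: "real ^ 'p" and t :: real
    assume "x \<in> domF" "y \<in> domF" "0 \<le> t \<and> t \<le> 1"
    then show "(1 - t) *\<^sub>R x + t *\<^sub>R y \<in> domF"
      using key[of x y t] by (cases "t = 0"; cases "t = 1") auto
  qed
  show "convex_on domF (\<lambda>v. \<alpha> * f v)"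
  proof (rule convex_onI[OF _ dom])
    fix t :: real and x y assume "0 < t" "t < 1" "x \<in> domF" "y \<in> domF"
    then have "\<alpha> * f ((1 - t) *\<^sub>R x + t *\<^sub>R y) \<le> \<alpha> * ((1 - t) * f x + t * f y)"
      using key \<alpha>_pos by (intro mult_left_mono) auto
    then show "\<alpha> * f ((1 - t) *\<^sub>R x + t *\<^sub>R y) \<le> (1 - t) * (\<alpha> * f x) + t * (\<alpha> * f y)"
      by (simp add: algebra_simps)
  qed
qed

lemma g_upper: "p \<in> Dom \<Longrightarrow> v \<in> domF \<Longrightarrow> v \<bullet> divp p - \<alpha> * f v \<le> g p"
  unfolding g_def by (rule cSUP_upper) (auto simp: Dom_def dual_bound_def bdd_above_def)

lemma g_least: "dual_bound p c \<Longrightarrow> g p \<le> c"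
  unfolding g_def dual_bound_def by (intro cSUP_least domF_nonempty) auto

lemma dual_bound_g: "p \<in> Dom \<Longrightarrow> dual_bound p (g p)"
  using g_upper by (simp add: dual_bound_def)

lemma fconj_not_MInf:
  assumes "s \<in> subs D" shows "fconj (X_sub D s) (Fs s) w \<noteq> - \<infinity>"
proof -
  obtain v where v: "v \<in> X_sub D s" "Fs s v \<noteq> \<infinity>" using Fs_proper[OF assms] by (auto simp: proper_on_def)
  have "ereal (v \<bullet> w) - Fs s v \<le> fconj (X_sub D s) (Fs s) w"
    unfolding fconj_def using v(1) by (rule SUP_upper)
  then show ?thesis using Fs_eq[OF assms v] by auto
qed

abbreviation local_dual :: "nat \<Rightarrow> rt0 ^ 'p \<Rightarrow> ereal" where
  "local_dual s p \<equiv> ereal \<alpha> * fconj (X_sub D s) (Fs s) ((1 / \<alpha>) *\<^sub>R divp (restr (pixels D s) p))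
     + chi (Ct_sub D s) (restr (pixels D s) p)"

text \<open>The conjugate of a separable function is the sum of the conjugates: functions on the subdomains can
be chosen independently and glued together.\<close>

lemma sum_local_dual_le_iff:
  "(\<Sum>s\<in>subs D. local_dual s p) \<le> ereal c \<longleftrightarrow> p \<in> Ct D \<and> dual_bound p c"
proof
  let ?w = "\<lambda>s. divp (restr (pixels D s) p)"
  assume le: "(\<Sum>s\<in>subs D. local_dual s p) \<le> ereal c"
  then have "(\<Sum>s\<in>subs D. local_dual s p) \<noteq> \<infinity>" by auto
  then have fin: "local_dual s p \<noteq> \<infinity>" if "s \<in> subs D" for s
    using that by (auto simp: sum_Pinfty)
  have C: "restr (pixels D s) p \<in> Ct_sub D s" if "s \<in> subs D" for s
    using fin[OF that] fconj_not_MInf[OF that]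
    by (cases "restr (pixels D s) p \<in> Ct_sub D s") (auto simp: chi_def)
  then have "p \<in> Ct D" by (simp add: Ct_iff_Ct_sub[OF D])
  moreover have "v \<bullet> divp p - \<alpha> * f v \<le> c" if v: "v \<in> domF" for v
  proof -
    have "ereal (v \<bullet> divp p - \<alpha> * f v)
        = (\<Sum>s\<in>subs D. ereal (restr (pixels D s) v \<bullet> ?w s - \<alpha> * fs s (restr (pixels D s) v)))"
      unfolding dual_split[OF v] by simp
    also have "\<dots> \<le> (\<Sum>s\<in>subs D. local_dual s p)"
    proof (rule sum_mono)
      fix s assume s: "s \<in> subs D"
      let ?v = "restr (pixels D s) v"
      have Fv: "Fs s ?v = ereal (fs s ?v)"
        using v s by (intro Fs_eq restr_in_X_sub) (auto simp: domF_iff)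
      have "ereal (?v \<bullet> ((1 / \<alpha>) *\<^sub>R ?w s)) - Fs s ?v \<le> fconj (X_sub D s) (Fs s) ((1 / \<alpha>) *\<^sub>R ?w s)"
        unfolding fconj_def by (intro SUP_upper restr_in_X_sub)
      then have "ereal \<alpha> * (ereal (?v \<bullet> ((1 / \<alpha>) *\<^sub>R ?w s)) - Fs s ?v)
          \<le> ereal \<alpha> * fconj (X_sub D s) (Fs s) ((1 / \<alpha>) *\<^sub>R ?w s)"
        using \<alpha>_pos by (intro ereal_mult_left_mono) auto
      moreover have "ereal \<alpha> * (ereal (?v \<bullet> ((1 / \<alpha>) *\<^sub>R ?w s)) - Fs s ?v) = ereal (?v \<bullet> ?w s - \<alpha> * fs s ?v)"
        using \<alpha>_pos by (simp add: Fv right_diff_distrib)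
      ultimately show "ereal (?v \<bullet> ?w s - \<alpha> * fs s ?v) \<le> local_dual s p"
        using C[OF s] by (simp add: chi_def)
    qed
    also note le
    finally show ?thesis by simp
  qed
  ultimately show "p \<in> Ct D \<and> dual_bound p c" by (simp add: dual_bound_def)
next
  let ?w = "\<lambda>s. divp (restr (pixels D s) p)"
  assume R: "p \<in> Ct D \<and> dual_bound p c"
  let ?A = "\<lambda>s. {v \<in> X_sub D s. Fs s v \<noteq> \<infinity>}"
  have "local_dual s p \<le> (SUP v\<in>?A s. ereal (v \<bullet> ?w s - \<alpha> * fs s v))" (is "_ \<le> ?M s") if s: "s \<in> subs D" for s
  proof -
    have "fconj (X_sub D s) (Fs s) ((1 / \<alpha>) *\<^sub>R ?w s) \<le> ereal (1 / \<alpha>) * ?M s"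
      unfolding fconj_def
    proof (rule SUP_least)
      fix v assume v: "v \<in> X_sub D s"
      show "ereal (v \<bullet> ((1 / \<alpha>) *\<^sub>R ?w s)) - Fs s v \<le> ereal (1 / \<alpha>) * ?M s"
      proof (cases "Fs s v = \<infinity>")
        case False
        have "ereal (v \<bullet> ((1 / \<alpha>) *\<^sub>R ?w s)) - Fs s v = ereal (1 / \<alpha>) * ereal (v \<bullet> ?w s - \<alpha> * fs s v)"
          using \<alpha>_pos by (simp add: Fs_eq[OF s v False] right_diff_distrib)
        also have "\<dots> \<le> ereal (1 / \<alpha>) * ?M s"
          using v False \<alpha>_pos by (intro ereal_mult_left_mono SUP_upper) auto
        finally show ?thesis .
      qed simp
    qed
    then have "ereal \<alpha> * fconj (X_sub D s) (Fs s) ((1 / \<alpha>) *\<^sub>R ?w s) \<le> ereal \<alpha> * (ereal (1 / \<alpha>) * ?M s)"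
      using \<alpha>_pos by (intro ereal_mult_left_mono) auto
    also have "\<dots> = ?M s"
      using \<alpha>_pos by (simp add: mult.assoc[symmetric] one_ereal_def[symmetric])
    finally show ?thesis using R s by (simp add: Ct_iff_Ct_sub[OF D] chi_def)
  qed
  then have "(\<Sum>s\<in>subs D. local_dual s p) \<le> (\<Sum>s\<in>subs D. ?M s)" by (rule sum_mono)
  also have "\<dots> \<le> ereal c"
  proof (rule sum_SUP_le)
    show "?A s \<noteq> {}" if "s \<in> subs D" for s
      using Fs_proper[OF that] by (auto simp: proper_on_def)
    fix v assume v: "\<And>s. s \<in> subs D \<Longrightarrow> v s \<in> ?A s"
    then obtain x where x: "\<And>s. s \<in> subs D \<Longrightarrow> restr (pixels D s) x = v s"
      using glue[OF D, of v] by auto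
    have xd: "x \<in> domF" using v x by (simp add: domF_iff)
    have "(\<Sum>s\<in>subs D. v s \<bullet> ?w s - \<alpha> * fs s (v s)) = x \<bullet> divp p - \<alpha> * f x"
      unfolding dual_split[OF xd] by (intro sum.cong) (auto simp: x)
    also have "\<dots> \<le> c" using R xd by (simp add: dual_bound_def)
    finally show "(\<Sum>s\<in>subs D. v s \<bullet> ?w s - \<alpha> * fs s (v s)) \<le> c" .
  qed simp
  finally show "(\<Sum>s\<in>subs D. local_dual s p) \<le> ereal c" .
qed

lemma sum_local_dual: "(\<Sum>s\<in>subs D. local_dual s p) = (if p \<in> Dom then ereal (g p) else \<infinity>)"
proof -
  let ?S = "\<Sum>s\<in>subs D. local_dual s p"
  have nMInf: "?S \<noteq> - \<infinity>"
  proof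
    assume S: "?S = - \<infinity>"
    have b: "dual_bound p c" for c using sum_local_dual_le_iff[of p c] S by simp
    obtain v where v: "v \<in> domF" using domF_nonempty by auto
    with b[of "v \<bullet> divp p - \<alpha> * f v - 1"] show False by (auto simp: dual_bound_def)
  qed
  show ?thesis
  proof (cases "p \<in> Dom")
    case True
    then have le: "?S \<le> ereal (g p)"
      using dual_bound_g by (simp add: sum_local_dual_le_iff Dom_def)
    with nMInf obtain c where c: "?S = ereal c" by (cases ?S) auto
    then have "dual_bound p c" using sum_local_dual_le_iff[of p c] by simp
    with le c True show ?thesis using g_least by (simp add: antisym)
  next
    case False
    then have "\<not> ?S \<le> ereal c" for c using sum_local_dual_le_iff[of p c] by (auto simp: Dom_def)
    then have "?S = \<infinity>" using nMInf by (cases ?S) auto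
    with False show ?thesis by simp
  qed
qed

lemma Lagrangian_eq:
  "Lagrangian D \<alpha> Fs p l = (if p \<in> Dom then ereal (g p + inner_Gamma D (jump D p) l) else \<infinity>)"
  unfolding Lagrangian_def sum_local_dual by simp

lemma Dom_subset_Yt: "Dom \<subseteq> Yt D"
  by (auto simp: Dom_def Ct_def)

lemma Dom_bounded: "bounded Dom"
  by (rule bounded_subset[OF compact_imp_bounded[OF compact_Ct[OF D]]]) (auto simp: Dom_def)

text \<open>Jensen's inequality for \<open>g\<close>, which is a supremum of affine functions.\<close>

lemma average_in_Dom:
  assumes "finite I" "I \<noteq> {}" "\<And>i. i \<in> I \<Longrightarrow> x i \<in> Dom"
  shows "(1 / real (card I)) *\<^sub>R (\<Sum>i\<in>I. x i) \<in> Dom"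
    and "g ((1 / real (card I)) *\<^sub>R (\<Sum>i\<in>I. x i)) \<le> (1 / real (card I)) * (\<Sum>i\<in>I. g (x i))"
proof -
  let ?m = "(1 / real (card I)) *\<^sub>R (\<Sum>i\<in>I. x i)"
  have n: "0 < real (card I)" using assms by (simp add: card_gt_0_iff)
  have "(\<Sum>i\<in>I. (1 / real (card I)) *\<^sub>R x i) \<in> Ct D"
    using assms n by (intro convex_sum convex_Ct[OF D]) (auto simp: Dom_def)
  then have C: "?m \<in> Ct D" by (simp add: scaleR_sum_right)
  have b: "dual_bound ?m ((1 / real (card I)) * (\<Sum>i\<in>I. g (x i)))"
    unfolding dual_bound_def
  proof
    fix v assume v: "v \<in> domF"
    have "v \<bullet> divp ?m - \<alpha> * f v = (1 / real (card I)) * (\<Sum>i\<in>I. v \<bullet> divp (x i) - \<alpha> * f v)"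
      using n by (simp add: linear_scale[OF linear_divp] linear_sum[OF linear_divp] inner_sum_right
          sum_subtractf right_diff_distrib)
    also have "\<dots> \<le> (1 / real (card I)) * (\<Sum>i\<in>I. g (x i))"
      using assms v g_upper by (intro mult_left_mono sum_mono) auto
    finally show "v \<bullet> divp ?m - \<alpha> * f v \<le> (1 / real (card I)) * (\<Sum>i\<in>I. g (x i))" .
  qed
  with C show "?m \<in> Dom" by (auto simp: Dom_def)
  show "g ?m \<le> (1 / real (card I)) * (\<Sum>i\<in>I. g (x i))" by (rule g_least[OF b])
qed

text \<open>As a supremum of continuous functions, \<open>g\<close> is lower semicontinuous.\<close>

lemma g_closed:
  assumes X: "\<And>k. X k \<in> Dom" "X \<longlonglongrightarrow> x" and C: "\<And>k. g (X k) \<le> C k" "C \<longlonglongrightarrow> C0"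
  shows "x \<in> Dom \<and> g x \<le> C0"
proof -
  have "x \<in> Ct D"
    using X(1) by (intro closed_sequentially[OF compact_imp_closed[OF compact_Ct[OF D]] _ X(2)]) (auto simp: Dom_def)
  moreover have b: "dual_bound x C0"
    unfolding dual_bound_def
  proof
    fix v assume v: "v \<in> domF"
    have "bounded_linear (divp :: rt0 ^ 'p \<Rightarrow> _)"
      using linear_divp linear_conv_bounded_linear by blast
    from bounded_linear.tendsto[OF this X(2)]
    have "(\<lambda>k. v \<bullet> divp (X k) - \<alpha> * f v) \<longlonglongrightarrow> v \<bullet> divp x - \<alpha> * f v"
      by (intro tendsto_intros)
    moreover have "v \<bullet> divp (X k) - \<alpha> * f v \<le> C k" for k
      using g_upper[OF X(1) v, of k] C(1)[of k] by linarith
    ultimately show "v \<bullet> divp x - \<alpha> * f v \<le> C0"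
      using C(2) by (intro LIMSEQ_le) auto
  qed
  ultimately show ?thesis using g_least[OF b] by (auto simp: Dom_def)
qed

text \<open>The separation argument applies with \<open>K = div C\<close>, whose support function is the total variation.  It
gives a maximiser \<open>p\<close> of \<open>\<langle>u, div \<cdot>\<rangle>\<close>; the dual solution is \<open>- p\<close>, as \<open>C\<close> is symmetric.  A competitor \<open>x\<close> is
compared with \<open>- p\<close> via its average, which lies in \<open>C\<close>.\<close>

lemma saddle_from_minimizer:
  assumes min: "model_minimizer D \<alpha> F u"
  shows "\<exists>ps ls. ps \<in> Dom \<and> (\<forall>e\<in>Gamma D. jump D ps e = 0) \<and>
    (\<forall>x\<in>Dom. g ps \<le> g x + inner_Gamma D (jump D x) ls)"
proof -
  have TV: "TV D v = (SUP k\<in>divp ` C_set D. v \<bullet> k)" for v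
    by (simp add: TV_def image_image)
  have le: "ereal \<alpha> * F u + ereal (TV D u) \<le> ereal \<alpha> * F v + ereal (TV D v)" for v
    using min by (simp add: model_minimizer_def)
  have u: "u \<in> domF"
  proof (rule ccontr)
    assume "u \<notin> domF"
    then have "F u = \<infinity>" by (simp add: domF_def)
    moreover obtain v where "v \<in> domF" using domF_nonempty by auto
    ultimately show False using le[of v] \<alpha>_pos F_eq[of v] by simp
  qed
  have bl: "bounded_linear (divp :: rt0 ^ 'p \<Rightarrow> _)"
    using linear_divp linear_conv_bounded_linear by blast
  have K: "compact (divp ` C_set D)" "convex (divp ` C_set D)" "divp ` C_set D \<noteq> {}"
    using zero_in_C[OF D]
    by (auto intro!: compact_continuous_image linear_continuous_on bl compact_C[OF D]
        convex_linear_image linear_divp convex_C[OF D])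
  have "\<alpha> * f u + (SUP k\<in>divp ` C_set D. u \<bullet> k) \<le> \<alpha> * f v + (SUP k\<in>divp ` C_set D. v \<bullet> k)" if "v \<in> domF" for v
    using le[of v] F_eq[OF u] F_eq[OF that] unfolding TV by simp
  from support_point_of_minimizer[OF domF_convex f_convex K u this]
  obtain p where p: "p \<in> C_set D" and
    pu: "\<And>v. v \<in> domF \<Longrightarrow> \<alpha> * f u + u \<bullet> divp p \<le> \<alpha> * f v + v \<bullet> divp p"
    and pmax: "\<And>q. q \<in> C_set D \<Longrightarrow> u \<bullet> divp q \<le> u \<bullet> divp p"
    by auto
  define ps where "ps = - p"
  have div_ps: "divp ps = - divp p" by (simp add: ps_def linear_neg[OF linear_divp])
  have psC: "ps \<in> C_set D" unfolding ps_def by (rule minus_in_C[OF D p])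
  have b: "dual_bound ps (u \<bullet> divp ps - \<alpha> * f u)"
    using pu by (auto simp: dual_bound_def div_ps algebra_simps)
  have psD: "ps \<in> Dom" using b psC C_subset_Ct[OF D] by (auto simp: Dom_def)
  have jump0: "jump D ps e = 0" if e: "e \<in> Gamma D" for e
  proof -
    obtain T T' \<kappa> where "pixel_edge D e T" "pixel_edge D e T'"
      and J: "\<And>q. jump D q e = \<kappa> * (normal_comp (q $ T) e - normal_comp (q $ T') e)"
      using Gamma_pixels[OF D e] by metis
    then have "normal_comp (ps $ T) e = normal_comp (ps $ T') e"
      using psC unfolding C_set_iff[OF D] Y_space_iff[OF D] by blast
    then show ?thesis by (simp add: J)
  qed
  obtain ls where ls: "\<And>q. q \<in> Yt D \<Longrightarrow> u \<bullet> divp (field_of_dofs D (edge_average D q)) = u \<bullet> divp q + inner_Gamma D (jump D q) ls"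
    using multiplier_for_averaging[OF D, of u] by blast
  have "g ps \<le> g x + inner_Gamma D (jump D x) ls" if x: "x \<in> Dom" for x
  proof -
    have "x \<in> Ct D" "x \<in> Yt D" using x by (auto simp: Dom_def Ct_def)
    have "g ps \<le> u \<bullet> divp ps - \<alpha> * f u" by (rule g_least[OF b])
    also have "u \<bullet> divp ps \<le> u \<bullet> divp (field_of_dofs D (edge_average D x))"
      using pmax[OF minus_in_C[OF D averaged_field_in_C[OF D \<open>x \<in> Ct D\<close>]]]
      by (simp add: div_ps linear_neg[OF linear_divp])
    also have "\<dots> - \<alpha> * f u = (u \<bullet> divp x - \<alpha> * f u) + inner_Gamma D (jump D x) ls"
      by (simp add: ls[OF \<open>x \<in> Yt D\<close>])
    also have "\<dots> \<le> g x + inner_Gamma D (jump D x) ls"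
      using g_upper[OF x u] by simp
    finally show ?thesis by simp
  qed
  with psD jump0 show ?thesis by blast
qed

text \<open>The local problems add up to the variational inequality of the abstract primal step.  The value
\<open>\<langle>u, div p\<rangle> - \<alpha> F(u)\<close> equals \<open>g p\<close> and its counterpart at \<open>q\<close> is at most \<open>g q\<close>; the adjoint of the jump
operator in the proximal centre becomes the coupling term.\<close>

lemma algorithm_step:
  assumes \<tau>: "0 < \<tau>"
    and saddle: "\<And>s. s \<in> subs D \<Longrightarrow> saddle_point (X_sub D s) (Yt_sub D s)
      (local_functional D \<alpha> \<tau> Fs s (p0 - \<tau> *\<^sub>R jump_adj D l)) (restr (pixels D s) u) (restr (pixels D s) p)"
  shows "p \<in> Dom"
    and "q \<in> Dom \<Longrightarrow> g p + (1 / \<tau>) * inner_Yt D (p0 - p) (q - p)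
      \<le> g q + (\<Sum>e\<in>Gamma D. jump D (q - p) e * l e)"
proof -
  let ?R = "\<lambda>s. restr (pixels D s)"
  let ?ph = "p0 - \<tau> *\<^sub>R jump_adj D l"
  note loc = local_saddle[OF D _ \<alpha>_pos \<tau> Fs_proper saddle]
  have u: "u \<in> domF" using loc(1) by (simp add: domF_iff)
  have pC: "p \<in> Ct D" using loc(2) by (simp add: Ct_iff_Ct_sub[OF D])
  have b: "dual_bound p (u \<bullet> divp p - \<alpha> * f u)"
    unfolding dual_bound_def
  proof
    fix v assume v: "v \<in> domF"
    show "v \<bullet> divp p - \<alpha> * f v \<le> u \<bullet> divp p - \<alpha> * f u"
      unfolding dual_split[OF v] dual_split[OF u] fs_def
      using v by (intro sum_mono loc(3)) (auto simp: restr_in_X_sub domF_iff)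
  qed
  show pD: "p \<in> Dom" using pC b by (auto simp: Dom_def)
  assume q: "q \<in> Dom"
  have "(1 / \<tau>) * inner_Yt D (?ph - p) (q - p)
      = (\<Sum>s\<in>subs D. (1 / \<tau>) * inner_Yt_sub D s (?R s ?ph - ?R s p) (?R s q - ?R s p))"
    by (simp add: inner_Yt_def linear_diff[OF linear_restr] sum_distrib_left)
  also have "\<dots> \<le> (\<Sum>s\<in>subs D. ?R s u \<bullet> divp (?R s q) - ?R s u \<bullet> divp (?R s p))"
    using q by (intro sum_mono loc(4)) (auto simp: Dom_def Ct_iff_Ct_sub[OF D])
  also have "\<dots> = u \<bullet> divp q - u \<bullet> divp p"
    by (simp add: sum_subtractf divp_restr inner_split[OF D, symmetric])
  finally have 1: "(1 / \<tau>) * inner_Yt D (?ph - p) (q - p) \<le> u \<bullet> divp q - u \<bullet> divp p" .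
  have "q - p \<in> Yt D"
    using q pD Dom_subset_Yt by (intro subspace_diff[OF subspace_Yt[OF D]]) auto
  then have adj: "inner_Yt D (jump_adj D l) (q - p) = (\<Sum>e\<in>Gamma D. jump D (q - p) e * l e)"
    using jump_adj(2)[OF D, of "q - p" l] inner_Yt_sym[of D] by (simp add: inner_Gamma_def)
  have "?ph - p = (p0 - p) - \<tau> *\<^sub>R jump_adj D l" by simp
  then have "(1 / \<tau>) * inner_Yt D (?ph - p) (q - p)
      = (1 / \<tau>) * inner_Yt D (p0 - p) (q - p) - (\<Sum>e\<in>Gamma D. jump D (q - p) e * l e)"
    using \<tau> by (simp only: bilinear_lsub[OF bilinear_inner_Yt] bilinear_lmul[OF bilinear_inner_Yt] adj)
      (simp add: field_simps)
  with 1 g_least[OF b] g_upper[OF q u]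
  show "g p + (1 / \<tau>) * inner_Yt D (p0 - p) (q - p) \<le> g q + (\<Sum>e\<in>Gamma D. jump D (q - p) e * l e)"
    by linarith
qed

end

section \<open>Convergence of the domain decomposition method\<close>

theorem theorem4p3:
  fixes D :: "'p::finite decomp"
    and \<alpha> L \<tau> \<sigma> :: real
    and F :: "real ^ 'p \<Rightarrow> ereal"
    and Fs :: "nat \<Rightarrow> real ^ 'p \<Rightarrow> ereal"
    and u :: "nat \<Rightarrow> real ^ 'p"
    and p :: "nat \<Rightarrow> rt0 ^ 'p"
    and lam :: "nat \<Rightarrow> edge \<Rightarrow> real"
  assumes "decomposition D"
    and "\<alpha> > 0"
    and "proper_convex_lsc_on UNIV F"
    and "\<And>s. s \<in> subs D \<Longrightarrow> proper_convex_lsc_on (X_sub D s) (Fs s)"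
    and "\<And>v. F v = (\<Sum>s\<in>subs D. Fs s (restr (pixels D s) v))"
    and "rel_interior {v. F v < \<infinity>} \<noteq> {}"
    and "L > 2" and "\<tau> > 0" and "\<sigma> > 0" and "\<tau> * \<sigma> = 1 / L"
    and "generated_by_algorithm D \<alpha> \<tau> \<sigma> Fs u p lam"
  shows "((\<exists>v. model_minimizer D \<alpha> F v) \<longrightarrow>
           (\<exists>pstar lamstar. saddle_point (Yt D) UNIV (Lagrangian D \<alpha> Fs) pstar lamstar \<and>
              (\<lambda>n. norm_Yt D (p n - pstar)) \<longlonglongrightarrow> 0 \<and>
              (\<lambda>n. norm_Gamma D (\<lambda>e. lam n e - lamstar e)) \<longlonglongrightarrow> 0)) \<and>
         (\<forall>n\<ge>1. \<forall>q\<in>Yt D. \<forall>l :: edge \<Rightarrow> real.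
            Lagrangian D \<alpha> Fs ((1 / real n) *\<^sub>R (\<Sum>i=1..n. p i)) l
            - Lagrangian D \<alpha> Fs q (\<lambda>e. (1 / real n) * (\<Sum>i=1..n. lam i e))
            \<le> ereal (1 / real n * (1 / \<tau> * (norm_Yt D (q - p 0))\<^sup>2
                + 1 / \<sigma> * (norm_Gamma D (\<lambda>e. l e - lam 0 e))\<^sup>2)))"
proof -
  interpret model_problem D \<alpha> F Fs by unfold_locales (use assms in auto)
  have p_0: "p 0 = 0"
    and dual: "\<And>n. lam (Suc n) = (\<lambda>e. lam n e + \<sigma> * jump D (2 *\<^sub>R p n - (if n = 0 then 0 else p (n - 1))) e)"
    and saddle: "\<And>n s. s \<in> subs D \<Longrightarrow> saddle_point (X_sub D s) (Yt_sub D s)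
      (local_functional D \<alpha> \<tau> Fs s (p n - \<tau> *\<^sub>R jump_adj D (lam (Suc n))))
      (restr (pixels D s) (u (Suc n))) (restr (pixels D s) (p (Suc n)))"
    using assms(11) unfolding generated_by_algorithm_def Let_def by blast+
  interpret primal_dual_iteration Dom g "inner_Yt D" "Gamma D" "jump D" \<tau> \<sigma> 2 "sqrt (2 / L)" p lam
  proof (rule primal_dual_iteration.intro)
    show "finite (Gamma D)" by (rule finite_Gamma[OF D])
    show "bilinear (inner_Yt D)" by (rule bilinear_inner_Yt)
    show "inner_Yt D x y = inner_Yt D y x" for x y by (rule inner_Yt_sym)
    show "0 \<le> inner_Yt D x x" for x by (rule inner_Yt_nonneg)
    show "linear (\<lambda>x. jump D x e)" for e by (rule linear_jump)
    show "(\<Sum>e\<in>Gamma D. (jump D x e)\<^sup>2) \<le> 2 * inner_Yt D x x" for x by (rule jump_bound[OF D])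
    show "\<tau> * \<sigma> * 2 \<le> (sqrt (2 / L))\<^sup>2" using assms(7,10) by simp
    show "p (Suc n) \<in> Dom" for n by (rule algorithm_step(1)[OF assms(8) saddle])
    show "lam (Suc n) e = lam n e + \<sigma> * jump D (2 *\<^sub>R p n - p (n - 1)) e" for n e
      by (simp add: dual p_0)
    show "g (p (Suc n)) + 1 / \<tau> * inner_Yt D (p n - p (Suc n)) (q - p (Suc n))
        \<le> g q + (\<Sum>e\<in>Gamma D. jump D (q - p (Suc n)) e * lam (Suc n) e)" if "q \<in> Dom" for n q
      by (rule algorithm_step(2)[OF assms(8) saddle that])
  qed (use assms p_0 in \<open>auto simp: real_sqrt_lt_1_iff\<close>)
  have lagr: "lagr x l = g x + inner_Gamma D (jump D x) l" for x l
    by (simp add: lagr_def pairing_def inner_Gamma_def)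
  have dual_sqnorm: "(norm_Gamma D l)\<^sup>2 = dual_sqnorm l" for l
    by (simp add: norm_Gamma_def inner_Gamma_def dual_sqnorm_def sum_nonneg power2_eq_square)
  have sqnorm: "(norm_Yt D x)\<^sup>2 = sqnorm x" for x
    by (simp add: norm_Yt_def sqnorm_def inner_Yt_nonneg)
  have norms: "norm_Yt D x = sqrt (sqnorm x)" "norm_Gamma D l = sqrt (dual_sqnorm l)" for x l
    by (simp_all add: norm_Yt_def sqnorm_def norm_Gamma_def inner_Gamma_def dual_sqnorm_def power2_eq_square)
  show ?thesis
  proof (intro conjI impI allI ballI)
    assume "\<exists>v. model_minimizer D \<alpha> F v"
    then obtain ps ls where s: "ps \<in> Dom" "\<And>e. e \<in> Gamma D \<Longrightarrow> jump D ps e = 0"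
        "\<And>x. x \<in> Dom \<Longrightarrow> g ps \<le> g x + inner_Gamma D (jump D x) ls"
      using saddle_from_minimizer by metis
    have J: "inner_Gamma D (jump D x) l = 0" if "\<And>e. e \<in> Gamma D \<Longrightarrow> jump D x e = 0" for x l
      using that by (simp add: inner_Gamma_def)
    have "\<exists>pb lb. pb \<in> Dom \<and> (\<forall>q\<in>Dom. lagr pb lb \<le> lagr q lb) \<and> (\<forall>e\<in>Gamma D. jump D pb e = 0)
      \<and> (\<lambda>n. sqnorm (p n - pb)) \<longlonglongrightarrow> 0 \<and> (\<lambda>n. dual_sqnorm (\<lambda>e. lam n e - lb e)) \<longlonglongrightarrow> 0"
    proof (rule convergence)
      show "ps \<in> Dom" by (rule s(1))
      show "lagr ps ls \<le> lagr x ls" if "x \<in> Dom" for x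
        using s(3)[OF that] by (simp add: lagr J s(2))
      show "lagr ps l \<le> lagr ps ls" for l by (simp add: lagr J s(2))
    qed (rule Dom_bounded, rule g_closed)
    then obtain pb lb where pb: "pb \<in> Dom" "\<And>q. q \<in> Dom \<Longrightarrow> lagr pb lb \<le> lagr q lb"
        "\<And>e. e \<in> Gamma D \<Longrightarrow> jump D pb e = 0"
      and lim: "(\<lambda>n. sqnorm (p n - pb)) \<longlonglongrightarrow> 0" "(\<lambda>n. dual_sqnorm (\<lambda>e. lam n e - lb e)) \<longlonglongrightarrow> 0"
      by blast
    have "saddle_point (Yt D) UNIV (Lagrangian D \<alpha> Fs) pb lb"
      unfolding saddle_point_def Lagrangian_eq
      using pb Dom_subset_Yt by (auto simp: J lagr)
    moreover have "(\<lambda>n. norm_Yt D (p n - pb)) \<longlonglongrightarrow> 0"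
      using tendsto_real_sqrt[OF lim(1)] by (simp add: norms)
    moreover have "(\<lambda>n. norm_Gamma D (\<lambda>e. lam n e - lb e)) \<longlonglongrightarrow> 0"
      using tendsto_real_sqrt[OF lim(2)] by (simp add: norms)
    ultimately show "\<exists>pstar lamstar. saddle_point (Yt D) UNIV (Lagrangian D \<alpha> Fs) pstar lamstar \<and>
              (\<lambda>n. norm_Yt D (p n - pstar)) \<longlonglongrightarrow> 0 \<and>
              (\<lambda>n. norm_Gamma D (\<lambda>e. lam n e - lamstar e)) \<longlonglongrightarrow> 0" by blast
  next
    fix n :: nat and q l assume n: "1 \<le> n" and q: "q \<in> Yt D"
    let ?pn = "(1 / real n) *\<^sub>R (\<Sum>i=1..n. p i)" and ?ln = "\<lambda>e. (1 / real n) * (\<Sum>i=1..n. lam i e)"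
    let ?rhs = "1 / real n * (1 / \<tau> * (norm_Yt D (q - p 0))\<^sup>2 + 1 / \<sigma> * (norm_Gamma D (\<lambda>e. l e - lam 0 e))\<^sup>2)"
    have iter: "p i \<in> Dom" if "i \<in> {1..n}" for i
      using p_Dom[of "i - 1"] that by simp
    have pn: "?pn \<in> Dom" "g ?pn \<le> (1 / real n) * (\<Sum>i=1..n. g (p i))"
      using average_in_Dom[of "{1..n}" p] iter n by simp_all
    show "Lagrangian D \<alpha> Fs ?pn l - Lagrangian D \<alpha> Fs q ?ln \<le> ereal ?rhs"
    proof (cases "q \<in> Dom")
      case False
      then show ?thesis using pn(1) by (simp add: Lagrangian_eq)
    next
      case True
      have 1: "inner_Gamma D (jump D ?pn) l = (1 / real n) * (\<Sum>i=1..n. inner_Gamma D (jump D (p i)) l)"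
        unfolding inner_Gamma_def linear_scale[OF linear_jump] linear_sum[OF linear_jump]
        by (subst sum.swap) (simp add: sum_distrib_left sum_distrib_right mult.assoc)
      have 2: "inner_Gamma D (jump D q) ?ln = (1 / real n) * (\<Sum>i=1..n. inner_Gamma D (jump D q) (lam i))"
        unfolding inner_Gamma_def
        by (subst sum.swap) (simp add: sum_distrib_left mult.left_commute)
      have g: "g q = (1 / real n) * (\<Sum>i=1..n. g q)" using n by simp
      have "(g ?pn + inner_Gamma D (jump D ?pn) l) - (g q + inner_Gamma D (jump D q) ?ln)
          \<le> (1 / real n) * (\<Sum>i=1..n. lagr (p i) l - lagr q (lam i))"
        using pn(2) unfolding 1 2 lagr by (subst g) (simp add: sum_subtractf sum.distrib algebra_simps)
      also have "\<dots> \<le> (1 / real n) * (sqnorm (q - p 0) / (2 * \<tau>) + dual_sqnorm (\<lambda>e. l e - lam 0 e) / (2 * \<sigma>))"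
        using gap_sum_bound[OF True] by (intro mult_left_mono) auto
      also have "\<dots> \<le> ?rhs"
        unfolding sqnorm dual_sqnorm using sqnorm_nonneg[of "q - p 0"] dual_sqnorm_nonneg[of "\<lambda>e. l e - lam 0 e"] \<tau>_pos \<sigma>_pos
        by (intro mult_left_mono add_mono) (simp_all add: field_simps)
      finally show ?thesis using True pn(1) by (simp add: Lagrangian_eq)
    qed
  qed
qed

end
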